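(* Let $A\ge 1$ be a real number. Then the $2$-dimensional sequence $(n,\,n\log^A n)_{n\ge1}$ has $\infty$-MPPC; that is, for Lebesgue-almost all $(\alpha_1,\alpha_2)\in\mathbb{R}^2$ the sequence $\big(\{n\alpha_1\},\{n(\log n)^A\alpha_2\}\big)_{n\ge1}$ in $[0,1)^2$ has $\infty$-PPC.
   Context: $\{\cdot\}$ denotes the fractional part and $\log^A n=(\log n)^A$. $\infty$-PPC in dimension $2$ (Poissonian pair correlation with respect to the sup-norm): for a sequence $(\boldsymbol{y}_n)$ in $[0,1)^2$, $s>0$ and $N\in\mathbb{N}$ let $$R^{(2)}_{2,\infty}(s,(\boldsymbol{y}_n),N):=\frac1N\#\Big\{1\le n\ne m\le N:\ \min_{\boldsymbol{k}\in\mathbb{Z}^2}\|\boldsymbol{y}_n-\boldsymbol{y}_m+\boldsymbol{k}\|_\infty\le \frac{s}{N^{1/2}}\Big\},$$ where ordered pairs $(n,m)$ are counted. The sequence $(\boldsymbol{y}_n)$ has $\infty$-PPC if for every $s>0$, $R^{(2)}_{2,\infty}(s,(\boldsymbol{y}_n),N)\to(2s)^2=4s^2$ as $N\to\infty$. *)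

theory Defs
  imports "HOL-Analysis.Analysis"
begin

text \<open>
  Sequences are indexed by \<open>n \<ge> 1\<close>; the value at \<open>0\<close> is never used.
  The sup-norm on the plane is \<^const>\<open>infnorm\<close>.
\<close>

text \<open>
  The minimum of the sup-norm over all integer translates.  It is written as an infimum; the
  lemma \<open>torus_infnorm_attained\<close> shows that it is attained.
\<close>
definition torus_infnorm :: "real \<times> real \<Rightarrow> real" where
  "torus_infnorm x = (INF k\<in>\<int> \<times> \<int>. infnorm (x + k))"

lemma infnorm_pair: "infnorm (a :: real, b :: real) = max \<bar>a\<bar> \<bar>b\<bar>"
proof -
  have "{\<bar>(a, b) \<bullet> i\<bar> | i. i \<in> (Basis :: (real \<times> real) set)} = {\<bar>a\<bar>, \<bar>b\<bar>}"
    by (force simp: Basis_prod_def)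
  then show ?thesis
    by (simp add: infnorm_def cSup_eq_Max)
qed

lemma torus_infnorm_attained:
  "\<exists>k\<in>\<int> \<times> \<int>. infnorm (x + k) = torus_infnorm x"
proof -
  obtain a b where x: "x = (a, b)" by force
  define k :: "real \<times> real" where "k = (- of_int (round a), - of_int (round b))"
  have k: "k \<in> \<int> \<times> \<int>" by (simp add: k_def)
  have least: "infnorm (x + k) \<le> infnorm (x + l)" if l: "l \<in> \<int> \<times> \<int>" for l
  proof -
    obtain i j :: int where "l = (of_int i, of_int j)"
      using l by (auto elim!: Ints_cases)
    then show ?thesis
      using round_diff_minimal[of a "- i"] round_diff_minimal[of b "- j"]
      by (auto simp: x k_def infnorm_pair)
  qed
  have "torus_infnorm x = infnorm (x + k)"
    unfolding torus_infnorm_def using k least by (intro cInf_eq_minimum) auto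
  with k show ?thesis by metis
qed

definition pair_corr_inf :: "real \<Rightarrow> (nat \<Rightarrow> real \<times> real) \<Rightarrow> nat \<Rightarrow> real" where
  "pair_corr_inf s y N =
     1 / real N * real (card {(n, m). n \<in> {1..N} \<and> m \<in> {1..N} \<and> n \<noteq> m \<and>
                                     torus_infnorm (y n - y m) \<le> s / real N powr (1/2)})"

definition has_inf_PPC :: "(nat \<Rightarrow> real \<times> real) \<Rightarrow> bool" where
  "has_inf_PPC y \<longleftrightarrow> (\<forall>s>0. (\<lambda>N. pair_corr_inf s y N) \<longlonglongrightarrow> (2 * s)\<^sup>2)"

definition has_inf_MPPC :: "(nat \<Rightarrow> real \<times> real) \<Rightarrow> bool" where
  "has_inf_MPPC x \<longleftrightarrow>
     (AE \<alpha> in lborel. has_inf_PPC (\<lambda>n. (frac (fst (x n) * fst \<alpha>), frac (snd (x n) * snd \<alpha>))))"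

end

theory Submission
  imports Defs
begin

text \<open>
  Write \<open>\<delta> = s / \<surd>N\<close>, let \<open>y\<close> be the second coordinate sequence, and index a pair \<open>m < n \<le> N\<close> by
  its difference \<open>h = n - m\<close> and by \<open>m\<close>.  The pair counts if \<open>h \<alpha>\<^sub>1\<close> and \<open>(y\<^sub>n - y\<^sub>m) \<alpha>\<^sub>2\<close> are both
  within \<open>\<delta>\<close> of an integer.  Replace the indicator functions by trapezoids and these by Fejer means,
  that is, by cosine polynomials whose coefficients are at most a constant times \<open>min \<delta> (1 / k)\<close>, and
  integrate the square of the resulting sum minus its mean.

  For the frequency \<open>k\<close> in \<open>\<alpha>\<^sub>2\<close>, two pairs with differences \<open>h, h'\<close> contribute the product of a
  correlation in \<open>\<alpha>\<^sub>1\<close>, which is at most of order \<open>\<delta>\<^sup>2 + \<delta> log N gcd h h' / max h h'\<close>, and of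
  \<open>min 1 (1 / (k D))\<close>, where \<open>D\<close> is the distance between the two increments of \<open>y\<close>.  By the
  Cauchy--Schwarz inequality over \<open>k\<close> it is enough to save a power of \<open>N\<close> in the number of
  quadruples with \<open>D \<le> N powr (- 2/5)\<close>.  Only the convexity of \<open>y\<close> is used for this: pairs with nearly
  equal increments form a chain in both indices, hence meet few blocks of given length, and inside
  a block two differences and one index leave at most a constant times \<open>N powr (3/5)\<close> choices for the
  remaining index.

  The resulting power saving in the variance gives almost sure convergence along \<open>N = q ^ 40\<close>,
  and monotonicity in \<open>N\<close> and \<open>s\<close> fills the gaps between these values.
\<close>

section \<open>Truncated reciprocals and convex sequences\<close>

text \<open>The correlation sum has mean of order \<open>N\<close>, so its variance must lie a power
  of \<open>N\<close> below \<open>N\<^sup>2\<close>. The squared mean of each polynomial is of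
  order \<open>1 / N\<close>; a count of order \<open>N ^ 3\<close> of quadruples with nearly equal
  increments would just fail, and the separation of increments for each single difference
  \<open>h\<close> gives no more than that. Hence the extra count with blocks. Two demands fix its
  parameters. Quadruples beyond the threshold carry a weight of order \<delta> divided by the
  threshold, so the threshold must exceed \<open>N powr (- 1/2)\<close> by a power. For block length
  \<open>M\<close> the count is, up to smaller terms,
  \<open>N / M * (N\<^sup>2 + M\<^sup>2 * threshold * N\<^sup>2)\<close>, balanced when
  \<open>M\<^sup>2 * threshold = 1\<close>; then \<open>M = N powr (1/5)\<close> gives
  \<open>N powr (14/5)\<close>. The hypothesis on \<open>A\<close> provides the rate of convexity:
  second differences at least a multiple of \<open>1 / n\<close>. One null set has to serve all
  \<open>s\<close> at once, so the final limit uses trapezoids with rational parameters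
  only.\<close>

definition trunc_inv :: "real \<Rightarrow> real" where
  "trunc_inv z = 1 / max 1 z"

lemma trunc_inv_nonneg [simp]: "0 \<le> trunc_inv z"
  and trunc_inv_le_1: "trunc_inv z \<le> 1"
  by (simp_all add: trunc_inv_def)

lemma trunc_inv_antimono: "z \<le> w \<Longrightarrow> trunc_inv w \<le> trunc_inv z"
  by (simp add: trunc_inv_def frac_le)

lemma trunc_inv_le: "0 < z \<Longrightarrow> trunc_inv z \<le> 1 / z"
  by (simp add: trunc_inv_def frac_le)

text \<open>In use \<open>z\<close> is a distance between two increments and
  \<open>trunc_inv (k * z)\<close> bounds an integral of cosines of frequency \<open>k\<close>.
  Beyond the threshold the decay in \<open>k\<close> is kept at the price \<open>1 / \<eta>\<close>,
  because \<open>max 1 z * \<eta> \<le> z\<close> there.\<close>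

lemma trunc_inv_mult_le:
  assumes "0 < \<eta>" "\<eta> \<le> 1" "0 < k" "0 \<le> z"
  shows "trunc_inv (k * z) \<le> (if z \<le> \<eta> then 1 else 0) + trunc_inv z / (k * \<eta>)"
proof (cases "z \<le> \<eta>")
  case True
  have "0 \<le> trunc_inv z / (k * \<eta>)" using assms by simp
  with True show ?thesis using trunc_inv_le_1[of "k * z"] by simp
next
  case False
  then have z: "\<eta> < z" by simp
  have "trunc_inv (k * z) \<le> 1 / (k * z)" using assms z by (intro trunc_inv_le) auto
  also have "\<dots> \<le> trunc_inv z / (k * \<eta>)"
  proof -
    have "max 1 z * \<eta> \<le> z" using assms z by (auto simp: max_def mult_left_le)
    then have "1 / z \<le> 1 / (max 1 z * \<eta>)" using assms z by (intro divide_left_mono) auto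
    then have "(1 / z) / k \<le> (1 / (max 1 z * \<eta>)) / k" using assms by (intro divide_right_mono) auto
    then show ?thesis by (simp add: trunc_inv_def mult_ac)
  qed
  finally show ?thesis using False by simp
qed

lemma sum_inverse_dist_le:
  fixes J :: "nat set"
  assumes "J \<subseteq> {1..N}" "j0 \<in> {1..N}"
  shows "(\<Sum>j\<in>J - {j0}. 1 / \<bar>real j - real j0\<bar>) \<le> 2 * harm N"
proof -
  have fin: "finite J" using assms finite_subset by blast
  have "(\<Sum>j\<in>J - {j0}. 1 / \<bar>real j - real j0\<bar>) \<le> (\<Sum>j\<in>{1..<j0} \<union> {j0<..N}. 1 / \<bar>real j - real j0\<bar>)"
    using assms by (intro sum_mono2) auto
  also have "\<dots> = (\<Sum>j\<in>{1..<j0}. 1 / \<bar>real j - real j0\<bar>) + (\<Sum>j\<in>{j0<..N}. 1 / \<bar>real j - real j0\<bar>)"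
    by (intro sum.union_disjoint) auto
  also have "(\<Sum>j\<in>{1..<j0}. 1 / \<bar>real j - real j0\<bar>) = (\<Sum>i\<in>{1..<j0}. inverse (real i))"
    by (rule sum.reindex_bij_witness[of _ "\<lambda>i. j0 - i" "\<lambda>i. j0 - i"])
       (auto simp: of_nat_diff divide_inverse)
  also have "\<dots> \<le> harm N"
    unfolding harm_def using assms by (intro sum_mono2) auto
  also have "(\<Sum>j\<in>{j0<..N}. 1 / \<bar>real j - real j0\<bar>) = (\<Sum>i\<in>{1..N - j0}. inverse (real i))"
    by (rule sum.reindex_bij_witness[of _ "\<lambda>i. j0 + i" "\<lambda>i. i - j0"])
       (auto simp: of_nat_diff divide_inverse)
  also have "\<dots> \<le> harm N"
    unfolding harm_def by (intro sum_mono2) auto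
  finally show ?thesis by simp
qed

text \<open>Each point other than the nearest one is at distance at least half its distance to the
  nearest one.\<close>

lemma sum_trunc_inv_spaced_le:
  fixes z :: "nat \<Rightarrow> real"
  assumes J: "J \<subseteq> {1..N}" and "0 < \<sigma>"
    and spaced: "\<And>i j. i \<in> J \<Longrightarrow> j \<in> J \<Longrightarrow> \<sigma> * \<bar>real i - real j\<bar> \<le> \<bar>z i - z j\<bar>"
  shows "(\<Sum>j\<in>J. trunc_inv \<bar>x - z j\<bar>) \<le> 1 + 4 / \<sigma> * harm N"
proof (cases "J = {}")
  case True
  then show ?thesis using \<open>0 < \<sigma>\<close> by (simp add: harm_nonneg)
next
  case False
  have fin: "finite J" using J finite_subset by blast
  define j0 where "j0 = arg_min_on (\<lambda>j. \<bar>x - z j\<bar>) J"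
  have j0: "j0 \<in> J" unfolding j0_def by (intro arg_min_if_finite(1) fin False)
  have least: "\<bar>x - z j0\<bar> \<le> \<bar>x - z j\<bar>" if "j \<in> J" for j
    unfolding j0_def by (intro arg_min_least fin False that)
  have far: "trunc_inv \<bar>x - z j\<bar> \<le> 2 / \<sigma> * (1 / \<bar>real j - real j0\<bar>)" if j: "j \<in> J - {j0}" for j
  proof -
    have "\<sigma> * \<bar>real j - real j0\<bar> \<le> 2 * \<bar>x - z j\<bar>"
      using spaced[of j j0] least[of j] j j0 by (smt (verit) DiffD1)
    moreover have pos: "0 < \<sigma> * \<bar>real j - real j0\<bar>" using j \<open>0 < \<sigma>\<close> by auto
    moreover have "0 < b" "a / 2 \<le> b" if "a \<le> 2 * b" "0 < a" for a b :: real
      using that by linarith+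
    ultimately have "0 < \<bar>x - z j\<bar>" "\<sigma> * \<bar>real j - real j0\<bar> / 2 \<le> \<bar>x - z j\<bar>"
      by blast+
    with pos have "trunc_inv \<bar>x - z j\<bar> \<le> 1 / \<bar>x - z j\<bar>"
      "1 / \<bar>x - z j\<bar> \<le> 1 / (\<sigma> * \<bar>real j - real j0\<bar> / 2)"
      by (intro trunc_inv_le divide_left_mono mult_pos_pos; simp)+
    then show ?thesis by (simp add: field_simps)
  qed
  have "(\<Sum>j\<in>J. trunc_inv \<bar>x - z j\<bar>) = trunc_inv \<bar>x - z j0\<bar> + (\<Sum>j\<in>J-{j0}. trunc_inv \<bar>x - z j\<bar>)"
    by (intro sum.remove fin j0)
  also have "\<dots> \<le> 1 + (\<Sum>j\<in>J-{j0}. 2 / \<sigma> * (1 / \<bar>real j - real j0\<bar>))"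
    by (intro add_mono trunc_inv_le_1 sum_mono far)
  also have "\<dots> = 1 + 2 / \<sigma> * (\<Sum>j\<in>J-{j0}. 1 / \<bar>real j - real j0\<bar>)"
    by (simp add: sum_distrib_left)
  also have "\<dots> \<le> 1 + 2 / \<sigma> * (2 * harm N)"
    using J j0 \<open>0 < \<sigma>\<close> by (intro add_left_mono mult_left_mono sum_inverse_dist_le) auto
  finally show ?thesis by simp
qed

lemma card_spaced_le:
  fixes J :: "nat set"
  assumes "finite J" "0 \<le> L" and "\<And>i j. i \<in> J \<Longrightarrow> j \<in> J \<Longrightarrow> i \<le> j \<Longrightarrow> real j - real i \<le> L"
  shows "real (card J) \<le> 1 + L"
proof (cases "J = {}")
  case False
  have "J \<subseteq> {Min J..Max J}" using assms(1) by auto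
  then have "card J \<le> card {Min J..Max J}" by (intro card_mono) auto
  also have "\<dots> = Suc (Max J) - Min J" by simp
  finally have "real (card J) \<le> real (Max J) - real (Min J) + 1"
    using Min_le_iff[OF assms(1) False, of "Max J"] Max_in[OF assms(1) False] by fastforce
  also have "real (Max J) - real (Min J) \<le> L"
    using assms False by (intro assms(3)) auto
  finally show ?thesis by simp
qed (use assms in simp)

text \<open>Indexing by the difference \<open>h = n - m\<close> and the smaller index \<open>m\<close>.\<close>

definition index_pairs :: "nat \<Rightarrow> (nat \<times> nat) set" where
  "index_pairs N = (SIGMA h:{1..<N}. {1..N - h})"

lemma finite_index_pairs [simp]: "finite (index_pairs N)"
  by (simp add: index_pairs_def)

lemma card_index_pairs: "real (card (index_pairs N)) = real N * (real N - 1) / 2"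
proof -
  have "card (index_pairs N) = (\<Sum>h\<in>{1..<N}. N - h)"
    by (simp add: index_pairs_def)
  also have "real \<dots> = (\<Sum>h\<in>{1..<N}. real N - real h)"
    by (simp add: of_nat_diff)
  also have "\<dots> = real N * (real N - 1) / 2"
  proof (induction N)
    case (Suc N)
    have "(\<Sum>h\<in>{1..<Suc N}. real (Suc N) - real h) = (\<Sum>h\<in>{1..<Suc N}. (real N - real h) + 1)"
      by (intro sum.cong) auto
    also have "\<dots> = (\<Sum>h\<in>{1..<N}. real N - real h) + real N"
      by (subst sum.distrib) (cases N; simp)
    finally show ?case using Suc by (simp add: field_simps)
  qed simp
  finally show ?thesis .
qed

lemma card_index_pairs_le: "real (card (index_pairs N)) \<le> real N ^ 2"
  by (auto simp: card_index_pairs power2_eq_square field_simps)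

text \<open>All that the second moment argument uses of \<open>n log^A n\<close>: the first step is
  positive and convexity has rate \<open>1 / n\<close>. One constant \<open>c\<close> serves both,
  since only its positivity matters.\<close>

locale convex_gaps =
  fixes y :: "nat \<Rightarrow> real" and c :: real
  assumes c_pos: "0 < c"
    and first_gap: "c \<le> y 2 - y 1"
    and second_gap: "1 \<le> n \<Longrightarrow> c / real (n + 1) \<le> y (n + 2) - 2 * y (n + 1) + y n"
begin

definition \<Delta> :: "nat \<times> nat \<Rightarrow> real" where
  "\<Delta> p = y (snd p + fst p) - y (snd p)"

lemma step_gap: "1 \<le> n \<Longrightarrow> c \<le> y (n + 1) - y n"
proof (induction n rule: dec_induct)
  case base
  then show ?case using first_gap by (simp add: numeral_2_eq_2)
next
  case (step n)
  have "0 \<le> c / real (n + 1)" using c_pos by simp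
  with second_gap[of n] step show ?case by simp
qed

lemma gap:
  assumes "1 \<le> m" "m \<le> n"
  shows "c * (real n - real m) \<le> y n - y m"
  using assms(2)
proof (induction n rule: dec_induct)
  case (step n)
  then show ?case using step_gap[of n] \<open>1 \<le> m\<close> by (simp add: algebra_simps)
qed simp

text \<open>The difference telescopes into \<open>h\<close> consecutive second differences, whose
  middle indices are at most \<open>N\<close>; each is therefore at least
  \<open>c / N\<close>.\<close>

lemma shift_gap:
  assumes "1 \<le> m" "m + 1 + h \<le> N"
  shows "c * real h / real N \<le> \<Delta> (h, m + 1) - \<Delta> (h, m)"
  using assms(2)
proof (induction h)
  case 0
  then show ?case by (simp add: \<Delta>_def)
next
  case (Suc h)
  have "c / real N \<le> c / real (m + h + 1)"
    using c_pos Suc.prems by (intro divide_left_mono) auto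
  also have "\<dots> \<le> y (m + h + 2) - 2 * y (m + h + 1) + y (m + h)"
    using assms(1) by (intro second_gap) auto
  finally show ?case using Suc
    by (simp add: \<Delta>_def add_divide_distrib distrib_left add_ac)
qed

lemma shift_gaps:
  assumes "1 \<le> m" "m \<le> m'" "m' + h \<le> N"
  shows "c * real h / real N * (real m' - real m) \<le> \<Delta> (h, m') - \<Delta> (h, m)"
  using assms(2,3)
proof (induction m' rule: dec_induct)
  case (step n)
  then show ?case using shift_gap[of n h N] \<open>1 \<le> m\<close>
    by (simp add: algebra_simps add_divide_distrib diff_divide_distrib)
qed simp

lemma shift_gaps_abs:
  assumes "1 \<le> m" "1 \<le> m'" "m + h \<le> N" "m' + h \<le> N"
  shows "c * real h / real N * \<bar>real m - real m'\<bar> \<le> \<bar>\<Delta> (h, m) - \<Delta> (h, m')\<bar>"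
proof (cases "m \<le> m'")
  case True
  then show ?thesis using shift_gaps[of m m' h N] assms by auto
next
  case False
  then show ?thesis using shift_gaps[of m' m h N] assms by auto
qed

text \<open>For fixed \<open>h\<close> the increments are separated by \<open>c * h / N\<close>. The
  factor \<open>1 / h\<close> in the bound makes the later sum over \<open>h\<close> cost only one
  more logarithm.\<close>

lemma sum_trunc_inv_\<Delta>_le:
  assumes "h \<in> {1..<N}"
  shows "(\<Sum>m\<in>{1..N-h}. trunc_inv \<bar>x - \<Delta> (h, m)\<bar>) \<le> 1 + 4 * real N * harm N / (c * real h)"
proof -
  have "(\<Sum>m\<in>{1..N-h}. trunc_inv \<bar>x - \<Delta> (h, m)\<bar>) \<le> 1 + 4 / (c * real h / real N) * harm N"
    using assms c_pos by (intro sum_trunc_inv_spaced_le shift_gaps_abs) auto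
  then show ?thesis using assms by (simp add: field_simps)
qed

end

section \<open>Sums of greatest common divisors\<close>

text \<open>Bounds \<open>gcd h h'\<close> by the sum of all common divisors.\<close>

lemma sum_gcd_le:
  assumes "0 < h'"
  shows "(\<Sum>h\<in>{1..h'}. gcd h h') \<le> h' * card {d. d dvd h'}"
proof -
  have fin: "finite {d. d dvd h'}" using assms by simp
  have "(\<Sum>h\<in>{1..h'}. gcd h h') \<le> (\<Sum>h\<in>{1..h'}. \<Sum>d\<in>{d. d dvd h'}. if d dvd h then d else 0)"
  proof (rule sum_mono)
    fix h assume "h \<in> {1..h'}"
    have "gcd h h' = (\<Sum>d\<in>{gcd h h'}. if d dvd h then d else 0)" by simp
    also have "\<dots> \<le> (\<Sum>d\<in>{d. d dvd h'}. if d dvd h then d else 0)"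
      by (intro sum_mono2 fin) auto
    finally show "gcd h h' \<le> (\<Sum>d\<in>{d. d dvd h'}. if d dvd h then d else 0)" .
  qed
  also have "\<dots> = (\<Sum>d\<in>{d. d dvd h'}. \<Sum>h\<in>{1..h'}. if d dvd h then d else 0)"
    by (rule sum.swap)
  also have "\<dots> \<le> (\<Sum>d\<in>{d. d dvd h'}. h')"
  proof (rule sum_mono)
    fix d assume "d \<in> {d. d dvd h'}"
    then have d: "0 < d" using assms by (auto intro: Nat.gr0I)
    have "{h\<in>{1..h'}. d dvd h} = (*) d ` {1..h' div d}"
    proof safe
      fix h assume "h \<in> {1..h'}" "d dvd h"
      then show "h \<in> (*) d ` {1..h' div d}" using d
        by (auto elim!: dvdE simp: less_eq_div_iff_mult_less_eq mult_ac intro!: image_eqI)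
    next
      fix i assume "i \<in> {1..h' div d}"
      then show "d * i \<in> {1..h'}" using d
        by (auto simp: less_eq_div_iff_mult_less_eq mult_ac)
    qed auto
    then have "card {h\<in>{1..h'}. d dvd h} = h' div d"
      using d by (simp add: card_image inj_on_def)
    then have "(\<Sum>h\<in>{1..h'}. if d dvd h then d else 0) = h' div d * d"
      by (simp add: sum.If_cases Int_def)
    then show "(\<Sum>h\<in>{1..h'}. if d dvd h then d else 0) \<le> h'"
      by (simp add: div_times_less_eq_dividend)
  qed
  finally show ?thesis by (simp add: mult.commute)
qed

text \<open>Interchanging \<open>h\<close> with its divisor \<open>d\<close> leaves harmonic sums
  over the multiples of \<open>d\<close> and then over \<open>d\<close>. The weight has the shape of
  the bound in \<open>sum_trunc_inv_\<Delta>_le\<close>, with \<open>B\<close> of order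
  \<open>N * harm N\<close>.\<close>

lemma sum_card_divisors_le:
  assumes "0 \<le> B"
  shows "(\<Sum>h\<in>{1..<N}. real (card {d. d dvd h}) * (1 + B / real h)) \<le> real N * harm N + B * harm N ^ 2"
proof -
  have "(\<Sum>h\<in>{1..<N}. real (card {d. d dvd h}) * (1 + B / real h))
      = (\<Sum>h\<in>{1..<N}. \<Sum>d\<in>{1..<N}. if d dvd h then 1 + B / real h else 0)"
  proof (rule sum.cong)
    fix h assume h: "h \<in> {1..<N}"
    then have "{d. d dvd h} = {d\<in>{1..<N}. d dvd h}"
      by (auto dest: dvd_imp_le intro: Nat.gr0I simp: Suc_le_eq)
    then have "real (card {d. d dvd h}) * (1 + B / real h) = (\<Sum>d\<in>{d\<in>{1..<N}. d dvd h}. 1 + B / real h)"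
      by simp
    also have "\<dots> = (\<Sum>d\<in>{1..<N}. if d dvd h then 1 + B / real h else 0)"
      by (rule sum.inter_filter) simp
    finally show "real (card {d. d dvd h}) * (1 + B / real h)
      = (\<Sum>d\<in>{1..<N}. if d dvd h then 1 + B / real h else 0)" .
  qed simp
  also have "\<dots> = (\<Sum>d\<in>{1..<N}. \<Sum>h\<in>{1..<N}. if d dvd h then 1 + B / real h else 0)"
    by (rule sum.swap)
  also have "\<dots> \<le> (\<Sum>d\<in>{1..<N}. real N * inverse (real d) + B * harm N * inverse (real d))"
  proof (rule sum_mono)
    fix d assume d: "d \<in> {1..<N}"
    have sub: "{h\<in>{1..<N}. d dvd h} \<subseteq> (*) d ` {1..N div d}"
    proof safe
      fix h assume "h \<in> {1..<N}" "d dvd h"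
      then show "h \<in> (*) d ` {1..N div d}" using d
        by (auto elim!: dvdE simp: less_eq_div_iff_mult_less_eq mult_ac intro!: image_eqI)
    qed
    have "(\<Sum>h\<in>{1..<N}. if d dvd h then 1 + B / real h else 0) = (\<Sum>h\<in>{h\<in>{1..<N}. d dvd h}. 1 + B / real h)"
      by (rule sum.inter_filter[symmetric]) simp
    also have "\<dots> \<le> (\<Sum>h\<in>(*) d ` {1..N div d}. 1 + B / real h)"
      using assms by (intro sum_mono2 sub) auto
    also have "\<dots> = (\<Sum>i\<in>{1..N div d}. 1 + B / real (d * i))"
      using d by (subst sum.reindex) (auto simp: inj_on_def)
    also have "\<dots> = real (N div d) + B / real d * harm (N div d)"
      by (simp add: sum.distrib harm_def sum_distrib_left divide_inverse mult_ac)
    also have "\<dots> \<le> real N / real d + B / real d * harm N"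
      using assms by (intro add_mono mult_left_mono harm_mono) (auto simp: of_nat_div_le_of_nat)
    finally show "(\<Sum>h\<in>{1..<N}. if d dvd h then 1 + B / real h else 0)
        \<le> real N * inverse (real d) + B * harm N * inverse (real d)" by (simp add: divide_inverse mult_ac)
  qed
  also have "\<dots> = (real N + B * harm N) * (\<Sum>d\<in>{1..<N}. inverse (real d))"
    by (simp add: sum.distrib sum_distrib_left distrib_right)
  also have "\<dots> \<le> (real N + B * harm N) * harm N"
    unfolding harm_def[of N] using assms
    by (intro mult_left_mono sum_mono2) (auto simp: sum_nonneg)
  finally show ?thesis by (simp add: algebra_simps power2_eq_square)
qed

text \<open>In a solution of \<open>k * h = k' * h'\<close> the number \<open>k\<close> is a
  multiple of \<open>h' / gcd h h'\<close> and \<open>k'\<close> one of \<open>h / gcd h h'\<close>.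
  The ratio is the reciprocal of the larger modulus.\<close>

definition gcd_ratio :: "nat \<Rightarrow> nat \<Rightarrow> real" where
  "gcd_ratio h h' = real (gcd h h') / real (max h h')"

lemma gcd_ratio_nonneg [simp]: "0 \<le> gcd_ratio h h'"
  by (simp add: gcd_ratio_def)

text \<open>On the triangle the maximum in \<open>gcd_ratio\<close> is \<open>h'\<close>, so
  \<open>sum_gcd_le\<close> reduces the inner sum to the number of divisors of
  \<open>h'\<close>.\<close>

lemma sum_gcd_ratio_triangle_le:
  assumes "0 \<le> B"
  shows "(\<Sum>h'\<in>{1..<N}. \<Sum>h\<in>{1..h'}. gcd_ratio h h' * (1 + B / real h'))
    \<le> real N * harm N + B * harm N ^ 2"
proof -
  have "(\<Sum>h\<in>{1..h'}. gcd_ratio h h' * (1 + B / real h')) \<le> real (card {d. d dvd h'}) * (1 + B / real h')"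
    if "h' \<in> {1..<N}" for h'
  proof -
    have "(\<Sum>h\<in>{1..h'}. gcd_ratio h h') = (\<Sum>h\<in>{1..h'}. real (gcd h h') / real h')"
      by (intro sum.cong) (auto simp: gcd_ratio_def max_def)
    also have "\<dots> = real (\<Sum>h\<in>{1..h'}. gcd h h') / real h'" by (simp add: sum_divide_distrib)
    also have "\<dots> \<le> real (h' * card {d. d dvd h'}) / real h'"
      using that by (intro divide_right_mono of_nat_mono sum_gcd_le) auto
    also have "\<dots> = real (card {d. d dvd h'})" using that by simp
    finally have "(\<Sum>h\<in>{1..h'}. gcd_ratio h h') * (1 + B / real h') \<le> real (card {d. d dvd h'}) * (1 + B / real h')"
      using assms by (intro mult_right_mono) auto
    then show ?thesis by (simp add: sum_distrib_right)
  qed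
  then have "(\<Sum>h'\<in>{1..<N}. \<Sum>h\<in>{1..h'}. gcd_ratio h h' * (1 + B / real h'))
      \<le> (\<Sum>h'\<in>{1..<N}. real (card {d. d dvd h'}) * (1 + B / real h'))"
    by (intro sum_mono)
  also have "\<dots> \<le> real N * harm N + B * harm N ^ 2"
    by (intro sum_card_divisors_le assms)
  finally show ?thesis .
qed

lemma sum_symmetric_le:
  fixes g :: "nat \<Rightarrow> nat \<Rightarrow> real"
  assumes "\<And>a b. 0 \<le> g a b" "\<And>a b. g a b = g b a"
  shows "(\<Sum>a\<in>{1..<N}. \<Sum>b\<in>{1..<N}. g a b) \<le> 2 * (\<Sum>b\<in>{1..<N}. \<Sum>a\<in>{1..b}. g a b)"
proof -
  have le: "(\<Sum>a\<in>{1..<N}. if a \<le> b then g a b else 0) = (\<Sum>a\<in>{1..b}. g a b)" if "b \<in> {1..<N}" for b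
  proof -
    have "(\<Sum>a\<in>{1..<N}. if a \<le> b then g a b else 0) = (\<Sum>a\<in>{a\<in>{1..<N}. a \<le> b}. g a b)"
      by (rule sum.inter_filter[symmetric]) simp
    also have "{a\<in>{1..<N}. a \<le> b} = {1..b}" using that by auto
    finally show ?thesis .
  qed
  have "(\<Sum>a\<in>{1..<N}. \<Sum>b\<in>{1..<N}. g a b)
      \<le> (\<Sum>a\<in>{1..<N}. \<Sum>b\<in>{1..<N}. (if a \<le> b then g a b else 0) + (if b \<le> a then g b a else 0))"
    using assms by (intro sum_mono) auto
  also have "\<dots> = (\<Sum>a\<in>{1..<N}. \<Sum>b\<in>{1..<N}. if a \<le> b then g a b else 0)
      + (\<Sum>a\<in>{1..<N}. \<Sum>b\<in>{1..<N}. if b \<le> a then g b a else 0)"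
    by (simp add: sum.distrib)
  also have "(\<Sum>a\<in>{1..<N}. \<Sum>b\<in>{1..<N}. if a \<le> b then g a b else 0)
      = (\<Sum>b\<in>{1..<N}. \<Sum>a\<in>{1..<N}. if a \<le> b then g a b else 0)"
    by (rule sum.swap)
  also have "(\<Sum>b\<in>{1..<N}. \<Sum>a\<in>{1..<N}. if a \<le> b then g a b else 0) = (\<Sum>b\<in>{1..<N}. \<Sum>a\<in>{1..b}. g a b)"
    by (intro sum.cong le refl)
  finally show ?thesis by (simp only: mult_2)
qed

lemma sum_gcd_ratio_le:
  "(\<Sum>h\<in>{1..<N}. \<Sum>h'\<in>{1..<N}. gcd_ratio h h') \<le> 2 * real N * harm N"
proof -
  have "(\<Sum>h\<in>{1..<N}. \<Sum>h'\<in>{1..<N}. gcd_ratio h h')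
      \<le> 2 * (\<Sum>h'\<in>{1..<N}. \<Sum>h\<in>{1..h'}. gcd_ratio h h')"
    by (intro sum_symmetric_le) (auto simp: gcd_ratio_def gcd.commute max.commute)
  also have "\<dots> \<le> 2 * (real N * harm N)"
    using sum_gcd_ratio_triangle_le[of 0 N] by simp
  finally show ?thesis by simp
qed

lemma sum_index_pairs: "sum f (index_pairs N) = (\<Sum>h\<in>{1..<N}. \<Sum>m\<in>{1..N-h}. f (h, m))"
  unfolding index_pairs_def by (subst sum.Sigma) auto

lemma sum_index_pairs_gcd_ratio_le:
  "(\<Sum>p\<in>index_pairs N. \<Sum>p'\<in>index_pairs N. gcd_ratio (fst p) (fst p')) \<le> 2 * real N ^ 3 * harm N"
proof -
  have "(\<Sum>p\<in>index_pairs N. \<Sum>p'\<in>index_pairs N. gcd_ratio (fst p) (fst p'))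
      = (\<Sum>h\<in>{1..<N}. \<Sum>h'\<in>{1..<N}. real (N - h) * real (N - h') * gcd_ratio h h')"
    by (simp add: sum_index_pairs sum_distrib_left mult_ac)
  also have "\<dots> \<le> (\<Sum>h\<in>{1..<N}. \<Sum>h'\<in>{1..<N}. real N * real N * gcd_ratio h h')"
    by (intro sum_mono mult_mono mult_nonneg_nonneg) auto
  also have "\<dots> = real N ^ 2 * (\<Sum>h\<in>{1..<N}. \<Sum>h'\<in>{1..<N}. gcd_ratio h h')"
    by (simp add: sum_distrib_left power2_eq_square)
  also have "\<dots> \<le> real N ^ 2 * (2 * real N * harm N)"
    by (intro mult_left_mono sum_gcd_ratio_le) auto
  finally show ?thesis by (simp add: power3_eq_cube power2_eq_square mult_ac)
qed

context convex_gaps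
begin

lemma sum_trunc_inv_le:
  "(\<Sum>p\<in>index_pairs N. \<Sum>p'\<in>index_pairs N. trunc_inv \<bar>\<Delta> p - \<Delta> p'\<bar>)
    \<le> real N ^ 3 * (1 + 4 * harm N ^ 2 / c)"
proof -
  have inner: "(\<Sum>p'\<in>index_pairs N. trunc_inv \<bar>\<Delta> p - \<Delta> p'\<bar>) \<le> real N * (1 + 4 * harm N ^ 2 / c)" for p
  proof -
    have "(\<Sum>p'\<in>index_pairs N. trunc_inv \<bar>\<Delta> p - \<Delta> p'\<bar>)
        \<le> (\<Sum>h\<in>{1..<N}. 1 + 4 * real N * harm N / (c * real h))"
      unfolding sum_index_pairs by (intro sum_mono sum_trunc_inv_\<Delta>_le)
    also have "\<dots> = real (N - 1) + 4 * real N * harm N / c * (\<Sum>h\<in>{1..<N}. inverse (real h))"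
      by (simp add: sum.distrib sum_distrib_left divide_inverse mult_ac)
    also have "\<dots> \<le> real N + 4 * real N * harm N / c * harm N"
      unfolding harm_def[of N] using c_pos
      by (intro add_mono mult_left_mono sum_mono2) (auto simp: sum_nonneg)
    finally show ?thesis by (simp add: field_simps power2_eq_square)
  qed
  have "(\<Sum>p\<in>index_pairs N. \<Sum>p'\<in>index_pairs N. trunc_inv \<bar>\<Delta> p - \<Delta> p'\<bar>)
      \<le> (\<Sum>p\<in>index_pairs N. real N * (1 + 4 * harm N ^ 2 / c))"
    by (intro sum_mono inner)
  also have "\<dots> = real (card (index_pairs N)) * (real N * (1 + 4 * harm N ^ 2 / c))"
    by simp
  also have "\<dots> \<le> real N ^ 2 * (real N * (1 + 4 * harm N ^ 2 / c))"
    using c_pos by (intro mult_right_mono card_index_pairs_le) auto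
  finally show ?thesis by (simp add: power3_eq_cube power2_eq_square mult_ac)
qed

text \<open>By symmetry \<open>h \<le> h'\<close> may be assumed, and the separation of increments
  is applied to the larger difference \<open>h'\<close>, which is also the denominator of
  \<open>gcd_ratio\<close>. Using both savings together gives \<open>N\<^sup>2\<close> up to
  logarithms, against \<open>N ^ 3\<close> for either one alone.\<close>

lemma sum_gcd_ratio_trunc_inv_le:
  "(\<Sum>p\<in>index_pairs N. \<Sum>p'\<in>index_pairs N. gcd_ratio (fst p) (fst p') * trunc_inv \<bar>\<Delta> p - \<Delta> p'\<bar>)
    \<le> 2 * real N ^ 2 * (harm N + 4 * harm N ^ 3 / c)"
proof -
  define g where "g h h' = (\<Sum>m\<in>{1..N-h}. \<Sum>m'\<in>{1..N-h'}. gcd_ratio h h' * trunc_inv \<bar>\<Delta> (h, m) - \<Delta> (h', m')\<bar>)"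
    for h h'
  define B where "B = 4 * real N * harm N / c"
  have B: "0 \<le> B" using c_pos by (simp add: B_def harm_nonneg)
  have sym: "g h h' = g h' h" for h h'
    unfolding g_def by (subst sum.swap) (simp add: gcd_ratio_def gcd.commute max.commute abs_minus_commute)
  have g_le: "g h h' \<le> real N * (gcd_ratio h h' * (1 + B / real h'))" if "h' \<in> {1..<N}" for h h'
  proof -
    have "g h h' = gcd_ratio h h' * (\<Sum>m\<in>{1..N-h}. \<Sum>m'\<in>{1..N-h'}. trunc_inv \<bar>\<Delta> (h, m) - \<Delta> (h', m')\<bar>)"
      by (simp add: g_def sum_distrib_left)
    also have "\<dots> \<le> gcd_ratio h h' * (\<Sum>m\<in>{1..N-h}. 1 + B / real h')"
      using sum_trunc_inv_\<Delta>_le[OF that]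
      by (intro mult_left_mono sum_mono) (auto simp: B_def field_simps)
    also have "\<dots> \<le> gcd_ratio h h' * (real N * (1 + B / real h'))"
      using B by (intro mult_left_mono) (auto intro!: mult_right_mono)
    finally show ?thesis by (simp add: mult_ac)
  qed
  have "(\<Sum>p\<in>index_pairs N. \<Sum>p'\<in>index_pairs N. gcd_ratio (fst p) (fst p') * trunc_inv \<bar>\<Delta> p - \<Delta> p'\<bar>)
      = (\<Sum>h\<in>{1..<N}. \<Sum>m\<in>{1..N-h}. \<Sum>h'\<in>{1..<N}. \<Sum>m'\<in>{1..N-h'}. gcd_ratio h h' * trunc_inv \<bar>\<Delta> (h, m) - \<Delta> (h', m')\<bar>)"
    by (simp add: sum_index_pairs)
  also have "\<dots> = (\<Sum>h\<in>{1..<N}. \<Sum>h'\<in>{1..<N}. g h h')"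
    unfolding g_def by (rule sum.cong[OF refl], rule sum.swap)
  also have "\<dots> \<le> 2 * (\<Sum>h'\<in>{1..<N}. \<Sum>h\<in>{1..h'}. g h h')"
    by (intro sum_symmetric_le sym) (auto simp: g_def intro!: sum_nonneg mult_nonneg_nonneg)
  also have "\<dots> \<le> 2 * (\<Sum>h'\<in>{1..<N}. \<Sum>h\<in>{1..h'}. real N * (gcd_ratio h h' * (1 + B / real h')))"
    by (intro mult_left_mono sum_mono g_le) auto
  also have "\<dots> = 2 * real N * (\<Sum>h'\<in>{1..<N}. \<Sum>h\<in>{1..h'}. gcd_ratio h h' * (1 + B / real h'))"
    by (simp add: sum_distrib_left mult.assoc)
  also have "\<dots> \<le> 2 * real N * (real N * harm N + B * harm N ^ 2)"
    by (intro mult_left_mono sum_gcd_ratio_triangle_le B) auto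
  also have "\<dots> = 2 * real N ^ 2 * (harm N + 4 * harm N ^ 3 / c)"
    by (simp add: B_def power2_eq_square power3_eq_cube algebra_simps)
  finally show ?thesis .
qed

end

section \<open>Increments that are nearly equal\<close>

lemma card_same_fibre:
  assumes "finite A"
  shows "card {(p, p'). p \<in> A \<and> p' \<in> A \<and> f p = f p'} = (\<Sum>v\<in>f ` A. (card {p\<in>A. f p = v})\<^sup>2)"
proof -
  have "{(p, p'). p \<in> A \<and> p' \<in> A \<and> f p = f p'} = (SIGMA p:A. {p'\<in>A. f p' = f p})" by auto
  then have "card {(p, p'). p \<in> A \<and> p' \<in> A \<and> f p = f p'} = (\<Sum>p\<in>A. card {p'\<in>A. f p' = f p})"
    using assms by simp
  also have "\<dots> = (\<Sum>v\<in>f ` A. \<Sum>p\<in>{p\<in>A. f p = v}. card {p'\<in>A. f p' = f p})"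
    using assms by (intro sum.group[symmetric]) auto
  also have "\<dots> = (\<Sum>v\<in>f ` A. (card {p\<in>A. f p = v})\<^sup>2)"
    by (intro sum.cong) (auto simp: power2_eq_square)
  finally show ?thesis .
qed

lemma card_square_le_same_fibre:
  assumes "finite A"
  shows "(real (card A))\<^sup>2 \<le> real (card (f ` A)) * real (card {(p, p'). p \<in> A \<and> p' \<in> A \<and> f p = f p'})"
proof -
  have "real (card A) = (\<Sum>v\<in>f ` A. real (card {p\<in>A. f p = v}))"
    using assms sum.group[of A "f ` A" f "\<lambda>_. 1::real"] by simp
  also have "\<dots>\<^sup>2 \<le> (\<Sum>v\<in>f ` A. (real (card {p\<in>A. f p = v}))\<^sup>2) * real (card (f ` A))"
    by (rule sum_squared_le_sum_of_squares)
  finally show ?thesis by (simp add: card_same_fibre[OF assms] mult.commute)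
qed

text \<open>If an integer separates the two numbers, both lie within 1/2 of it and the grid shifted
  by 1/2 does not separate them. Thus closeness is covered by two equivalence relations, whose
  classes can be treated one at a time.\<close>

lemma floor_eq_or_shifted_floor_eq:
  fixes a b :: real
  assumes "\<bar>a - b\<bar> \<le> 1 / 2"
  shows "\<lfloor>a\<rfloor> = \<lfloor>b\<rfloor> \<or> \<lfloor>a + 1/2\<rfloor> = \<lfloor>b + 1/2\<rfloor>"
proof -
  have *: "\<lfloor>a + 1/2\<rfloor> = \<lfloor>b + 1/2\<rfloor>" if "\<bar>a - b\<bar> \<le> 1 / 2" "\<lfloor>b\<rfloor> < \<lfloor>a\<rfloor>" for a b :: real
  proof -
    have "b < of_int \<lfloor>a\<rfloor>" using that by (simp add: floor_less_iff)
    moreover have "of_int \<lfloor>a\<rfloor> \<le> a" by simp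
    ultimately have "\<lfloor>a + 1/2\<rfloor> = \<lfloor>a\<rfloor>" "\<lfloor>b + 1/2\<rfloor> = \<lfloor>a\<rfloor>"
      using that(1) by (intro floor_unique; linarith)+
    then show ?thesis by simp
  qed
  show ?thesis
    using *[of a b] *[of b a] assms linorder_less_linear[of "\<lfloor>a\<rfloor>" "\<lfloor>b\<rfloor>"]
    by (auto simp: abs_minus_commute)
qed

text \<open>The cell of the point formed by both endpoints \<open>m\<close> and
  \<open>m + h\<close>, not of \<open>(h, m)\<close>: the chain property concerns the
  endpoints.\<close>

definition block :: "nat \<Rightarrow> nat \<times> nat \<Rightarrow> nat \<times> nat" where
  "block M p = (snd p div M, (snd p + fst p) div M)"

context convex_gaps
begin

text \<open>If the interval from \<open>m\<close> to \<open>m + h\<close> contained the other one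
  properly, the increments would differ by at least one unit step of the sequence, that is by
  \<open>c\<close>. The same happens when the lower endpoints agree and the upper ones do
  not.\<close>

lemma close_pairs_chain:
  assumes "p \<in> index_pairs N" "p' \<in> index_pairs N" and close: "\<bar>\<Delta> p - \<Delta> p'\<bar> < c"
    and "snd p \<le> snd p'" "p \<noteq> p'"
  shows "snd p < snd p' \<and> snd p + fst p < snd p' + fst p'"
proof -
  obtain h m h' m' where p: "p = (h, m)" "p' = (h', m')" by force
  have pos: "1 \<le> m" "1 \<le> m'" "1 \<le> h" "1 \<le> h'" using assms p by (auto simp: index_pairs_def)
  have less: "m + h < m' + h'"
  proof (rule ccontr)
    assume "\<not> m + h < m' + h'"
    then have le: "m' + h' \<le> m + h" by simp
    with assms p have "1 \<le> (real (m + h) - real (m' + h')) + (real m' - real m)" by auto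
    with c_pos have "c * 1 \<le> c * ((real (m + h) - real (m' + h')) + (real m' - real m))"
      by (intro mult_left_mono) auto
    also have "\<dots> = c * (real (m + h) - real (m' + h')) + c * (real m' - real m)" by (rule distrib_left)
    also have "\<dots> \<le> \<Delta> p - \<Delta> p'"
      using gap[of m m'] gap[of "m' + h'" "m + h"] assms pos le by (simp add: p \<Delta>_def)
    finally show False using close by simp
  qed
  moreover have "m \<noteq> m'"
  proof
    assume [simp]: "m = m'"
    have "c * (real (m' + h') - real (m' + h)) \<le> y (m' + h') - y (m' + h)"
      using less pos by (intro gap) auto
    moreover have "c * 1 \<le> c * (real (m' + h') - real (m' + h))"
      using c_pos less by (intro mult_left_mono) auto
    ultimately show False using close by (simp add: p \<Delta>_def)
  qed
  ultimately show ?thesis using assms p by simp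
qed

text \<open>Along a chain both block coordinates are nondecreasing, so their sum already determines
  the block, and the sum takes at most \<open>2 * (N div M) + 1\<close> values.\<close>

lemma card_blocks_le:
  assumes "A \<subseteq> index_pairs N" "0 < M" "M \<le> N"
    and close: "\<And>p p'. p \<in> A \<Longrightarrow> p' \<in> A \<Longrightarrow> \<bar>\<Delta> p - \<Delta> p'\<bar> < c"
  shows "real (card (block M ` A)) \<le> 3 * real N / real M"
proof -
  define s where "s u = fst u + snd u" for u :: "nat \<times> nat"
  have "inj_on s (block M ` A)"
  proof (rule inj_onI)
    have *: "block M p = block M p'"
      if "p \<in> A" "p' \<in> A" "s (block M p) = s (block M p')" "snd p \<le> snd p'" for p p'
    proof (cases "p = p'")
      case False
      have "snd p + fst p \<le> snd p' + fst p'"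
        using close_pairs_chain[of p N p'] close[of p p'] that subsetD[OF assms(1)] False by auto
      then have "(snd p + fst p) div M \<le> (snd p' + fst p') div M" "snd p div M \<le> snd p' div M"
        using that by (auto intro: div_le_mono)
      then show ?thesis using that by (auto simp: block_def s_def)
    qed simp
    fix u u' assume "u \<in> block M ` A" "u' \<in> block M ` A" "s u = s u'"
    then obtain p p' where p: "p \<in> A" "p' \<in> A" "u = block M p" "u' = block M p'" by auto
    with \<open>s u = s u'\<close> show "u = u'"
      using *[of p p'] *[of p' p] by (cases "snd p \<le> snd p'") auto
  qed
  then have "card (block M ` A) = card (s ` block M ` A)" by (simp add: card_image)
  also have "\<dots> \<le> card {0..2 * (N div M)}"
  proof (intro card_mono subsetI)
    fix v assume "v \<in> s ` block M ` A"
    then obtain p where p: "p \<in> A" "v = s (block M p)" by auto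
    from subsetD[OF assms(1) p(1)] have "snd p \<le> N" "snd p + fst p \<le> N"
      by (auto simp: index_pairs_def)
    then have "snd p div M \<le> N div M" "(snd p + fst p) div M \<le> N div M" by (auto intro: div_le_mono)
    then show "v \<in> {0..2 * (N div M)}" by (simp add: p s_def block_def)
  qed auto
  also have "\<dots> = 2 * (N div M) + 1" by simp
  finally have "real (card (block M ` A)) \<le> 2 * real (N div M) + 1" by linarith
  \<comment> \<open>The summand 1 is absorbed by \<open>N / M\<close>, since
    \<open>M \<le> N\<close>.\<close>
  also have "\<dots> \<le> 2 * (real N / real M) + real N / real M"
    using assms by (intro add_mono mult_left_mono of_nat_div_le_of_nat) auto
  finally show ?thesis by simp
qed

lemma div_eq_imp_less:
  fixes a b M :: nat
  assumes "a div M = b div M" "0 < M" "a \<le> b"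
  shows "b - a < M"
  using assms by (metis add_diff_cancel_left div_mult_mod_eq less_imp_diff_less mod_less_divisor)

text \<open>Write \<open>n = m + h\<close>, \<open>n' = m' + h'\<close>. The difference of
  increments regroups as \<open>(y n' - y n) - (y m' - y m)\<close>, which is
  \<open>\<Delta> (u, n) - \<Delta> (v, m)\<close> with \<open>u = n' - n\<close> and
  \<open>v = m' - m\<close>. In a common block \<open>u\<close> and \<open>v\<close> are below
  \<open>M\<close>; once \<open>u\<close>, \<open>v\<close>, \<open>m\<close> are fixed, convexity
  separates the values for different \<open>n\<close>.\<close>

lemma card_close_same_block_half:
  assumes "0 < M" "0 \<le> \<theta>" "\<theta> < c" "1 \<le> N"
  shows "real (card {(p, p'). p \<in> index_pairs N \<and> p' \<in> index_pairs N \<and>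
      \<bar>\<Delta> p - \<Delta> p'\<bar> \<le> \<theta> \<and> block M p = block M p' \<and> snd p < snd p'})
    \<le> real M ^ 2 * real N * (1 + 2 * \<theta> * real N / c)" (is "real (card ?S) \<le> _")
proof -
  define T where "T = {1..<M} \<times> {1..<M} \<times> {1..N}"
  define F where "F t = (case t of (u, v, m) \<Rightarrow>
    {n\<in>{1..N}. n + u \<le> N \<and> \<bar>\<Delta> (u, n) - \<Delta> (v, m)\<bar> \<le> \<theta>})" for t :: "nat \<times> nat \<times> nat"
  \<comment> \<open>The coordinates are \<open>((u, v, m), n)\<close>. Subtraction of naturals is
    exact here because the chain property makes \<open>u\<close> and \<open>v\<close> positive, so
    the map is injective.\<close>
  define \<psi> where "\<psi> = (\<lambda>((h, m), (h', m')). (((m' + h') - (m + h), m' - m, m), m + h)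
    :: (nat \<times> nat \<times> nat) \<times> nat)"
  have F_le: "real (card (F t)) \<le> 1 + 2 * \<theta> * real N / c" if "t \<in> T" for t
  proof -
    obtain u v m where t: "t = (u, v, m)" by (cases t)
    with that have u: "1 \<le> u" by (auto simp: T_def)
    show ?thesis
    proof (rule card_spaced_le)
      fix i j assume ij: "i \<in> F t" "j \<in> F t" "i \<le> j"
      \<comment> \<open>The difference \<open>u\<close> may be as small as 1, so only the spacing
        \<open>c / N\<close> is available; the window has length
        \<open>2 * \<theta>\<close>.\<close>
      have "c / real N * (real j - real i) \<le> c * real u / real N * (real j - real i)"
        using c_pos u ij by (intro mult_right_mono divide_right_mono) auto
      also have "\<dots> \<le> \<Delta> (u, j) - \<Delta> (u, i)"
        using ij by (intro shift_gaps) (auto simp: F_def t)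
      also have "\<dots> \<le> 2 * \<theta>" using ij unfolding F_def t by auto
      finally show "real j - real i \<le> 2 * \<theta> * real N / c"
        using c_pos assms by (simp add: field_simps)
    qed (use c_pos assms in \<open>auto simp: F_def t\<close>)
  qed
  have less: "m < m' \<and> m + h < m' + h'" if "((h, m), (h', m')) \<in> ?S" for h m h' m'
    using close_pairs_chain[of "(h, m)" N "(h', m')"] that assms by auto
  have "inj_on \<psi> ?S"
  proof (rule inj_onI)
    fix w w' assume w: "w \<in> ?S" "w' \<in> ?S" "\<psi> w = \<psi> w'"
    obtain h m h' m' i n i' n' where eq: "w = ((h, m), (h', m'))" "w' = ((i, n), (i', n'))"
      by (metis surj_pair)
    note less[OF w(1)[unfolded eq(1)]] less[OF w(2)[unfolded eq(2)]]
    with w(3) show "w = w'" unfolding eq \<psi>_def by auto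
  qed
  moreover have "\<psi> ` ?S \<subseteq> Sigma T F"
  proof
    fix w assume "w \<in> \<psi> ` ?S"
    then obtain h m h' m' where w: "w = \<psi> ((h, m), (h', m'))" and S: "((h, m), (h', m')) \<in> ?S"
      by (metis (no_types, lifting) imageE surj_pair)
    have lt: "m < m'" "m + h < m' + h'"
      using less[OF S] by auto
    have bl: "m' - m < M" "(m' + h') - (m + h) < M"
      using S lt assms by (auto intro!: div_eq_imp_less simp: block_def)
    have "y (m' + h') - y (m + h) - (y m' - y m) = \<Delta> (h', m') - \<Delta> (h, m)"
      by (simp add: \<Delta>_def)
    then have "\<bar>y (m' + h') - y (m + h) - (y m' - y m)\<bar> \<le> \<theta>"
      using S by (simp add: abs_minus_commute)
    then have "m + h \<in> F ((m' + h') - (m + h), m' - m, m)"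
      using S lt by (auto simp: F_def index_pairs_def \<Delta>_def)
    then show "w \<in> Sigma T F"
      using S lt bl by (auto simp: w \<psi>_def T_def index_pairs_def)
  qed
  moreover have "finite (Sigma T F)"
    by (auto simp: T_def F_def split: prod.splits)
  ultimately have "card ?S \<le> card (Sigma T F)"
    by (meson card_inj_on_le)
  also have "\<dots> = (\<Sum>t\<in>T. card (F t))"
    by (intro card_SigmaI) (auto simp: T_def F_def split: prod.splits)
  finally have "real (card ?S) \<le> (\<Sum>t\<in>T. real (card (F t)))"
    by (simp only: of_nat_sum[symmetric] of_nat_le_iff)
  also have "\<dots> \<le> (\<Sum>t\<in>T. 1 + 2 * \<theta> * real N / c)" by (intro sum_mono F_le)
  also have "\<dots> = real (card T) * (1 + 2 * \<theta> * real N / c)" by simp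
  also have "\<dots> \<le> (real M ^ 2 * real N) * (1 + 2 * \<theta> * real N / c)"
  proof (intro mult_right_mono)
    have "card T = (M - 1) * ((M - 1) * N)" by (simp add: T_def card_cartesian_product)
    also have "\<dots> \<le> M * (M * N)" by (intro mult_le_mono) auto
    finally have "real (card T) \<le> real (M * (M * N))" by (rule of_nat_mono)
    then show "real (card T) \<le> real M ^ 2 * real N" by (simp add: power2_eq_square mult_ac)
  qed (use c_pos assms in auto)
  finally show ?thesis .
qed

text \<open>Close pairs with equal lower index coincide, so apart from the diagonal the lower
  indices are strictly ordered, one way or the other.\<close>

lemma card_close_same_block:
  assumes "0 < M" "0 \<le> \<theta>" "\<theta> < c" "1 \<le> N"
  shows "real (card {(p, p'). p \<in> index_pairs N \<and> p' \<in> index_pairs N \<and>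
      \<bar>\<Delta> p - \<Delta> p'\<bar> \<le> \<theta> \<and> block M p = block M p'})
    \<le> real N ^ 2 + 2 * real M ^ 2 * real N * (1 + 2 * \<theta> * real N / c)" (is "real (card ?S) \<le> _")
proof -
  define H where "H = {(p, p'). p \<in> index_pairs N \<and> p' \<in> index_pairs N \<and>
      \<bar>\<Delta> p - \<Delta> p'\<bar> \<le> \<theta> \<and> block M p = block M p' \<and> snd p < snd p'}"
  have finH: "finite H" unfolding H_def
    by (rule finite_subset[of _ "index_pairs N \<times> index_pairs N"]) auto
  have "?S \<subseteq> (\<lambda>p. (p, p)) ` index_pairs N \<union> H \<union> prod.swap ` H"
  proof clarify
    fix p p'
    assume *: "(p, p') \<notin> prod.swap ` H" "(p, p') \<notin> H" "p \<in> index_pairs N" "p' \<in> index_pairs N"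
      "\<bar>\<Delta> p - \<Delta> p'\<bar> \<le> \<theta>" "block M p = block M p'"
    have "\<not> snd p < snd p'" using * by (auto simp: H_def)
    moreover have "\<not> snd p' < snd p"
    proof
      assume "snd p' < snd p"
      then have "(p', p) \<in> H" using * by (auto simp: H_def abs_minus_commute)
      then show False using *(1) by force
    qed
    ultimately have "p = p'"
      using close_pairs_chain[of p N p'] * \<open>\<theta> < c\<close> by auto
    then show "(p, p') \<in> (\<lambda>p. (p, p)) ` index_pairs N" using * by auto
  qed
  then have "card ?S \<le> card ((\<lambda>p. (p, p)) ` index_pairs N \<union> H \<union> prod.swap ` H)"
    using finH by (intro card_mono) auto
  also have "\<dots> \<le> card ((\<lambda>p. (p, p)) ` index_pairs N) + card H + card (prod.swap ` H)"
    by (intro order.trans[OF card_Un_le] add_mono card_Un_le order.refl)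
  also have "\<dots> \<le> card (index_pairs N) + card H + card H"
    using finH by (intro add_mono card_image_le order.refl) auto
  finally have "real (card ?S) \<le> real (card (index_pairs N)) + 2 * real (card H)" by linarith
  also have "\<dots> \<le> real N ^ 2 + 2 * (real M ^ 2 * real N * (1 + 2 * \<theta> * real N / c))"
    unfolding H_def using assms
    by (intro add_mono mult_left_mono card_index_pairs_le card_close_same_block_half) auto
  finally show ?thesis by simp
qed

text \<open>By convexity the pairs with one value of \<open>\<beta>\<close> form a chain, so they meet few blocks; the
  Cauchy--Schwarz inequality over the blocks then reduces to pairs of pairs in a common block.\<close>

lemma card_same_box_le:
  fixes \<beta> :: "nat \<times> nat \<Rightarrow> int"
  assumes "0 < M" "M \<le> N" "0 \<le> \<theta>" "\<theta> < c"
    and box: "\<And>p p'. \<beta> p = \<beta> p' \<Longrightarrow> \<bar>\<Delta> p - \<Delta> p'\<bar> \<le> \<theta>"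
  shows "real (card {(p, p'). p \<in> index_pairs N \<and> p' \<in> index_pairs N \<and> \<beta> p = \<beta> p'})
    \<le> 3 * real N / real M * (real N ^ 2 + 2 * real M ^ 2 * real N * (1 + 2 * \<theta> * real N / c))"
proof -
  define P where "P = index_pairs N"
  define B where "B v = {p\<in>P. \<beta> p = v}" for v
  define S where "S v = {(p, p'). p \<in> B v \<and> p' \<in> B v \<and> block M p = block M p'}" for v
  have fin: "finite P" "finite (B v)" "finite (S v)" for v
  proof -
    show "finite P" "finite (B v)" by (simp_all add: P_def B_def)
    then show "finite (S v)" unfolding S_def by - (rule finite_subset[of _ "B v \<times> B v"], auto)
  qed
  have "real (card {(p, p'). p \<in> P \<and> p' \<in> P \<and> \<beta> p = \<beta> p'}) = (\<Sum>v\<in>\<beta> ` P. (real (card (B v)))\<^sup>2)"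
    by (simp add: card_same_fibre[OF fin(1)] B_def)
  also have "\<dots> \<le> (\<Sum>v\<in>\<beta> ` P. 3 * real N / real M * real (card (S v)))"
  proof (rule sum_mono)
    fix v
    have "(real (card (B v)))\<^sup>2 \<le> real (card (block M ` B v)) * real (card (S v))"
      unfolding S_def by (intro card_square_le_same_fibre fin)
    also have "\<dots> \<le> 3 * real N / real M * real (card (S v))"
    proof (intro mult_right_mono card_blocks_le assms)
      fix p p' assume "p \<in> B v" "p' \<in> B v"
      then have "\<bar>\<Delta> p - \<Delta> p'\<bar> \<le> \<theta>" by (intro box) (simp add: B_def)
      with \<open>\<theta> < c\<close> show "\<bar>\<Delta> p - \<Delta> p'\<bar> < c" by simp
    qed (auto simp: B_def P_def)
    finally show "(real (card (B v)))\<^sup>2 \<le> 3 * real N / real M * real (card (S v))" .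
  qed
  also have "\<dots> = 3 * real N / real M * real (\<Sum>v\<in>\<beta> ` P. card (S v))"
    by (simp add: sum_distrib_left)
  also have "(\<Sum>v\<in>\<beta> ` P. card (S v)) = card (\<Union>v\<in>\<beta> ` P. S v)"
    using fin by (intro card_UN_disjoint[symmetric]) (auto simp: S_def B_def)
  also have "\<dots> \<le> card {(p, p'). p \<in> index_pairs N \<and> p' \<in> index_pairs N \<and>
      \<bar>\<Delta> p - \<Delta> p'\<bar> \<le> \<theta> \<and> block M p = block M p'}"
  proof (rule card_mono)
    show "finite {(p, p'). p \<in> index_pairs N \<and> p' \<in> index_pairs N \<and>
        \<bar>\<Delta> p - \<Delta> p'\<bar> \<le> \<theta> \<and> block M p = block M p'}"
      by (rule finite_subset[of _ "index_pairs N \<times> index_pairs N"]) auto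
  qed (auto simp: S_def B_def P_def intro!: box)
  finally have "real (card {(p, p'). p \<in> P \<and> p' \<in> P \<and> \<beta> p = \<beta> p'})
      \<le> 3 * real N / real M * real (card {(p, p'). p \<in> index_pairs N \<and> p' \<in> index_pairs N \<and>
      \<bar>\<Delta> p - \<Delta> p'\<bar> \<le> \<theta> \<and> block M p = block M p'})"
    by (simp add: mult_left_mono divide_right_mono)
  also have "\<dots> \<le> 3 * real N / real M * (real N ^ 2 + 2 * real M ^ 2 * real N * (1 + 2 * \<theta> * real N / c))"
    using assms by (intro mult_left_mono card_close_same_block) auto
  finally show ?thesis by (simp add: P_def)
qed

text \<open>The values of \<Delta> are sorted into cells of length \<open>2 * \<eta>\<close> of two
  grids shifted by half a cell; \<open>\<eta>\<close>-close pairs share a cell in one of them. This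
  doubles the constant and replaces \<open>\<theta>\<close> by \<open>2 * \<eta>\<close>.\<close>

lemma card_close_le:
  assumes "0 < M" "M \<le> N" "0 < \<eta>" "2 * \<eta> < c"
  shows "real (card {(p, p'). p \<in> index_pairs N \<and> p' \<in> index_pairs N \<and> \<bar>\<Delta> p - \<Delta> p'\<bar> \<le> \<eta>})
    \<le> 6 * real N / real M * (real N ^ 2 + 2 * real M ^ 2 * real N * (1 + 4 * \<eta> * real N / c))"
    (is "real (card ?S) \<le> _")
proof -
  define \<beta> where "\<beta> s p = \<lfloor>\<Delta> p / (2 * \<eta>) + s\<rfloor>" for s p
  define B where "B s = {(p, p'). p \<in> index_pairs N \<and> p' \<in> index_pairs N \<and> \<beta> s p = \<beta> s p'}" for s
  have box: "\<bar>\<Delta> p - \<Delta> p'\<bar> \<le> 2 * \<eta>" if "\<beta> s p = \<beta> s p'" for s p p'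
  proof -
    have "\<bar>\<Delta> p / (2 * \<eta>) - \<Delta> p' / (2 * \<eta>)\<bar> \<le> 1"
      using that unfolding \<beta>_def by linarith
    then have "\<bar>\<Delta> p - \<Delta> p'\<bar> / (2 * \<eta>) \<le> 1"
      using assms by (simp flip: diff_divide_distrib)
    then show ?thesis using assms by (simp add: field_simps)
  qed
  have bound: "real (card (B s))
      \<le> 3 * real N / real M * (real N ^ 2 + 2 * real M ^ 2 * real N * (1 + 4 * \<eta> * real N / c))" for s
    using card_same_box_le[of M N "2 * \<eta>" "\<beta> s"] assms box by (simp add: B_def)
  have "?S \<subseteq> B 0 \<union> B (1/2)"
  proof clarify
    fix p p'
    assume *: "(p, p') \<notin> B (1/2)" "p \<in> index_pairs N" "p' \<in> index_pairs N" "\<bar>\<Delta> p - \<Delta> p'\<bar> \<le> \<eta>"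
    have "\<bar>\<Delta> p / (2 * \<eta>) - \<Delta> p' / (2 * \<eta>)\<bar> = \<bar>\<Delta> p - \<Delta> p'\<bar> / (2 * \<eta>)"
      using assms by (simp flip: diff_divide_distrib)
    also have "\<dots> \<le> 1 / 2" using * assms by (simp add: field_simps)
    finally have "\<lfloor>\<Delta> p / (2 * \<eta>)\<rfloor> = \<lfloor>\<Delta> p' / (2 * \<eta>)\<rfloor>
        \<or> \<lfloor>\<Delta> p / (2 * \<eta>) + 1/2\<rfloor> = \<lfloor>\<Delta> p' / (2 * \<eta>) + 1/2\<rfloor>"
      by (rule floor_eq_or_shifted_floor_eq)
    with * show "(p, p') \<in> B 0" by (auto simp: B_def \<beta>_def)
  qed
  moreover have "finite (B s)" for s
    unfolding B_def by (rule finite_subset[of _ "index_pairs N \<times> index_pairs N"]) auto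
  ultimately have "card ?S \<le> card (B 0 \<union> B (1/2))" by (intro card_mono) auto
  also have "\<dots> \<le> card (B 0) + card (B (1/2))" by (rule card_Un_le)
  finally have "real (card ?S) \<le> real (card (B 0)) + real (card (B (1/2)))" by linarith
  also have "\<dots> \<le> 2 * (3 * real N / real M * (real N ^ 2 + 2 * real M ^ 2 * real N * (1 + 4 * \<eta> * real N / c)))"
    using add_mono[OF bound[of 0] bound[of "1/2"]] by (simp only: mult_2)
  finally show ?thesis by simp
qed

end

section \<open>Cosine approximation of trapezoids\<close>

definition int_dist :: "real \<Rightarrow> real" where
  "int_dist x = \<bar>x - of_int (round x)\<bar>"

lemma int_dist_nonneg [simp]: "0 \<le> int_dist x"
  by (simp add: int_dist_def)

lemma int_dist_le_half: "int_dist x \<le> 1 / 2"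
  using of_int_round_abs_le[of x] by (simp add: int_dist_def abs_minus_commute)

lemma int_dist_le: "int_dist x \<le> \<bar>x - of_int k\<bar>"
  by (simp add: int_dist_def round_diff_minimal)

lemma int_dist_minus: "int_dist (- x) = int_dist x"
proof -
  have "int_dist (- x) \<le> int_dist x" for x
    using int_dist_le[of "- x" "- round x"] by (simp add: int_dist_def abs_minus_commute)
  from this[of x] this[of "- x"] show ?thesis by simp
qed

lemma int_dist_eq_abs:
  assumes "\<bar>x\<bar> \<le> 1 / 2"
  shows "int_dist x = \<bar>x\<bar>"
proof (rule antisym)
  show "int_dist x \<le> \<bar>x\<bar>" using int_dist_le[of x 0] by simp
  have "round x = 0 \<or> 1 \<le> round x \<or> round x \<le> - 1" by linarith
  then have "round x = 0 \<or> 1 \<le> real_of_int (round x) \<or> real_of_int (round x) \<le> - 1"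
    by linarith
  then show "\<bar>x\<bar> \<le> int_dist x"
    using assms unfolding int_dist_def by auto
qed

lemma int_dist_diff_le: "\<bar>int_dist x - int_dist u\<bar> \<le> int_dist (x - u)"
proof -
  have *: "int_dist x \<le> int_dist u + int_dist (x - u)" for x u
    using int_dist_le[of x "round u + round (x - u)"] by (simp add: int_dist_def)
  from *[of x u] *[of u x] show ?thesis
    using int_dist_minus[of "x - u"] by simp
qed

lemma int_dist_add_of_int: "int_dist (x + of_int k) = int_dist x"
proof -
  have *: "int_dist (x + of_int k) \<le> int_dist x" for x k
    using int_dist_le[of "x + of_int k" "round x + k"] by (simp add: int_dist_def)
  from *[of x k] *[of "x + of_int k" "- k"] show ?thesis by simp
qed

text \<open>With \<open>t = pi * \<bar>z\<bar> \<le> 2\<close> the cubic Maclaurin bound gives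
  \<open>sin t \<ge> t - t ^ 3 / 6 \<ge> t / 3 \<ge> \<bar>z\<bar>\<close>. The sine is preferred to
  the distance because its square integrates exactly against the Fejer kernel.\<close>

lemma int_dist_le_sin: "int_dist x \<le> \<bar>sin (pi * x)\<bar>"
proof -
  define z where "z = x - of_int (round x)"
  define t where "t = pi * \<bar>z\<bar>"
  have z: "\<bar>z\<bar> \<le> 1 / 2" using int_dist_le_half[of x] by (simp add: int_dist_def z_def)
  have t: "0 \<le> t" "t \<le> 2" "3 * \<bar>z\<bar> \<le> t"
  proof -
    show "0 \<le> t" by (simp add: t_def)
    show "3 * \<bar>z\<bar> \<le> t" unfolding t_def using pi_gt3 by (intro mult_right_mono) auto
    have "t \<le> 4 * (1 / 2)" unfolding t_def using pi_less_4 z by (intro mult_mono) auto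
    then show "t \<le> 2" by simp
  qed
  have "\<bar>sin t - t\<bar> \<le> t ^ 3 / 6"
    using Maclaurin_sin_bound[of t 3] t(1)
    by (simp add: sin_coeff_def numeral_3_eq_3 field_simps)
  then have "t - t ^ 3 / 6 \<le> sin t" by linarith
  moreover have "t ^ 3 \<le> 4 * t"
  proof -
    have "t * t \<le> 2 * 2" using t by (intro mult_mono) auto
    then have "t * t * t \<le> 4 * t" using t by (intro mult_right_mono) auto
    then show ?thesis by (simp add: power3_eq_cube)
  qed
  ultimately have "\<bar>z\<bar> \<le> sin t" using t by linarith
  also have "sin t \<le> \<bar>sin (pi * z)\<bar>"
    unfolding t_def by (cases "0 \<le> z") auto
  also have "\<bar>sin (pi * z)\<bar> = \<bar>sin (pi * x)\<bar>"
  proof -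
    have "sin (pi * of_int (round x)) = 0" by (metis mult.commute sin_integer_2pi sin_zero_iff_int2)
    moreover have "\<bar>cos (pi * of_int (round x))\<bar> = 1"
      using sin_cos_squared_add[of "pi * of_int (round x)"] \<open>sin (pi * of_int (round x)) = 0\<close>
      by (simp add: abs_square_eq_1)
    ultimately show ?thesis
      by (simp add: z_def right_diff_distrib sin_diff abs_mult)
  qed
  finally show ?thesis by (simp add: int_dist_def z_def)
qed

text \<open>A function of period 1 between the indicators of \<open>int_dist x \<le> a\<close> and
  \<open>int_dist x \<le> b\<close>. The linear slope gives both a Lipschitz bound and explicit
  Fourier coefficients.\<close>

definition trapezoid :: "real \<Rightarrow> real \<Rightarrow> real \<Rightarrow> real" where
  "trapezoid a b x = max 0 (min 1 ((b - int_dist x) / (b - a)))"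

lemma trapezoid_nonneg [simp]: "0 \<le> trapezoid a b x"
  and trapezoid_le_1: "trapezoid a b x \<le> 1"
  by (simp_all add: trapezoid_def)

lemma trapezoid_eq_1: "a < b \<Longrightarrow> int_dist x \<le> a \<Longrightarrow> trapezoid a b x = 1"
  by (simp add: trapezoid_def)

lemma trapezoid_eq_0: "a < b \<Longrightarrow> b \<le> int_dist x \<Longrightarrow> trapezoid a b x = 0"
  by (simp add: trapezoid_def divide_nonpos_pos)

lemma trapezoid_minus: "trapezoid a b (- x) = trapezoid a b x"
  by (simp add: trapezoid_def int_dist_minus)

lemma trapezoid_lipschitz:
  assumes "a < b"
  shows "\<bar>trapezoid a b u - trapezoid a b x\<bar> \<le> int_dist (x - u) / (b - a)"
proof -
  have "\<bar>trapezoid a b u - trapezoid a b x\<bar> \<le> \<bar>(b - int_dist u) / (b - a) - (b - int_dist x) / (b - a)\<bar>"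
    unfolding trapezoid_def by linarith
  also have "\<dots> = \<bar>int_dist x - int_dist u\<bar> / (b - a)"
    using assms by (simp flip: diff_divide_distrib)
  also have "\<dots> \<le> int_dist (x - u) / (b - a)"
    using assms by (intro divide_right_mono int_dist_diff_le) auto
  finally show ?thesis .
qed

lemma continuous_on_trapezoid [continuous_intros]:
  assumes "a < b" "continuous_on S g"
  shows "continuous_on S (\<lambda>x. trapezoid a b (g x))"
proof -
  have "continuous_on UNIV (trapezoid a b)"
    unfolding continuous_on_iff
  proof safe
    fix x e :: real assume "0 < e"
    have "dist (trapezoid a b u) (trapezoid a b x) < e" if "dist u x < e * (b - a)" for u
    proof -
      have "int_dist (x - u) \<le> \<bar>u - x\<bar>" using int_dist_le[of "x - u" 0] by simp
      then have "int_dist (x - u) / (b - a) < e"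
        using that assms by (simp add: dist_real_def field_simps)
      then show ?thesis using trapezoid_lipschitz[OF assms(1), of u x] by (simp add: dist_real_def)
    qed
    then show "\<exists>d>0. \<forall>x'\<in>UNIV. dist x' x < d \<longrightarrow> dist (trapezoid a b x') (trapezoid a b x) < e"
      using assms \<open>0 < e\<close> by (intro exI[of _ "e * (b - a)"]) auto
  qed
  then show ?thesis using assms(2) by (rule continuous_on_compose2) auto
qed

lemma has_integral_even:
  fixes g :: "real \<Rightarrow> real"
  assumes "(g has_integral I) {0..r}" "\<And>u. g (- u) = g u" "0 \<le> r"
  shows "(g has_integral (2 * I)) {-r..r}"
proof -
  have "((\<lambda>u. g (- u)) has_integral I) {-r..-0}"
    by (subst has_integral_reflect_real) (use assms in auto)
  then have "(g has_integral I) {-r..0}" by (simp add: assms)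
  with assms have "(g has_integral (I + I)) {-r..r}"
    by (intro has_integral_combine[of "-r" 0 r]) auto
  then show ?thesis by simp
qed

lemma trapezoid_pieces:
  assumes "0 < a" "a < b" "b \<le> 1 / 2"
  shows "u \<in> {0..a} \<Longrightarrow> trapezoid a b u = 1"
    and "u \<in> {a..b} \<Longrightarrow> trapezoid a b u = (b - u) / (b - a)"
    and "u \<in> {b..1/2} \<Longrightarrow> trapezoid a b u = 0"
proof -
  have [simp]: "int_dist u = u" if "0 \<le> u" "u \<le> 1/2" using that int_dist_eq_abs[of u] by simp
  show "u \<in> {0..a} \<Longrightarrow> trapezoid a b u = 1"
    using assms by (intro trapezoid_eq_1) auto
  show "u \<in> {a..b} \<Longrightarrow> trapezoid a b u = (b - u) / (b - a)"
    using assms by (simp add: trapezoid_def)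
  show "u \<in> {b..1/2} \<Longrightarrow> trapezoid a b u = 0"
    using assms by (intro trapezoid_eq_0) auto
qed

lemma has_integral_trapezoid_mult:
  fixes g :: "real \<Rightarrow> real"
  assumes ab: "0 < a" "a < b" "b \<le> 1 / 2"
    and "(g has_integral I1) {0..a}" "((\<lambda>u. (b - u) / (b - a) * g u) has_integral I2) {a..b}"
    and "\<And>u. g (- u) = g u"
  shows "((\<lambda>u. trapezoid a b u * g u) has_integral (2 * (I1 + I2))) {-(1/2)..1/2}"
proof -
  have "((\<lambda>u. trapezoid a b u * g u) has_integral I1) {0..a}"
    by (rule has_integral_eq[OF _ assms(4)]) (use trapezoid_pieces[OF ab] in auto)
  moreover have "((\<lambda>u. trapezoid a b u * g u) has_integral I2) {a..b}"
    by (rule has_integral_eq[OF _ assms(5)]) (use trapezoid_pieces[OF ab] in auto)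
  moreover have "((\<lambda>u. trapezoid a b u * g u) has_integral 0) {b..1/2}"
    by (rule has_integral_is_0) (use trapezoid_pieces[OF ab] in auto)
  ultimately have "((\<lambda>u. trapezoid a b u * g u) has_integral (I1 + I2 + 0)) {0..1/2}"
    using ab by (intro has_integral_combine[of 0 b "1/2"] has_integral_combine[of 0 a b]) auto
  then show ?thesis
    using has_integral_even[of "\<lambda>u. trapezoid a b u * g u" "I1 + I2" "1/2"] assms(6)
    by (simp add: trapezoid_minus)
qed

lemma integral_trapezoid:
  assumes "0 < a" "a < b" "b \<le> 1 / 2"
  shows "(trapezoid a b has_integral (a + b)) {-(1/2)..1/2}"
proof -
  have "((\<lambda>u. 1) has_integral a) {0..a}"
    using has_integral_const_real[of "1::real" 0 a] assms by simp
  moreover have "((\<lambda>u. (b - u) / (b - a) * 1) has_integral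
      (- ((b - b)\<^sup>2 / (2 * (b - a))) - - ((b - a)\<^sup>2 / (2 * (b - a))))) {a..b}"
  proof -
    define d where "d = b - a"
    have d: "0 < d" using assms by (simp add: d_def)
    have "((\<lambda>u. - ((b - u)\<^sup>2 / (2 * d))) has_real_derivative (b - u) / d * 1) (at u within S)" for u S
      using d by (auto intro!: derivative_eq_intros simp: field_simps)
    then show ?thesis using assms unfolding d_def
      by (intro fundamental_theorem_of_calculus)
         (auto simp flip: has_real_derivative_iff_has_vector_derivative)
  qed
  ultimately have "((\<lambda>u. trapezoid a b u * 1) has_integral
      (2 * (a + (- ((b - b)\<^sup>2 / (2 * (b - a))) - - ((b - a)\<^sup>2 / (2 * (b - a))))))) {-(1/2)..1/2}"
    using assms by (intro has_integral_trapezoid_mult) auto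
  moreover have "2 * (a + (- ((b - b)\<^sup>2 / (2 * (b - a))) - - ((b - a)\<^sup>2 / (2 * (b - a))))) = a + b"
  proof -
    have "(b - a)\<^sup>2 / (2 * (b - a)) = (b - a) / 2"
    proof -
      have "d\<^sup>2 / (2 * d) = d / 2" for d :: real by (simp add: power2_eq_square)
      then show ?thesis .
    qed
    then show ?thesis by (simp only:) (simp add: diff_divide_distrib)
  qed
  ultimately show ?thesis by (simp only: mult_1_right)
qed

lemma integral_trapezoid_cos:
  assumes "0 < a" "a < b" "b \<le> 1 / 2" "0 < w"
  shows "((\<lambda>u. trapezoid a b u * cos (w * u)) has_integral
    2 * (cos (w * a) - cos (w * b)) / (w\<^sup>2 * (b - a))) {-(1/2)..1/2}"
proof -
  \<comment> \<open>Integration by parts yields this antiderivative on the slope. Its sine term at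
    \<open>a\<close> cancels the integral over the plateau, which leaves only the cosine terms with
    \<open>w\<^sup>2\<close> in the denominator.\<close>
  define G where "G u = (b - u) / (b - a) * (sin (w * u) / w) - cos (w * u) / (w\<^sup>2 * (b - a))" for u
  have "((\<lambda>u. cos (w * u)) has_integral (sin (w * a) / w - sin (w * 0) / w)) {0..a}"
    using assms
    by (intro fundamental_theorem_of_calculus)
       (auto simp flip: has_real_derivative_iff_has_vector_derivative intro!: derivative_eq_intros)
  moreover have "((\<lambda>u. (b - u) / (b - a) * cos (w * u)) has_integral (G b - G a)) {a..b}"
  proof -
    define d where "d = b - a"
    have d: "0 < d" using assms by (simp add: d_def)
    have "(G has_real_derivative (b - u) / (b - a) * cos (w * u)) (at u within S)" for u S
      unfolding G_def d_def[symmetric] using d assms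
      by (auto intro!: derivative_eq_intros) (simp add: field_simps power2_eq_square)
    then show ?thesis using assms
      by (intro fundamental_theorem_of_calculus)
         (auto simp flip: has_real_derivative_iff_has_vector_derivative)
  qed
  ultimately have "((\<lambda>u. trapezoid a b u * cos (w * u)) has_integral
      (2 * ((sin (w * a) / w - sin (w * 0) / w) + (G b - G a)))) {-(1/2)..1/2}"
    using assms by (intro has_integral_trapezoid_mult) auto
  moreover have "2 * ((sin (w * a) / w - sin (w * 0) / w) + (G b - G a))
      = 2 * (cos (w * a) - cos (w * b)) / (w\<^sup>2 * (b - a))"
    using assms by (simp add: G_def diff_divide_distrib)
  ultimately show ?thesis by simp
qed

section \<open>The Fejer kernel and approximation by its means\<close>

definition fejer :: "nat \<Rightarrow> real \<Rightarrow> real" where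
  "fejer K z = 1 + (\<Sum>k\<in>{1..<K}. 2 * (1 - real k / real K) * cos (2 * pi * real k * z))"

text \<open>\<open>K\<close> times the kernel is the squared modulus of the exponential sum over
  \<open>j < K\<close>, written with cosines and sines and proved by induction on the number of
  terms.\<close>

lemma fejer_nonneg: "0 < K \<Longrightarrow> 0 \<le> fejer K z"
proof -
  assume "0 < K"
  define t where "t = 2 * pi * z"
  have "real n + (\<Sum>k\<in>{1..<n}. 2 * (real n - real k) * cos (real k * t))
      = (\<Sum>j<n. cos (real j * t))\<^sup>2 + (\<Sum>j<n. sin (real j * t))\<^sup>2" for n
  proof (induction n)
    case (Suc n)
    define A where "A = (\<Sum>j<n. cos (real j * t))"
    define B where "B = (\<Sum>j<n. sin (real j * t))"
    have "(A + cos (real n * t))\<^sup>2 + (B + sin (real n * t))\<^sup>2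
        = A\<^sup>2 + B\<^sup>2 + ((cos (real n * t))\<^sup>2 + (sin (real n * t))\<^sup>2) + 2 * (A * cos (real n * t) + B * sin (real n * t))"
      by (simp add: power2_sum algebra_simps)
    also have "(cos (real n * t))\<^sup>2 + (sin (real n * t))\<^sup>2 = 1" by simp
    also have "A * cos (real n * t) + B * sin (real n * t) = (\<Sum>j<n. cos (real (n - j) * t))"
      unfolding A_def B_def sum_distrib_right sum.distrib[symmetric]
      by (intro sum.cong) (auto simp: of_nat_diff left_diff_distrib right_diff_distrib cos_diff mult.commute)
    also have "\<dots> = (\<Sum>k\<in>{1..<Suc n}. cos (real k * t))"
      by (rule sum.reindex_bij_witness[of _ "\<lambda>k. n - k" "\<lambda>j. n - j"]) auto
    also have "A\<^sup>2 + B\<^sup>2 = real n + (\<Sum>k\<in>{1..<n}. 2 * (real n - real k) * cos (real k * t))"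
      using Suc by (simp add: A_def B_def)
    \<comment> \<open>The additional term \<open>k = n\<close> has coefficient zero.\<close>
    also have "(\<Sum>k\<in>{1..<n}. 2 * (real n - real k) * cos (real k * t))
        = (\<Sum>k\<in>{1..<Suc n}. 2 * (real n - real k) * cos (real k * t))"
      by (cases n) auto
    finally have "(A + cos (real n * t))\<^sup>2 + (B + sin (real n * t))\<^sup>2
        = real (Suc n) + ((\<Sum>k\<in>{1..<Suc n}. 2 * (real n - real k) * cos (real k * t))
           + 2 * (\<Sum>k\<in>{1..<Suc n}. cos (real k * t)))" by simp
    also have "(\<Sum>k\<in>{1..<Suc n}. 2 * (real n - real k) * cos (real k * t))
           + 2 * (\<Sum>k\<in>{1..<Suc n}. cos (real k * t))
        = (\<Sum>k\<in>{1..<Suc n}. 2 * (real (Suc n) - real k) * cos (real k * t))"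
      unfolding sum_distrib_left sum.distrib[symmetric] by (intro sum.cong) (auto simp: algebra_simps)
    finally show ?case by (simp add: A_def B_def)
  qed simp
  from this[of K] have "0 \<le> real K + (\<Sum>k\<in>{1..<K}. 2 * (real K - real k) * cos (real k * t))"
    by simp
  also have "\<dots> = real K * fejer K z"
    unfolding fejer_def distrib_left sum_distrib_left t_def using \<open>0 < K\<close>
    by (auto intro!: sum.cong simp: field_simps)
  finally show ?thesis using \<open>0 < K\<close> by (simp add: zero_le_mult_iff)
qed

lemma has_integral_cos_period:
  assumes "1 \<le> k"
  shows "((\<lambda>u. cos (2 * pi * real k * (x - u))) has_integral 0) {-(1/2)..1/2}"
proof -
  define w where "w = pi * real k"
  have w: "0 < w" using assms by (simp add: w_def)
  have "((\<lambda>u. cos (2 * w * (x - u))) has_integral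
      (- sin (2 * w * (x - 1/2)) / (2 * w) - (- sin (2 * w * (x - -(1/2))) / (2 * w)))) {-(1/2)..1/2}"
    using w
    by (intro fundamental_theorem_of_calculus)
       (auto simp flip: has_real_derivative_iff_has_vector_derivative intro!: derivative_eq_intros)
  moreover have "sin (2 * w * (x - 1/2)) = sin (2 * w * (x - -(1/2)))"
  proof -
    have "sin (2 * w * (x - 1/2)) = sin (2 * w * x - w)" "sin (2 * w * (x - -(1/2))) = sin (2 * w * x + w)"
      by (simp_all add: algebra_simps)
    moreover have "sin w = 0" by (simp add: w_def mult.commute)
    ultimately show ?thesis by (simp add: sin_diff sin_add)
  qed
  ultimately show ?thesis by (simp add: w_def mult.assoc)
qed

lemma has_integral_cos_cos_period:
  assumes "1 \<le> k"
  shows "((\<lambda>u. cos (2 * pi * real k * (x - u)) * cos (2 * pi * (x - u))) has_integral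
    (if k = 1 then 1/2 else 0)) {-(1/2)..1/2}"
proof -
  have "cos (2 * pi * real k * z) * cos (2 * pi * z)
      = 1/2 * (cos (2 * pi * real (k - 1) * z) + cos (2 * pi * real (k + 1) * z))" for z
  proof -
    have "2 * pi * real (k - 1) * z = 2 * pi * real k * z - 2 * pi * z"
      "2 * pi * real (k + 1) * z = 2 * pi * real k * z + 2 * pi * z"
      using assms by (simp_all add: of_nat_diff algebra_simps)
    then show ?thesis by (simp only: cos_diff cos_add) simp
  qed
  moreover have "((\<lambda>u. cos (2 * pi * real (k - 1) * (x - u))) has_integral (if k = 1 then 1 else 0)) {-(1/2)..1/2}"
  proof (cases "k = 1")
    case True
    then show ?thesis using has_integral_const_real[of "1::real" "-(1/2)" "1/2"] by simp
  next
    case False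
    then show ?thesis using has_integral_cos_period[of "k - 1" x] assms by simp
  qed
  moreover have "((\<lambda>u. cos (2 * pi * real (k + 1) * (x - u))) has_integral 0) {-(1/2)..1/2}"
    by (rule has_integral_cos_period) simp
  ultimately have "((\<lambda>u. cos (2 * pi * real k * (x - u)) * cos (2 * pi * (x - u))) has_integral
      1/2 * ((if k = 1 then 1 else 0) + 0)) {-(1/2)..1/2}"
    by (simp only:) (intro has_integral_mult_right has_integral_add)
  then show ?thesis by (simp split: if_splits)
qed

lemma has_integral_fejer:
  "((\<lambda>u. fejer K (x - u)) has_integral 1) {-(1/2)..1/2}"
proof -
  have "((\<lambda>u. fejer K (x - u)) has_integral
      (1 + (\<Sum>k\<in>{1..<K}. 2 * (1 - real k / real K) * 0))) {-(1/2)..1/2}"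
    unfolding fejer_def using has_integral_const_real[of "1::real" "-(1/2)" "1/2"]
    by (intro has_integral_add has_integral_sum has_integral_mult_right has_integral_cos_period) auto
  then show ?thesis by simp
qed

text \<open>Half of \<open>1 - cos (2 * pi * z)\<close> replaces the squared sine, so only the
  frequencies 0 and 1 of the kernel contribute: half of \<open>1 - (1 - 1 / K)\<close>.\<close>

lemma has_integral_fejer_sin:
  assumes "0 < K"
  shows "((\<lambda>u. fejer K (x - u) * (sin (pi * (x - u)))\<^sup>2) has_integral (1 / (2 * real K))) {-(1/2)..1/2}"
proof -
  have "((\<lambda>u. 1 * cos (2 * pi * (x - u)) + (\<Sum>k\<in>{1..<K}. (2 * (1 - real k / real K)) *
      (cos (2 * pi * real k * (x - u)) * cos (2 * pi * (x - u))))) has_integral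
      (0 + (\<Sum>k\<in>{1..<K}. (2 * (1 - real k / real K)) * (if k = 1 then 1/2 else 0)))) {-(1/2)..1/2}"
    using has_integral_cos_period[of 1 x]
    by (intro has_integral_add has_integral_sum has_integral_mult_right has_integral_cos_cos_period) auto
  moreover have "(\<lambda>u. 1 * cos (2 * pi * (x - u)) + (\<Sum>k\<in>{1..<K}. (2 * (1 - real k / real K)) *
      (cos (2 * pi * real k * (x - u)) * cos (2 * pi * (x - u)))))
      = (\<lambda>u. fejer K (x - u) * cos (2 * pi * (x - u)))"
    by (simp add: fejer_def distrib_right sum_distrib_right mult.assoc)
  moreover have "(\<Sum>k\<in>{1..<K}. (2 * (1 - real k / real K)) * (if k = 1 then 1/2 else 0)) = 1 - 1 / real K"
  proof (cases "K = 1")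
    case False
    then have "1 \<in> {1..<K}" using assms by auto
    then show ?thesis by (simp add: if_distrib sum.delta cong: if_cong)
  qed simp
  ultimately have "((\<lambda>u. fejer K (x - u) * cos (2 * pi * (x - u))) has_integral (1 - 1 / real K)) {-(1/2)..1/2}"
    by simp
  from has_integral_mult_right[OF has_integral_diff[OF has_integral_fejer[of K x] this], of "1/2"]
  have "((\<lambda>u. 1/2 * (fejer K (x - u) - fejer K (x - u) * cos (2 * pi * (x - u)))) has_integral
      (1 / (2 * real K))) {-(1/2)..1/2}" by simp
  moreover have "1/2 * (fejer K z - fejer K z * cos (2 * pi * z)) = fejer K z * (sin (pi * z))\<^sup>2" for z
  proof -
    have "cos (2 * pi * z) = 1 - 2 * (sin (pi * z))\<^sup>2"
      using cos_double_sin[of "pi * z"] by (simp add: mult_ac)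
    then show ?thesis by (simp only:) (simp add: algebra_simps)
  qed
  ultimately show ?thesis by simp
qed

lemma continuous_on_fejer [continuous_intros]:
  fixes S :: "real set"
  shows "continuous_on S g \<Longrightarrow> continuous_on S (\<lambda>u. fejer K (g u))"
  unfolding fejer_def by (auto intro!: continuous_intros)

text \<open>The Lipschitz bound reduces the error to the first absolute moment of the kernel. This
  is controlled by total mass 1 and second moment of order \<open>1 / K\<close>, hence has order
  \<open>1 / r\<close> for \<open>K = r\<^sup>2\<close>; taking \<open>K\<close> to be a square
  keeps roots out of the statement.\<close>

lemma fejer_approximation:
  assumes ab: "0 < a" "a < b" and r: "0 < r" "K = r\<^sup>2"
  shows "\<bar>integral {-(1/2)..1/2} (\<lambda>u. fejer K (x - u) * trapezoid a b u) - trapezoid a b x\<bar>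
    \<le> 1 / ((b - a) * real r)"
proof -
  have K: "0 < K" using r by simp
  define I where "I = {-(1/2)..1/2::real}"
  define f where "f = trapezoid a b"
  have cont: "continuous_on I f" unfolding f_def using ab by (intro continuous_intros)
  have int: "(\<lambda>u. fejer K (x - u) * f u) integrable_on I" "(\<lambda>u. fejer K (x - u) * f x) integrable_on I"
    "(\<lambda>u. fejer K (x - u) * (f u - f x)) integrable_on I"
    unfolding I_def by (intro integrable_continuous_real continuous_intros cont[unfolded I_def])+
  have "integral I (\<lambda>u. fejer K (x - u) * (f u - f x))
      = integral I (\<lambda>u. fejer K (x - u) * f u) - integral I (\<lambda>u. fejer K (x - u) * f x)"
    unfolding right_diff_distrib by (intro integral_diff int)
  also have "integral I (\<lambda>u. fejer K (x - u) * f x) = f x"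
    unfolding I_def
    by (rule integral_unique) (use has_integral_mult_left[OF has_integral_fejer[of K x], of "f x"] in simp)
  finally have eq: "integral I (\<lambda>u. fejer K (x - u) * f u) - f x = integral I (\<lambda>u. fejer K (x - u) * (f u - f x))"
    by simp
  \<comment> \<open>The weights \<open>1 / (2 * r)\<close> and \<open>r / 2\<close> come from
    expanding \<open>(r * s - 1)\<^sup>2 \<ge> 0\<close> for the sine \<open>s\<close>; both parts
    then integrate to order \<open>1 / r\<close>.\<close>
  define g where "g u = 1 / (b - a) * (1 / (2 * real r) * fejer K (x - u) + real r / 2 * (fejer K (x - u) * (sin (pi * (x - u)))\<^sup>2))" for u
  have g: "(g has_integral 1 / (b - a) * (1 / (2 * real r) * 1 + real r / 2 * (1 / (2 * real K)))) I"
    unfolding g_def I_def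
    by (intro has_integral_mult_right has_integral_add has_integral_fejer has_integral_fejer_sin K)
  have "norm (integral I (\<lambda>u. fejer K (x - u) * (f u - f x))) \<le> integral I g"
  proof (rule integral_norm_bound_integral)
    show "g integrable_on I" using g by (rule has_integral_integrable)
    fix u
    define s where "s = \<bar>sin (pi * (x - u))\<bar>"
    have "\<bar>f u - f x\<bar> \<le> s / (b - a)"
      unfolding f_def s_def
      by (rule order.trans[OF trapezoid_lipschitz]) (use ab in \<open>auto intro!: divide_right_mono int_dist_le_sin\<close>)
    also have "s \<le> 1 / (2 * real r) + real r / 2 * s\<^sup>2"
    proof -
      have "0 \<le> (real r * s - 1)\<^sup>2" by simp
      then have "2 * (real r * s) \<le> 1 + real r * (real r * s\<^sup>2)"
        by (simp add: power2_eq_square algebra_simps)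
      then show ?thesis using r by (simp add: field_simps)
    qed
    finally have "\<bar>f u - f x\<bar> \<le> (1 / (2 * real r) + real r / 2 * s\<^sup>2) / (b - a)"
      using ab by (simp add: divide_right_mono)
    then have "fejer K (x - u) * \<bar>f u - f x\<bar> \<le> fejer K (x - u) * ((1 / (2 * real r) + real r / 2 * s\<^sup>2) / (b - a))"
      by (intro mult_left_mono fejer_nonneg K)
    moreover have "fejer K (x - u) * ((1 / (2 * real r) + real r / 2 * s\<^sup>2) / (b - a)) = g u"
      by (simp add: g_def s_def algebra_simps add_divide_distrib)
    moreover have "norm (fejer K (x - u) * (f u - f x)) = fejer K (x - u) * \<bar>f u - f x\<bar>"
      using fejer_nonneg[OF K, of "x - u"] by (simp add: abs_mult del: right_diff_distrib)
    ultimately show "norm (fejer K (x - u) * (f u - f x)) \<le> g u" by simp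
  qed (rule int)
  also have "integral I g = 1 / (b - a) * (1 / (2 * real r) * 1 + real r / 2 * (1 / (2 * real K)))"
    using g by (rule integral_unique)
  also have "\<dots> = 3 / 4 * (1 / ((b - a) * real r))"
    using r ab by (simp add: field_simps power2_eq_square)
  also have "\<dots> \<le> 1 / ((b - a) * real r)" using ab by (intro mult_left_le_one_le) auto
  finally show ?thesis unfolding eq[unfolded f_def I_def] f_def I_def real_norm_def .
qed

definition trig_poly :: "nat \<Rightarrow> (nat \<Rightarrow> real) \<Rightarrow> real \<Rightarrow> real" where
  "trig_poly K c x = c 0 + (\<Sum>k\<in>{1..<K}. c k * cos (2 * pi * real k * x))"

text \<open>The coefficients are the Fourier coefficients damped by the Fejer weights. Damping
  leaves the constant coefficient untouched, so the mean is exactly \<open>a + b\<close> and the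
  approximation causes no error in the main term.\<close>

lemma trapezoid_trig_poly:
  assumes ab: "0 < a" "a < b" "b \<le> 1 / 2" and r: "0 < r" "K = r\<^sup>2"
  obtains c where "c 0 = a + b"
    and "\<And>k. k \<in> {1..<K} \<Longrightarrow> \<bar>c k\<bar> \<le> 2 * (a + b)" and "\<And>k. k \<in> {1..<K} \<Longrightarrow> \<bar>c k\<bar> \<le> 1 / real k"
    and "\<And>x. \<bar>trig_poly K c x - trapezoid a b x\<bar> \<le> 1 / ((b - a) * real r)"
proof -
  define I where "I = {-(1/2)..1/2::real}"
  define f where "f = trapezoid a b"
  define e where "e k = integral I (\<lambda>u. f u * cos (2 * pi * real k * u))" for k
  define c where "c k = (if k = 0 then a + b else 2 * (1 - real k / real K) * e k)" for k
  have cont: "continuous_on I f" unfolding f_def using ab by (intro continuous_intros)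
  have int0: "(f has_integral (a + b)) I" unfolding f_def I_def using ab by (rule integral_trapezoid)
  have intc: "((\<lambda>u. f u * cos (2 * pi * real k * u)) has_integral e k) I" for k
    unfolding e_def I_def by (intro integrable_integral integrable_continuous_real continuous_intros cont[unfolded I_def])
  \<comment> \<open>The trapezoid is even, so the sine coefficients vanish: reflection shows that
    the integral equals its negative.\<close>
  have ints: "((\<lambda>u. f u * sin (2 * pi * real k * u)) has_integral 0) I" for k
  proof -
    obtain J where J: "((\<lambda>u. f u * sin (2 * pi * real k * u)) has_integral J) {-(1/2)..1/2}"
      using integrable_continuous_real[of "-(1/2)" "1/2" "\<lambda>u. f u * sin (2 * pi * real k * u)"]
        cont by (force simp: I_def integrable_on_def intro!: continuous_intros)
    then have "((\<lambda>u. f (- u) * sin (2 * pi * real k * - u)) has_integral J) {-(1/2)..- (-(1/2))}"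
      by (subst has_integral_reflect_real) simp
    then have "((\<lambda>u. - (f u * sin (2 * pi * real k * u))) has_integral J) {-(1/2)..1/2}"
      by (simp add: f_def trapezoid_minus)
    with has_integral_neg[OF J] have "J = - J" by (rule has_integral_unique[rotated])
    with J show ?thesis by (simp add: I_def)
  qed
  have e_le: "\<bar>e k\<bar> \<le> a + b" for k
  proof -
    have "norm (integral I (\<lambda>u. f u * cos (2 * pi * real k * u))) \<le> integral I f"
    proof (rule integral_norm_bound_integral)
      show "norm (f u * cos (2 * pi * real k * u)) \<le> f u" for u
        by (simp add: f_def abs_mult mult_left_le)
    qed (use int0 intc has_integral_integrable in blast)+
    then show ?thesis using int0 by (simp add: e_def integral_unique)
  qed
  have e_le': "\<bar>e k\<bar> \<le> 1 / (2 * real k)" if "1 \<le> k" for k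
  proof -
    define w where "w = 2 * pi * real k"
    have w: "0 < w" using that by (simp add: w_def)
    have "e k = 2 * (cos (w * a) - cos (w * b)) / (w\<^sup>2 * (b - a))"
      using integral_trapezoid_cos[OF ab w] by (simp add: e_def I_def f_def w_def integral_unique)
    then have "\<bar>e k\<bar> = 2 * \<bar>cos (w * a) - cos (w * b)\<bar> / (w\<^sup>2 * (b - a))"
      using ab w by (simp only: abs_divide abs_mult) simp
    \<comment> \<open>This factor cancels \<open>b - a\<close> in the denominator, so the bound
      \<open>1 / k\<close> does not depend on the steepness of the slope.\<close>
    also have "\<bar>cos (w * a) - cos (w * b)\<bar> \<le> w * (b - a)"
    proof -
      have "\<bar>cos (w * a) - cos (w * b)\<bar> = 2 * \<bar>sin ((w * a + w * b) / 2)\<bar> * \<bar>sin ((w * b - w * a) / 2)\<bar>"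
        by (simp add: cos_diff_cos abs_mult)
      also have "\<dots> \<le> 2 * 1 * \<bar>(w * b - w * a) / 2\<bar>"
        by (intro mult_mono abs_sin_le_one abs_sin_x_le_abs_x) auto
      also have "\<dots> = w * (b - a)" using w ab by (simp add: right_diff_distrib[symmetric])
      finally show ?thesis .
    qed
    also have "2 * (w * (b - a)) / (w\<^sup>2 * (b - a)) = 2 / w"
    proof -
      have "2 * (w * d) / (w\<^sup>2 * d) = 2 / w" if "0 < d" for d
        using that w by (simp add: power2_eq_square)
      then show ?thesis using ab by simp
    qed
    also have "\<dots> \<le> 1 / (2 * real k)"
      using that pi_gt3 by (simp add: w_def field_simps)
    finally show ?thesis using w ab by (simp add: divide_right_mono)
  qed
  have expand: "integral I (\<lambda>u. fejer K (x - u) * f u) = trig_poly K c x" for x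
  proof (rule integral_unique)
    have "((\<lambda>u. f u + (\<Sum>k\<in>{1..<K}. 2 * (1 - real k / real K) *
        (cos (2 * pi * real k * x) * (f u * cos (2 * pi * real k * u))
         + sin (2 * pi * real k * x) * (f u * sin (2 * pi * real k * u))))) has_integral
        (a + b + (\<Sum>k\<in>{1..<K}. 2 * (1 - real k / real K) *
        (cos (2 * pi * real k * x) * e k + sin (2 * pi * real k * x) * 0)))) I"
      by (intro has_integral_add has_integral_sum has_integral_mult_right int0 intc ints) auto
    moreover have "(\<lambda>u. f u + (\<Sum>k\<in>{1..<K}. 2 * (1 - real k / real K) *
        (cos (2 * pi * real k * x) * (f u * cos (2 * pi * real k * u))
         + sin (2 * pi * real k * x) * (f u * sin (2 * pi * real k * u)))))
        = (\<lambda>u. fejer K (x - u) * f u)"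
      by (auto simp: fejer_def fun_eq_iff distrib_right sum_distrib_right right_diff_distrib[of "2 * pi * real _"] cos_diff
        intro!: sum.cong)
    moreover have "(a + b + (\<Sum>k\<in>{1..<K}. 2 * (1 - real k / real K) *
        (cos (2 * pi * real k * x) * e k + sin (2 * pi * real k * x) * 0))) = trig_poly K c x"
      by (auto simp: trig_poly_def c_def intro!: sum.cong)
    ultimately show "((\<lambda>u. fejer K (x - u) * f u) has_integral trig_poly K c x) I" by simp
  qed
  have c_le: "\<bar>c k\<bar> \<le> 2 * \<bar>e k\<bar>" if "k \<in> {1..<K}" for k
  proof -
    have "\<bar>2 * (1 - real k / real K)\<bar> \<le> 2" using that by (auto simp: field_simps)
    then show ?thesis using that by (auto simp: c_def abs_mult intro!: mult_right_mono)
  qed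
  show ?thesis
  proof (rule that)
    show "c 0 = a + b" by (simp add: c_def)
    fix k assume k: "k \<in> {1..<K}"
    show "\<bar>c k\<bar> \<le> 2 * (a + b)" using c_le[OF k] e_le[of k] by simp
    show "\<bar>c k\<bar> \<le> 1 / real k" using c_le[OF k] e_le'[of k] k by simp
  next
    show "\<bar>trig_poly K c x - trapezoid a b x\<bar> \<le> 1 / ((b - a) * real r)" for x
      using fejer_approximation[OF ab(1,2) r, of x] expand[of x] by (simp add: I_def f_def)
  qed
qed

section \<open>Integrals of cosine polynomials\<close>

text \<open>Since \<open>T\<close> is a natural number, the interval consists of whole periods of
  every nonzero integer frequency. This makes the correlations in the first coordinate
  exact.\<close>

lemma has_integral_cos_nat:
  fixes T :: nat
  assumes "1 \<le> n"
  shows "((\<lambda>x. cos (2 * pi * real n * x)) has_integral 0) {- real T..real T}"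
proof -
  have "((\<lambda>x. cos (2 * pi * real n * x)) has_integral
      (sin (2 * pi * real n * real T) / (2 * pi * real n) - sin (2 * pi * real n * - real T) / (2 * pi * real n)))
      {- real T..real T}"
    using assms
    by (intro fundamental_theorem_of_calculus)
       (auto simp flip: has_real_derivative_iff_has_vector_derivative intro!: derivative_eq_intros)
  moreover have "sin (2 * pi * real n * real T) = 0"
  proof -
    have "2 * pi * real n * real T = real (2 * n * T) * pi" by simp
    then show ?thesis by (simp only: sin_npi)
  qed
  ultimately show ?thesis by simp
qed

lemma has_integral_cos_mult_cos_nat:
  fixes T :: nat
  assumes "1 \<le> m" "1 \<le> n"
  shows "((\<lambda>x. cos (2 * pi * real m * x) * cos (2 * pi * real n * x)) has_integral
    (if m = n then real T else 0)) {- real T..real T}"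
proof -
  define d where "d = (if m \<le> n then n - m else m - n)"
  have "cos (2 * pi * real m * x) * cos (2 * pi * real n * x)
      = 1/2 * (cos (2 * pi * real d * x) + cos (2 * pi * real (m + n) * x))" for x
  proof -
    have "2 * pi * real (m + n) * x = 2 * pi * real m * x + 2 * pi * real n * x"
      by (simp add: algebra_simps)
    moreover have "cos (2 * pi * real d * x) = cos (2 * pi * real m * x - 2 * pi * real n * x)"
    proof (cases "m \<le> n")
      case True
      then have "2 * pi * real d * x = - (2 * pi * real m * x - 2 * pi * real n * x)"
        by (simp add: d_def of_nat_diff algebra_simps)
      then show ?thesis by (simp only: cos_minus)
    next
      case False
      then show ?thesis by (simp add: d_def of_nat_diff algebra_simps)
    qed
    ultimately show ?thesis by (simp only: cos_add cos_diff) simp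
  qed
  moreover have "((\<lambda>x. cos (2 * pi * real d * x)) has_integral (if m = n then 2 * real T else 0)) {- real T..real T}"
  proof (cases "m = n")
    case True
    then show ?thesis using has_integral_const_real[of "1::real" "- real T" "real T"] by (simp add: d_def)
  next
    case False
    then show ?thesis using has_integral_cos_nat[of d T] by (auto simp: d_def)
  qed
  moreover have "((\<lambda>x. cos (2 * pi * real (m + n) * x)) has_integral 0) {- real T..real T}"
    by (rule has_integral_cos_nat) (use assms in simp)
  ultimately have "((\<lambda>x. cos (2 * pi * real m * x) * cos (2 * pi * real n * x)) has_integral
      1/2 * ((if m = n then 2 * real T else 0) + 0)) {- real T..real T}"
    by (simp only:) (intro has_integral_mult_right has_integral_add)
  then show ?thesis by (simp split: if_splits)
qed

text \<open>For a real frequency the interval need not consist of periods; the bound combines the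
  length \<open>2 * T\<close> with the decay of the antiderivative, and \<open>1 \<le> T\<close>
  absorbs the factor \<open>1 / pi\<close>.\<close>

lemma has_integral_cos_real:
  assumes "1 \<le> T"
  shows "\<exists>I. ((\<lambda>x. cos (2 * pi * a * x)) has_integral I) {- T..T} \<and> \<bar>I\<bar> \<le> 2 * T * trunc_inv \<bar>a\<bar>"
proof -
  define J where "J = integral {- T..T} (\<lambda>x. cos (2 * pi * a * x))"
  have hJ: "((\<lambda>x. cos (2 * pi * a * x)) has_integral J) {- T..T}"
    unfolding J_def by (intro integrable_integral integrable_continuous_real continuous_intros)
  have triv: "\<bar>J\<bar> \<le> 2 * T"
  proof -
    have "norm J \<le> 1 * measure lborel {- T..T}"
      by (rule has_integral_bound_real[OF _ _ hJ]) auto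
    then show ?thesis using assms by simp
  qed
  have "\<bar>J\<bar> \<le> 2 * T * trunc_inv \<bar>a\<bar>"
  proof (cases "\<bar>a\<bar> \<le> 1")
    case True
    then show ?thesis using triv by (simp add: trunc_inv_def)
  next
    case False
    then have "((\<lambda>x. cos (2 * pi * a * x)) has_integral
      (sin (2 * pi * a * T) / (2 * pi * a) - sin (2 * pi * a * - T) / (2 * pi * a))) {- T..T}"
      using assms
      by (intro fundamental_theorem_of_calculus)
         (auto simp flip: has_real_derivative_iff_has_vector_derivative intro!: derivative_eq_intros)
    then have "J = sin (2 * pi * a * T) / (2 * pi * a) - sin (2 * pi * a * - T) / (2 * pi * a)"
      using hJ has_integral_unique by blast
    then have "J = sin (2 * pi * a * T) / (pi * a)" by simp
    then have "\<bar>J\<bar> \<le> 1 / (pi * \<bar>a\<bar>)"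
      using abs_sin_le_one[of "2 * pi * a * T"]
      by (simp add: abs_mult divide_right_mono)
    also have "\<dots> \<le> 2 * T * (1 / \<bar>a\<bar>)"
    proof -
      have "1 / pi \<le> 2 * T" using pi_gt3 assms
      proof -
        have "1 / pi \<le> 1" using pi_gt3 by simp
        then show ?thesis using assms by linarith
      qed
      then have "1 / pi * (1 / \<bar>a\<bar>) \<le> 2 * T * (1 / \<bar>a\<bar>)" by (intro mult_right_mono) auto
      then show ?thesis by simp
    qed
    finally show ?thesis using False by (simp add: trunc_inv_def)
  qed
  with hJ show ?thesis by blast
qed

text \<open>The product splits into the frequencies \<open>k * (a - b)\<close> and
  \<open>k * (a + b)\<close>; as \<open>a\<close> and \<open>b\<close> are nonnegative, the second
  is at least as large in absolute value, so the first one decides.\<close>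

lemma has_integral_cos_mult_cos_real:
  assumes "1 \<le> T" "0 \<le> a" "0 \<le> b" "0 \<le> k"
  shows "\<exists>I. ((\<lambda>x. cos (2 * pi * k * (a * x)) * cos (2 * pi * k * (b * x))) has_integral I) {- T..T} \<and>
    \<bar>I\<bar> \<le> 2 * T * trunc_inv (k * \<bar>a - b\<bar>)"
proof -
  obtain I where I: "((\<lambda>x. cos (2 * pi * (k * (a - b)) * x)) has_integral I) {- T..T}"
    "\<bar>I\<bar> \<le> 2 * T * trunc_inv \<bar>k * (a - b)\<bar>" using has_integral_cos_real[OF assms(1)] by blast
  obtain J where J: "((\<lambda>x. cos (2 * pi * (k * (a + b)) * x)) has_integral J) {- T..T}"
    "\<bar>J\<bar> \<le> 2 * T * trunc_inv \<bar>k * (a + b)\<bar>" using has_integral_cos_real[OF assms(1)] by blast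
  have "cos (2 * pi * k * (a * x)) * cos (2 * pi * k * (b * x))
      = 1/2 * (cos (2 * pi * (k * (a - b)) * x) + cos (2 * pi * (k * (a + b)) * x))" for x
  proof -
    have "2 * pi * (k * (a - b)) * x = 2 * pi * k * (a * x) - 2 * pi * k * (b * x)"
      "2 * pi * (k * (a + b)) * x = 2 * pi * k * (a * x) + 2 * pi * k * (b * x)"
      by (simp_all add: algebra_simps)
    then show ?thesis by (simp only: cos_add cos_diff) simp
  qed
  then have "((\<lambda>x. cos (2 * pi * k * (a * x)) * cos (2 * pi * k * (b * x))) has_integral 1/2 * (I + J)) {- T..T}"
    by (simp only:) (intro has_integral_mult_right has_integral_add I J)
  moreover have "\<bar>1/2 * (I + J)\<bar> \<le> 2 * T * trunc_inv (k * \<bar>a - b\<bar>)"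
  proof -
    have "\<bar>a - b\<bar> \<le> \<bar>a + b\<bar>" using assms by linarith
    then have "k * \<bar>a - b\<bar> \<le> k * \<bar>a + b\<bar>" using assms by (intro mult_left_mono) auto
    then have "2 * T * trunc_inv \<bar>k * (a + b)\<bar> \<le> 2 * T * trunc_inv (k * \<bar>a - b\<bar>)"
      using assms by (intro mult_left_mono trunc_inv_antimono) (auto simp: abs_mult)
    moreover have "\<bar>k * (a - b)\<bar> = k * \<bar>a - b\<bar>" using assms by (simp add: abs_mult)
    ultimately have "\<bar>I\<bar> \<le> 2 * T * trunc_inv (k * \<bar>a - b\<bar>)" "\<bar>J\<bar> \<le> 2 * T * trunc_inv (k * \<bar>a - b\<bar>)"
      using I(2) J(2) by auto
    moreover have "\<bar>1/2 * (I + J)\<bar> \<le> X" if "\<bar>I\<bar> \<le> X" "\<bar>J\<bar> \<le> X" for X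
    proof -
      have "\<bar>I + J\<bar> \<le> X + X" using that by (intro order.trans[OF abs_triangle_ineq] add_mono)
      then show ?thesis by (simp add: abs_mult)
    qed
    ultimately show ?thesis by blast
  qed
  ultimately show ?thesis by blast
qed

text \<open>By orthogonality this is, up to a factor \<open>T\<close>, the integral of the product
  of the centred polynomials at \<open>h * x\<close> and \<open>h' * x\<close>.\<close>

definition resonance :: "nat \<Rightarrow> (nat \<Rightarrow> real) \<Rightarrow> nat \<Rightarrow> nat \<Rightarrow> real" where
  "resonance K c h h' = (\<Sum>k\<in>{1..<K}. \<Sum>k'\<in>{1..<K}. if k * h = k' * h' then c k * c k' else 0)"

text \<open>Let \<open>h \<le> h'\<close>. Then \<open>k\<close> is a multiple of
  \<open>b = h' / gcd h h'\<close> and determines \<open>k'\<close>. Bounding one coefficient by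
  \<open>1 / k\<close> and the other by \<open>B\<close> leaves a harmonic sum over multiples of
  \<open>b\<close>, and \<open>1 / b\<close> is the gcd ratio.\<close>

lemma resonance_le:
  assumes B: "\<And>k. k \<in> {1..<K} \<Longrightarrow> \<bar>c k\<bar> \<le> B" and inv: "\<And>k. k \<in> {1..<K} \<Longrightarrow> \<bar>c k\<bar> \<le> 1 / real k"
    and "1 \<le> h" "1 \<le> h'" "0 \<le> B"
  shows "\<bar>resonance K c h h'\<bar> \<le> B * harm K * gcd_ratio h h'"
proof -
  have *: "\<bar>resonance K c h h'\<bar> \<le> B * harm K * gcd_ratio h h'" if "1 \<le> h" "h \<le> h'" for h h'
  proof -
    define b where "b = h' div gcd h h'"
    have h': "1 \<le> h'" using that by simp
    have b: "1 \<le> b" "real b = real h' / real (gcd h h')"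
    proof -
      have "b * gcd h h' = h'" by (simp add: b_def)
      then show "1 \<le> b" using h' by (cases b) auto
      show "real b = real h' / real (gcd h h')" by (simp add: b_def real_of_nat_div)
    qed
    have dvd: "b dvd k" if "k * h = k' * h'" for k k'
    proof -
      have "coprime (h' div gcd h h') (h div gcd h h')"
        using h' div_gcd_coprime[of h' h] by (simp add: gcd.commute)
      moreover have "h' div gcd h h' dvd k * (h div gcd h h')"
      proof -
        have "k * (h div gcd h h') = k' * (h' div gcd h h')"
          using that by (metis div_mult_swap gcd_dvd1 gcd_dvd2)
        then show ?thesis by simp
      qed
      ultimately show ?thesis unfolding b_def by (metis coprime_dvd_mult_left_iff)
    qed
    have inner: "\<bar>\<Sum>k'\<in>{1..<K}. if k * h = k' * h' then c k * c k' else 0\<bar> \<le> (if b dvd k then B * (1 / real k) else 0)"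
      if k: "k \<in> {1..<K}" for k
    proof (cases "\<exists>k'\<in>{1..<K}. k * h = k' * h'")
      case True
      then obtain j where j: "j \<in> {1..<K}" "k * h = j * h'" by blast
      have "(\<Sum>k'\<in>{1..<K}. if k * h = k' * h' then c k * c k' else 0) = (\<Sum>k'\<in>{1..<K}. if k' = j then c k * c k' else 0)"
        using j h' by (intro sum.cong) auto
      also have "\<dots> = c k * c j" using j by simp
      also have "\<bar>\<dots>\<bar> \<le> 1 / real k * B"
        unfolding abs_mult using inv[OF k] B[OF j(1)] by (intro mult_mono) auto
      finally show ?thesis using dvd[OF j(2)] by simp
    next
      case False
      then have "(\<Sum>k'\<in>{1..<K}. if k * h = k' * h' then c k * c k' else 0) = 0"
        by (intro sum.neutral) auto
      then show ?thesis using \<open>0 \<le> B\<close> by simp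
    qed
    have "\<bar>resonance K c h h'\<bar> \<le> (\<Sum>k\<in>{1..<K}. if b dvd k then B * (1 / real k) else 0)"
      unfolding resonance_def by (rule order.trans[OF sum_abs]) (intro sum_mono inner)
    also have "\<dots> = (\<Sum>k\<in>{k\<in>{1..<K}. b dvd k}. B * (1 / real k))"
      by (rule sum.inter_filter[symmetric]) simp
    also have "\<dots> \<le> (\<Sum>k\<in>(*) b ` {1..K}. B * (1 / real k))"
    proof (intro sum_mono2)
      show "{k \<in> {1..<K}. b dvd k} \<subseteq> (*) b ` {1..K}"
      proof safe
        fix k assume "k \<in> {1..<K}" "b dvd k"
        then obtain j where "k = b * j" "1 \<le> j" "b * j < K" by (auto elim!: dvdE)
        moreover from this have "j < K" using b(1)
          by (metis le_less_trans mult.commute mult_le_mono2 nat_mult_1_right)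
        ultimately show "k \<in> (*) b ` {1..K}" by (intro image_eqI[of _ _ j]) auto
      qed
    qed (use \<open>0 \<le> B\<close> in auto)
    also have "\<dots> = (\<Sum>j\<in>{1..K}. B * (1 / real (b * j)))"
      using b(1) by (subst sum.reindex) (auto simp: inj_on_def)
    also have "\<dots> = B * harm K * (1 / real b)"
      by (simp add: harm_def sum_distrib_left sum_distrib_right divide_inverse mult_ac)
    also have "1 / real b = gcd_ratio h h'"
      using that by (simp add: b(2) gcd_ratio_def max_def)
    finally show ?thesis .
  qed
  have sym: "resonance K c h h' = resonance K c h' h"
    unfolding resonance_def by (subst sum.swap) (intro sum.cong refl, auto simp: mult.commute)
  show ?thesis
  proof (cases "h \<le> h'")
    case True
    then show ?thesis using *[of h h'] assms by simp
  next
    case False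
    then show ?thesis using *[of h' h] assms sym by (simp add: gcd_ratio_def gcd.commute max.commute)
  qed
qed

lemma has_integral_trig_poly_centred:
  fixes T :: nat
  assumes "1 \<le> h" "1 \<le> h'"
  shows "((\<lambda>x. (trig_poly K c (real h * x) - c 0) * (trig_poly K c (real h' * x) - c 0)) has_integral
    real T * resonance K c h h') {- real T..real T}"
proof -
  have "((\<lambda>x. \<Sum>k\<in>{1..<K}. \<Sum>k'\<in>{1..<K}. (c k * c k') *
      (cos (2 * pi * real (k * h) * x) * cos (2 * pi * real (k' * h') * x))) has_integral
      (\<Sum>k\<in>{1..<K}. \<Sum>k'\<in>{1..<K}. (c k * c k') * (if k * h = k' * h' then real T else 0))) {- real T..real T}"
    using assms by (intro has_integral_sum has_integral_mult_right has_integral_cos_mult_cos_nat) auto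
  moreover have "(\<lambda>x. \<Sum>k\<in>{1..<K}. \<Sum>k'\<in>{1..<K}. (c k * c k') *
      (cos (2 * pi * real (k * h) * x) * cos (2 * pi * real (k' * h') * x)))
      = (\<lambda>x. (trig_poly K c (real h * x) - c 0) * (trig_poly K c (real h' * x) - c 0))"
    by (simp add: trig_poly_def sum_product mult_ac)
  moreover have "(\<Sum>k\<in>{1..<K}. \<Sum>k'\<in>{1..<K}. (c k * c k') * (if k * h = k' * h' then real T else 0))
      = real T * resonance K c h h'"
    unfolding resonance_def sum_distrib_left by (intro sum.cong) auto
  ultimately show ?thesis by simp
qed

lemma has_integral_trig_poly_mult:
  fixes T :: nat
  assumes "1 \<le> h" "1 \<le> h'"
  shows "((\<lambda>x. trig_poly K c (real h * x) * trig_poly K c (real h' * x)) has_integral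
    2 * real T * (c 0)\<^sup>2 + real T * resonance K c h h') {- real T..real T}"
proof -
  have single: "((\<lambda>x. trig_poly K c (real h * x) - c 0) has_integral 0) {- real T..real T}" if "1 \<le> h" for h
  proof -
    have "((\<lambda>x. \<Sum>k\<in>{1..<K}. c k * cos (2 * pi * real (k * h) * x)) has_integral (\<Sum>k\<in>{1..<K}. c k * 0)) {- real T..real T}"
      using that by (intro has_integral_sum has_integral_mult_right has_integral_cos_nat) auto
    then show ?thesis by (simp add: trig_poly_def mult_ac)
  qed
  define F where "F h x = trig_poly K c (real h * x) - c 0" for h x
  have "((\<lambda>x. (c 0)\<^sup>2 + c 0 * F h x + c 0 * F h' x + F h x * F h' x) has_integral
      2 * real T * (c 0)\<^sup>2 + c 0 * 0 + c 0 * 0 + real T * resonance K c h h') {- real T..real T}"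
    unfolding F_def using assms has_integral_const_real[of "(c 0)\<^sup>2" "- real T" "real T"]
    by (intro has_integral_add has_integral_mult_right single has_integral_trig_poly_centred) auto
  moreover have "(\<lambda>x. (c 0)\<^sup>2 + c 0 * F h x + c 0 * F h' x + F h x * F h' x)
      = (\<lambda>x. trig_poly K c (real h * x) * trig_poly K c (real h' * x))"
    by (simp add: F_def fun_eq_iff power2_eq_square algebra_simps)
  ultimately show ?thesis by simp
qed

section \<open>Integration over squares and weighted sums of coefficients\<close>

definition square_box :: "nat \<Rightarrow> (real \<times> real) set" where
  "square_box T = cbox (- real T, - real T) (real T, real T)"

lemma has_integral_box_mult:
  fixes u v :: "real \<Rightarrow> real"
  assumes "(u has_integral I) {- real T..real T}" "(v has_integral J) {- real T..real T}"
    and "continuous_on UNIV u" "continuous_on UNIV v"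
  shows "((\<lambda>z. u (fst z) * v (snd z)) has_integral (I * J)) (square_box T)"
proof -
  have cont: "continuous_on (square_box T) (\<lambda>z. u (fst z) * v (snd z))"
    by (intro continuous_intros continuous_on_compose2[OF assms(3)] continuous_on_compose2[OF assms(4)]) auto
  then have "((\<lambda>z. u (fst z) * v (snd z)) has_integral
      integral (square_box T) (\<lambda>z. u (fst z) * v (snd z))) (square_box T)"
    unfolding square_box_def by (intro integrable_integral integrable_continuous)
  also have "integral (square_box T) (\<lambda>z. u (fst z) * v (snd z))
      = integral {- real T..real T} (\<lambda>x. integral {- real T..real T} (\<lambda>y. u x * v y))"
    using integral_prod_continuous[of "- real T" "- real T" "real T" "real T" "\<lambda>z. u (fst z) * v (snd z)"] cont
    by (simp add: square_box_def)
  also have "\<dots> = I * J"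
    using assms by (simp add: integral_unique)
  finally show ?thesis .
qed

lemma continuous_on_trig_poly [continuous_intros]:
  "continuous_on S g \<Longrightarrow> continuous_on S (\<lambda>x. trig_poly K c (g x))"
  for S :: "'a :: t2_space set"
  unfolding trig_poly_def by (auto intro!: continuous_intros)

text \<open>Cauchy--Schwarz with weights \<open>\<bar>a k\<bar>\<close>, the sign of
  \<open>a k\<close> being carried by the second factor. For coefficients of size
  \<open>1 / k\<close> the first factor is only a logarithm.\<close>

lemma sum_mult_square_le:
  fixes a u :: "'a \<Rightarrow> real"
  shows "(\<Sum>k\<in>A. a k * u k)\<^sup>2 \<le> (\<Sum>k\<in>A. \<bar>a k\<bar>) * (\<Sum>k\<in>A. \<bar>a k\<bar> * (u k)\<^sup>2)"
proof -
  have "sqrt \<bar>x\<bar> * (sgn x * sqrt \<bar>x\<bar> * v) = x * v" for x v :: real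
  proof -
    have "sqrt \<bar>x\<bar> * (sgn x * sqrt \<bar>x\<bar> * v) = sgn x * (sqrt \<bar>x\<bar> * sqrt \<bar>x\<bar>) * v"
      by (simp only: mult_ac)
    also have "\<dots> = x * v" by (simp add: sgn_mult_abs)
    finally show ?thesis .
  qed
  then have "(\<Sum>k\<in>A. a k * u k)\<^sup>2 = (\<Sum>k\<in>A. sqrt \<bar>a k\<bar> * (sgn (a k) * sqrt \<bar>a k\<bar> * u k))\<^sup>2"
    by (simp only:)
  also have "\<dots> \<le> (\<Sum>k\<in>A. (sqrt \<bar>a k\<bar>)\<^sup>2) * (\<Sum>k\<in>A. (sgn (a k) * sqrt \<bar>a k\<bar> * u k)\<^sup>2)"
    by (rule Cauchy_Schwarz_ineq_sum)
  also have "(\<Sum>k\<in>A. (sgn (a k) * sqrt \<bar>a k\<bar> * u k)\<^sup>2) = (\<Sum>k\<in>A. \<bar>a k\<bar> * (u k)\<^sup>2)"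
    by (intro sum.cong) (auto simp: power_mult_distrib sgn_if)
  finally show ?thesis by simp
qed

text \<open>The three bounds have different uses: the first for the weights in Cauchy--Schwarz, the
  second for terms that already carry a resonance, the third for the terms with the squared mean,
  where the close quadruples must be split off.\<close>

lemma sum_coeff_trunc_inv_le:
  assumes B: "\<And>k. k \<in> {1..<K} \<Longrightarrow> \<bar>c k\<bar> \<le> B" and inv: "\<And>k. k \<in> {1..<K} \<Longrightarrow> \<bar>c k\<bar> \<le> 1 / real k"
    and "0 \<le> B" "0 < \<eta>" "\<eta> \<le> 1" "0 \<le> D"
  shows "(\<Sum>k\<in>{1..<K}. \<bar>c k\<bar>) \<le> harm K"
    and "(\<Sum>k\<in>{1..<K}. \<bar>c k\<bar> * trunc_inv (real k * D)) \<le> harm K * trunc_inv D"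
    and "(\<Sum>k\<in>{1..<K}. \<bar>c k\<bar> * trunc_inv (real k * D))
      \<le> harm K * ((if D \<le> \<eta> then 1 else 0) + B / \<eta> * trunc_inv D)"
proof -
  have harm: "(\<Sum>k\<in>{1..<K}. inverse (real k)) \<le> harm K"
    unfolding harm_def by (intro sum_mono2) auto
  have "(\<Sum>k\<in>{1..<K}. \<bar>c k\<bar>) \<le> (\<Sum>k\<in>{1..<K}. inverse (real k))"
    using inv by (intro sum_mono) (auto simp: divide_inverse)
  with harm show c_harm: "(\<Sum>k\<in>{1..<K}. \<bar>c k\<bar>) \<le> harm K" by linarith
  have "(\<Sum>k\<in>{1..<K}. \<bar>c k\<bar> * trunc_inv (real k * D)) \<le> (\<Sum>k\<in>{1..<K}. \<bar>c k\<bar> * trunc_inv D)"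
  proof (intro sum_mono mult_left_mono trunc_inv_antimono)
    fix k assume "k \<in> {1..<K}"
    then have "1 * D \<le> real k * D" using \<open>0 \<le> D\<close> by (intro mult_right_mono) auto
    then show "D \<le> real k * D" by simp
  qed auto
  also have "\<dots> \<le> harm K * trunc_inv D"
    unfolding sum_distrib_right[symmetric] by (intro mult_right_mono c_harm) auto
  finally show "(\<Sum>k\<in>{1..<K}. \<bar>c k\<bar> * trunc_inv (real k * D)) \<le> harm K * trunc_inv D" .
  have "\<bar>c k\<bar> * trunc_inv (real k * D) \<le> inverse (real k) * ((if D \<le> \<eta> then 1 else 0) + B / \<eta> * trunc_inv D)"
    if k: "k \<in> {1..<K}" for k
  proof -
    have "\<bar>c k\<bar> * trunc_inv (real k * D) \<le> \<bar>c k\<bar> * ((if D \<le> \<eta> then 1 else 0) + trunc_inv D / (real k * \<eta>))"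
      using assms k by (intro mult_left_mono trunc_inv_mult_le) auto
    also have "\<dots> = \<bar>c k\<bar> * (if D \<le> \<eta> then 1 else 0) + \<bar>c k\<bar> * (trunc_inv D / (real k * \<eta>))"
      by (rule distrib_left)
    \<comment> \<open>The near part uses the bound \<open>1 / k\<close>, the far part the bound
      \<open>B\<close>; the latter has its \<open>1 / k\<close> already from the cosine integral, so
      both sums are harmonic.\<close>
    also have "\<dots> \<le> 1 / real k * (if D \<le> \<eta> then 1 else 0) + B * (trunc_inv D / (real k * \<eta>))"
      using B[OF k] inv[OF k] assms by (intro add_mono mult_right_mono) auto
    finally show ?thesis by (simp add: divide_inverse distrib_left mult_ac)
  qed
  then have "(\<Sum>k\<in>{1..<K}. \<bar>c k\<bar> * trunc_inv (real k * D))
      \<le> (\<Sum>k\<in>{1..<K}. inverse (real k)) * ((if D \<le> \<eta> then 1 else 0) + B / \<eta> * trunc_inv D)"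
    unfolding sum_distrib_right by (intro sum_mono)
  also have "\<dots> \<le> harm K * ((if D \<le> \<eta> then 1 else 0) + B / \<eta> * trunc_inv D)"
    using assms by (intro mult_right_mono harm) auto
  finally show "(\<Sum>k\<in>{1..<K}. \<bar>c k\<bar> * trunc_inv (real k * D))
      \<le> harm K * ((if D \<le> \<eta> then 1 else 0) + B / \<eta> * trunc_inv D)" .
qed

section \<open>The second moment\<close>

context convex_gaps
begin

definition smooth_corr :: "nat \<Rightarrow> (real \<Rightarrow> real) \<Rightarrow> real \<times> real \<Rightarrow> real" where
  "smooth_corr N f z = (\<Sum>p\<in>index_pairs N. f (real (fst p) * fst z) * f (\<Delta> p * snd z))"

lemma \<Delta>_nonneg:
  assumes "p \<in> index_pairs N"
  shows "0 \<le> \<Delta> p"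
proof -
  have "0 \<le> c * (real (snd p + fst p) - real (snd p))" using c_pos by simp
  also have "\<dots> \<le> \<Delta> p"
    unfolding \<Delta>_def using assms by (intro gap) (auto simp: index_pairs_def)
  finally show ?thesis .
qed

text \<open>The part with frequency 0 in the second coordinate. Only resonances in the first
  coordinate are left, and the gcd sum bounds them; with the later factor
  \<open>(a 0)\<^sup>2\<close> this is of order \<open>N powr (3/2)\<close> up to
  logarithms.\<close>

lemma second_moment_first_coordinate:
  assumes B: "\<And>k. k \<in> {1..<K} \<Longrightarrow> \<bar>a k\<bar> \<le> B" and inv: "\<And>k. k \<in> {1..<K} \<Longrightarrow> \<bar>a k\<bar> \<le> 1 / real k"
    and "0 \<le> B"
  shows "\<exists>J. ((\<lambda>z. (\<Sum>p\<in>index_pairs N. trig_poly K a (real (fst p) * fst z) - a 0)\<^sup>2) has_integral J) (square_box T)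
    \<and> J \<le> 4 * real T ^ 2 * B * harm K * real N ^ 3 * harm N"
proof (intro exI conjI)
  define P where "P = index_pairs N"
  define u where "u h x = trig_poly K a (real h * x) - a 0" for h x
  have cont: "continuous_on UNIV (u h)" for h unfolding u_def by (intro continuous_intros)
  have int: "((\<lambda>z. \<Sum>p\<in>P. \<Sum>p'\<in>P. (\<lambda>x. u (fst p) x * u (fst p') x) (fst z) * (\<lambda>_. 1) (snd z)) has_integral
      (\<Sum>p\<in>P. \<Sum>p'\<in>P. (real T * resonance K a (fst p) (fst p')) * (2 * real T))) (square_box T)"
    using has_integral_const_real[of "1::real" "- real T" "real T"]
    by (intro has_integral_sum has_integral_box_mult continuous_intros continuous_on_subset[OF cont])
       (auto simp: u_def P_def index_pairs_def intro!: has_integral_trig_poly_centred)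
  have eq: "(\<lambda>z. \<Sum>p\<in>P. \<Sum>p'\<in>P. (\<lambda>x. u (fst p) x * u (fst p') x) (fst z) * (\<lambda>_. 1) (snd z))
      = (\<lambda>z. (\<Sum>p\<in>P. u (fst p) (fst z))\<^sup>2)"
    by (simp add: power2_eq_square sum_product)
  show "((\<lambda>z. (\<Sum>p\<in>index_pairs N. trig_poly K a (real (fst p) * fst z) - a 0)\<^sup>2) has_integral
      (\<Sum>p\<in>P. \<Sum>p'\<in>P. (real T * resonance K a (fst p) (fst p')) * (2 * real T))) (square_box T)"
    using int[unfolded eq] by (simp only: u_def P_def)
  have "(\<Sum>p\<in>P. \<Sum>p'\<in>P. (real T * resonance K a (fst p) (fst p')) * (2 * real T))
      \<le> (\<Sum>p\<in>P. \<Sum>p'\<in>P. (real T * (B * harm K * gcd_ratio (fst p) (fst p'))) * (2 * real T))"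
  proof (intro sum_mono mult_right_mono mult_left_mono)
    fix p p' assume "p \<in> P" "p' \<in> P"
    then have "1 \<le> fst p" "1 \<le> fst p'" by (auto simp: P_def index_pairs_def)
    from resonance_le[where K=K and c=a, OF B inv this \<open>0 \<le> B\<close>]
    show "resonance K a (fst p) (fst p') \<le> B * harm K * gcd_ratio (fst p) (fst p')" by auto
  qed auto
  also have "\<dots> = 2 * real T ^ 2 * B * harm K * (\<Sum>p\<in>P. \<Sum>p'\<in>P. gcd_ratio (fst p) (fst p'))"
    by (simp add: sum_distrib_left power2_eq_square mult_ac)
  also have "\<dots> \<le> 2 * real T ^ 2 * B * harm K * (2 * real N ^ 3 * harm N)"
    unfolding P_def using \<open>0 \<le> B\<close>
    by (intro mult_left_mono sum_index_pairs_gcd_ratio_le) (auto simp: harm_nonneg)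
  finally show "(\<Sum>p\<in>P. \<Sum>p'\<in>P. (real T * resonance K a (fst p) (fst p')) * (2 * real T))
      \<le> 4 * real T ^ 2 * B * harm K * real N ^ 3 * harm N" by (simp add: mult_ac)
qed

text \<open>Each term of the expanded square is a product of one-dimensional integrals. The first
  polynomial is not centred: its mean yields \<open>(a 0)\<^sup>2\<close> for every pair of index
  pairs, and this is the term that requires the count of close increments.\<close>

lemma second_moment_frequency:
  assumes B: "\<And>k. k \<in> {1..<K} \<Longrightarrow> \<bar>a k\<bar> \<le> B" and inv: "\<And>k. k \<in> {1..<K} \<Longrightarrow> \<bar>a k\<bar> \<le> 1 / real k"
    and "0 \<le> B" "1 \<le> T"
  shows "\<exists>J. ((\<lambda>z. (\<Sum>p\<in>index_pairs N. trig_poly K a (real (fst p) * fst z)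
        * cos (2 * pi * real k * (\<Delta> p * snd z)))\<^sup>2) has_integral J) (square_box T)
    \<and> J \<le> (\<Sum>p\<in>index_pairs N. \<Sum>p'\<in>index_pairs N.
        (2 * real T * (a 0)\<^sup>2 + real T * (B * harm K * gcd_ratio (fst p) (fst p')))
        * (2 * real T * trunc_inv (real k * \<bar>\<Delta> p - \<Delta> p'\<bar>)))"
proof -
  define P where "P = index_pairs N"
  define u where "u h x = trig_poly K a (real h * x)" for h x
  define v where "v p x = cos (2 * pi * real k * (\<Delta> p * x))" for p x
  define A where "A p p' = 2 * real T * (a 0)\<^sup>2 + real T * resonance K a (fst p) (fst p')" for p p' :: "nat \<times> nat"
  have "\<forall>p\<in>P. \<forall>p'\<in>P. \<exists>I. ((\<lambda>x. v p x * v p' x) has_integral I) {- real T..real T} \<and>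
      \<bar>I\<bar> \<le> 2 * real T * trunc_inv (real k * \<bar>\<Delta> p - \<Delta> p'\<bar>)"
    unfolding v_def P_def using \<open>1 \<le> T\<close>
    by (intro ballI has_integral_cos_mult_cos_real \<Delta>_nonneg) auto
  then obtain I where I: "\<And>p p'. p \<in> P \<Longrightarrow> p' \<in> P \<Longrightarrow>
      ((\<lambda>x. v p x * v p' x) has_integral I p p') {- real T..real T} \<and>
      \<bar>I p p'\<bar> \<le> 2 * real T * trunc_inv (real k * \<bar>\<Delta> p - \<Delta> p'\<bar>)"
    by metis
  have contu: "continuous_on UNIV (u h)" for h unfolding u_def by (intro continuous_intros)
  have contv: "continuous_on UNIV (v p)" for p unfolding v_def by (intro continuous_intros)
  have "((\<lambda>z. \<Sum>p\<in>P. \<Sum>p'\<in>P. (\<lambda>x. u (fst p) x * u (fst p') x) (fst z) * (\<lambda>x. v p x * v p' x) (snd z)) has_integral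
      (\<Sum>p\<in>P. \<Sum>p'\<in>P. A p p' * I p p')) (square_box T)"
  proof (intro has_integral_sum has_integral_box_mult)
    fix p p' assume p: "p \<in> P" "p' \<in> P"
    then show "((\<lambda>x. u (fst p) x * u (fst p') x) has_integral A p p') {- real T..real T}"
      unfolding u_def A_def by (intro has_integral_trig_poly_mult) (auto simp: P_def index_pairs_def)
    show "((\<lambda>x. v p x * v p' x) has_integral I p p') {- real T..real T}" using I p by blast
    show "continuous_on UNIV (\<lambda>x. u (fst p) x * u (fst p') x)" by (intro continuous_on_mult contu)
    show "continuous_on UNIV (\<lambda>x. v p x * v p' x)" by (intro continuous_on_mult contv)
  qed (auto simp: P_def)
  moreover have "(\<lambda>z. \<Sum>p\<in>P. \<Sum>p'\<in>P. (\<lambda>x. u (fst p) x * u (fst p') x) (fst z) * (\<lambda>x. v p x * v p' x) (snd z))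
      = (\<lambda>z. (\<Sum>p\<in>P. u (fst p) (fst z) * v p (snd z))\<^sup>2)"
    by (simp add: power2_eq_square sum_product mult_ac)
  ultimately have "((\<lambda>z. (\<Sum>p\<in>P. u (fst p) (fst z) * v p (snd z))\<^sup>2) has_integral
      (\<Sum>p\<in>P. \<Sum>p'\<in>P. A p p' * I p p')) (square_box T)" by simp
  moreover have "(\<Sum>p\<in>P. \<Sum>p'\<in>P. A p p' * I p p') \<le> (\<Sum>p\<in>P. \<Sum>p'\<in>P.
        (2 * real T * (a 0)\<^sup>2 + real T * (B * harm K * gcd_ratio (fst p) (fst p')))
        * (2 * real T * trunc_inv (real k * \<bar>\<Delta> p - \<Delta> p'\<bar>)))"
  proof (intro sum_mono)
    fix p p' assume p: "p \<in> P" "p' \<in> P"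
    then have "1 \<le> fst p" "1 \<le> fst p'" by (auto simp: P_def index_pairs_def)
    from resonance_le[where K=K and c=a, OF B inv this \<open>0 \<le> B\<close>]
    have r: "\<bar>real T * resonance K a (fst p) (fst p')\<bar> \<le> real T * (B * harm K * gcd_ratio (fst p) (fst p'))"
      unfolding abs_mult by (simp add: mult_left_mono)
    have "\<bar>A p p'\<bar> \<le> \<bar>2 * real T * (a 0)\<^sup>2\<bar> + \<bar>real T * resonance K a (fst p) (fst p')\<bar>"
      unfolding A_def by (rule abs_triangle_ineq)
    also have "\<dots> \<le> 2 * real T * (a 0)\<^sup>2 + real T * (B * harm K * gcd_ratio (fst p) (fst p'))"
      by (intro add_mono r) auto
    finally have "\<bar>A p p'\<bar> \<le> 2 * real T * (a 0)\<^sup>2 + real T * (B * harm K * gcd_ratio (fst p) (fst p'))" .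
    moreover have "\<bar>I p p'\<bar> \<le> 2 * real T * trunc_inv (real k * \<bar>\<Delta> p - \<Delta> p'\<bar>)" using I p by blast
    ultimately have "\<bar>A p p' * I p p'\<bar> \<le> (2 * real T * (a 0)\<^sup>2 + real T * (B * harm K * gcd_ratio (fst p) (fst p')))
        * (2 * real T * trunc_inv (real k * \<bar>\<Delta> p - \<Delta> p'\<bar>))"
      unfolding abs_mult by (intro mult_mono) auto
    then show "A p p' * I p p' \<le> (2 * real T * (a 0)\<^sup>2 + real T * (B * harm K * gcd_ratio (fst p) (fst p')))
        * (2 * real T * trunc_inv (real k * \<bar>\<Delta> p - \<Delta> p'\<bar>))" by linarith
  qed
  ultimately show ?thesis unfolding u_def v_def P_def by blast
qed

lemma second_moment_frequencies:
  assumes B: "\<And>k. k \<in> {1..<K} \<Longrightarrow> \<bar>a k\<bar> \<le> B" and inv: "\<And>k. k \<in> {1..<K} \<Longrightarrow> \<bar>a k\<bar> \<le> 1 / real k"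
    and "0 \<le> B" "1 \<le> T" "0 < \<eta>" "\<eta> \<le> 1"
  shows "\<exists>J. ((\<lambda>z. \<Sum>k\<in>{1..<K}. \<bar>a k\<bar> * (\<Sum>p\<in>index_pairs N. trig_poly K a (real (fst p) * fst z)
        * cos (2 * pi * real k * (\<Delta> p * snd z)))\<^sup>2) has_integral J) (square_box T)
    \<and> J \<le> 4 * real T ^ 2 * (a 0)\<^sup>2 * harm K *
          (real (card {(p, p'). p \<in> index_pairs N \<and> p' \<in> index_pairs N \<and> \<bar>\<Delta> p - \<Delta> p'\<bar> \<le> \<eta>})
            + B / \<eta> * (real N ^ 3 * (1 + 4 * harm N ^ 2 / c)))
        + 2 * real T ^ 2 * B * harm K ^ 2 * (2 * real N ^ 2 * (harm N + 4 * harm N ^ 3 / c))"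
proof -
  define P where "P = index_pairs N"
  define D where "D p p' = \<bar>\<Delta> p - \<Delta> p'\<bar>" for p p'
  define U where "U k z = (\<Sum>p\<in>P. trig_poly K a (real (fst p) * fst z) * cos (2 * pi * real k * (\<Delta> p * snd z)))" for k z
  define X where "X p p' = 4 * real T ^ 2 * (a 0)\<^sup>2" for p p' :: "nat \<times> nat"
  define Y where "Y p p' = 2 * real T ^ 2 * B * harm K * gcd_ratio (fst p) (fst p')" for p p' :: "nat \<times> nat"
  have XY: "0 \<le> X p p'" "0 \<le> Y p p'" for p p'
    using \<open>0 \<le> B\<close> by (auto simp: X_def Y_def harm_nonneg)
  have "\<forall>k. \<exists>J. ((\<lambda>z. (U k z)\<^sup>2) has_integral J) (square_box T)
      \<and> J \<le> (\<Sum>p\<in>P. \<Sum>p'\<in>P. (X p p' + Y p p') * trunc_inv (real k * D p p'))"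
  proof
    fix k
    obtain J where J: "((\<lambda>z. (U k z)\<^sup>2) has_integral J) (square_box T)"
      "J \<le> (\<Sum>p\<in>P. \<Sum>p'\<in>P. (2 * real T * (a 0)\<^sup>2 + real T * (B * harm K * gcd_ratio (fst p) (fst p')))
        * (2 * real T * trunc_inv (real k * \<bar>\<Delta> p - \<Delta> p'\<bar>)))"
      using second_moment_frequency[where K=K and a=a and N=N and k=k, OF B inv \<open>0 \<le> B\<close> \<open>1 \<le> T\<close>]
      unfolding U_def P_def by blast
    note J(2)
    also have "(\<Sum>p\<in>P. \<Sum>p'\<in>P. (2 * real T * (a 0)\<^sup>2 + real T * (B * harm K * gcd_ratio (fst p) (fst p')))
        * (2 * real T * trunc_inv (real k * \<bar>\<Delta> p - \<Delta> p'\<bar>)))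
        = (\<Sum>p\<in>P. \<Sum>p'\<in>P. (X p p' + Y p p') * trunc_inv (real k * D p p'))"
      by (intro sum.cong refl) (simp add: X_def Y_def D_def power2_eq_square algebra_simps)
    finally show "\<exists>J. ((\<lambda>z. (U k z)\<^sup>2) has_integral J) (square_box T)
      \<and> J \<le> (\<Sum>p\<in>P. \<Sum>p'\<in>P. (X p p' + Y p p') * trunc_inv (real k * D p p'))"
      using J(1) by blast
  qed
  from choice[OF this] obtain J where "\<forall>k. ((\<lambda>z. (U k z)\<^sup>2) has_integral J k) (square_box T)
      \<and> J k \<le> (\<Sum>p\<in>P. \<Sum>p'\<in>P. (X p p' + Y p p') * trunc_inv (real k * D p p'))"
    by blast
  then have J: "((\<lambda>z. (U k z)\<^sup>2) has_integral J k) (square_box T)"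
    "J k \<le> (\<Sum>p\<in>P. \<Sum>p'\<in>P. (X p p' + Y p p') * trunc_inv (real k * D p p'))" for k
    by blast+
  have "((\<lambda>z. \<Sum>k\<in>{1..<K}. \<bar>a k\<bar> * (U k z)\<^sup>2) has_integral (\<Sum>k\<in>{1..<K}. \<bar>a k\<bar> * J k)) (square_box T)"
    by (intro has_integral_sum has_integral_mult_right J) auto
  moreover have "(\<Sum>k\<in>{1..<K}. \<bar>a k\<bar> * J k) \<le> 4 * real T ^ 2 * (a 0)\<^sup>2 * harm K *
          (real (card {(p, p'). p \<in> P \<and> p' \<in> P \<and> D p p' \<le> \<eta>}) + B / \<eta> * (real N ^ 3 * (1 + 4 * harm N ^ 2 / c)))
        + 2 * real T ^ 2 * B * harm K ^ 2 * (2 * real N ^ 2 * (harm N + 4 * harm N ^ 3 / c))"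
  proof -
    have "(\<Sum>k\<in>{1..<K}. \<bar>a k\<bar> * J k)
        \<le> (\<Sum>k\<in>{1..<K}. \<bar>a k\<bar> * (\<Sum>p\<in>P. \<Sum>p'\<in>P. (X p p' + Y p p') * trunc_inv (real k * D p p')))"
      by (intro sum_mono mult_left_mono J) auto
    also have "\<dots> = (\<Sum>k\<in>{1..<K}. \<Sum>p\<in>P. \<Sum>p'\<in>P. (X p p' + Y p p') * (\<bar>a k\<bar> * trunc_inv (real k * D p p')))"
      by (simp add: sum_distrib_left mult_ac)
    also have "\<dots> = (\<Sum>p\<in>P. \<Sum>k\<in>{1..<K}. \<Sum>p'\<in>P. (X p p' + Y p p') * (\<bar>a k\<bar> * trunc_inv (real k * D p p')))"
      by (rule sum.swap)
    also have "\<dots> = (\<Sum>p\<in>P. \<Sum>p'\<in>P. \<Sum>k\<in>{1..<K}. (X p p' + Y p p') * (\<bar>a k\<bar> * trunc_inv (real k * D p p')))"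
      by (rule sum.cong[OF refl], rule sum.swap)
    also have "\<dots> = (\<Sum>p\<in>P. \<Sum>p'\<in>P. X p p' * (\<Sum>k\<in>{1..<K}. \<bar>a k\<bar> * trunc_inv (real k * D p p'))
        + Y p p' * (\<Sum>k\<in>{1..<K}. \<bar>a k\<bar> * trunc_inv (real k * D p p')))"
      unfolding distrib_right sum.distrib sum_distrib_left ..
    also have "\<dots> \<le> (\<Sum>p\<in>P. \<Sum>p'\<in>P. X p p' * (harm K * ((if D p p' \<le> \<eta> then 1 else 0) + B / \<eta> * trunc_inv (D p p')))
        + Y p p' * (harm K * trunc_inv (D p p')))"
      using assms by (intro sum_mono add_mono mult_left_mono XY sum_coeff_trunc_inv_le) (auto simp: D_def)
    also have "\<dots> = 4 * real T ^ 2 * (a 0)\<^sup>2 * harm K *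
          ((\<Sum>p\<in>P. \<Sum>p'\<in>P. if D p p' \<le> \<eta> then 1 else 0) + B / \<eta> * (\<Sum>p\<in>P. \<Sum>p'\<in>P. trunc_inv (D p p')))
        + 2 * real T ^ 2 * B * harm K ^ 2 * (\<Sum>p\<in>P. \<Sum>p'\<in>P. gcd_ratio (fst p) (fst p') * trunc_inv (D p p'))"
      unfolding X_def Y_def
      by (simp add: sum.distrib sum_distrib_left distrib_left power2_eq_square mult_ac)
    also have "(\<Sum>p\<in>P. \<Sum>p'\<in>P. if D p p' \<le> \<eta> then 1 else 0 :: real)
        = real (card {(p, p'). p \<in> P \<and> p' \<in> P \<and> D p p' \<le> \<eta>})"
    proof -
      have "{(p, p'). p \<in> P \<and> p' \<in> P \<and> D p p' \<le> \<eta>} = (SIGMA p:P. {p'\<in>P. D p p' \<le> \<eta>})" by auto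
      then show ?thesis by (simp add: P_def sum.inter_filter[symmetric])
    qed
    also have "4 * real T ^ 2 * (a 0)\<^sup>2 * harm K * (real (card {(p, p'). p \<in> P \<and> p' \<in> P \<and> D p p' \<le> \<eta>})
            + B / \<eta> * (\<Sum>p\<in>P. \<Sum>p'\<in>P. trunc_inv (D p p')))
          + 2 * real T ^ 2 * B * harm K ^ 2 * (\<Sum>p\<in>P. \<Sum>p'\<in>P. gcd_ratio (fst p) (fst p') * trunc_inv (D p p'))
        \<le> 4 * real T ^ 2 * (a 0)\<^sup>2 * harm K * (real (card {(p, p'). p \<in> P \<and> p' \<in> P \<and> D p p' \<le> \<eta>})
            + B / \<eta> * (real N ^ 3 * (1 + 4 * harm N ^ 2 / c)))
          + 2 * real T ^ 2 * B * harm K ^ 2 * (2 * real N ^ 2 * (harm N + 4 * harm N ^ 3 / c))"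
      unfolding P_def D_def using assms
      by (intro add_mono mult_left_mono sum_trunc_inv_le sum_gcd_ratio_trunc_inv_le order.refl)
         (auto simp: harm_nonneg)
    finally show ?thesis .
  qed
  ultimately show ?thesis unfolding U_def P_def D_def by blast
qed

text \<open>Only the factor in the second coordinate is expanded. Its constant term produces the
  mean, which cancels exactly, plus the centred sum in the first coordinate; the inequality
  \<open>(x + y)\<^sup>2 \<le> 2 * x\<^sup>2 + 2 * y\<^sup>2\<close> avoids cross terms with the
  other frequencies.\<close>

lemma second_moment_smooth_corr:
  assumes B: "\<And>k. k \<in> {1..<K} \<Longrightarrow> \<bar>a k\<bar> \<le> B" and inv: "\<And>k. k \<in> {1..<K} \<Longrightarrow> \<bar>a k\<bar> \<le> 1 / real k"
    and "0 \<le> B" "1 \<le> T" "0 < \<eta>" "\<eta> \<le> 1"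
  shows "integral (square_box T) (\<lambda>z. (smooth_corr N (trig_poly K a) z - (a 0)\<^sup>2 * real (card (index_pairs N)))\<^sup>2)
    \<le> 2 * (a 0)\<^sup>2 * (4 * real T ^ 2 * B * harm K * real N ^ 3 * harm N)
      + 2 * harm K * (4 * real T ^ 2 * (a 0)\<^sup>2 * harm K *
          (real (card {(p, p'). p \<in> index_pairs N \<and> p' \<in> index_pairs N \<and> \<bar>\<Delta> p - \<Delta> p'\<bar> \<le> \<eta>})
            + B / \<eta> * (real N ^ 3 * (1 + 4 * harm N ^ 2 / c)))
        + 2 * real T ^ 2 * B * harm K ^ 2 * (2 * real N ^ 2 * (harm N + 4 * harm N ^ 3 / c)))"
proof -
  define P where "P = index_pairs N"
  define t where "t = trig_poly K a"
  define V where "V z = (\<Sum>p\<in>P. t (real (fst p) * fst z) - a 0)" for z :: "real \<times> real"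
  define U where "U k z = (\<Sum>p\<in>P. t (real (fst p) * fst z) * cos (2 * pi * real k * (\<Delta> p * snd z)))" for k z
  obtain J1 where J1: "((\<lambda>z. (V z)\<^sup>2) has_integral J1) (square_box T)"
      "J1 \<le> 4 * real T ^ 2 * B * harm K * real N ^ 3 * harm N"
    using second_moment_first_coordinate[where K=K and a=a and N=N and T=T, OF B inv \<open>0 \<le> B\<close>] unfolding V_def t_def P_def by blast
  obtain J2 where J2: "((\<lambda>z. \<Sum>k\<in>{1..<K}. \<bar>a k\<bar> * (U k z)\<^sup>2) has_integral J2) (square_box T)"
      "J2 \<le> 4 * real T ^ 2 * (a 0)\<^sup>2 * harm K *
          (real (card {(p, p'). p \<in> index_pairs N \<and> p' \<in> index_pairs N \<and> \<bar>\<Delta> p - \<Delta> p'\<bar> \<le> \<eta>})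
            + B / \<eta> * (real N ^ 3 * (1 + 4 * harm N ^ 2 / c)))
        + 2 * real T ^ 2 * B * harm K ^ 2 * (2 * real N ^ 2 * (harm N + 4 * harm N ^ 3 / c))"
    using second_moment_frequencies[where K=K and a=a and N=N, OF assms] unfolding U_def t_def P_def by blast
  have W: "smooth_corr N t z - (a 0)\<^sup>2 * real (card P) = a 0 * V z + (\<Sum>k\<in>{1..<K}. a k * U k z)" for z
  proof -
    have "t (\<Delta> p * snd z) = a 0 + (\<Sum>k\<in>{1..<K}. a k * cos (2 * pi * real k * (\<Delta> p * snd z)))" for p
      by (simp add: t_def trig_poly_def)
    then have "smooth_corr N t z = (\<Sum>p\<in>P. a 0 * t (real (fst p) * fst z))
        + (\<Sum>p\<in>P. \<Sum>k\<in>{1..<K}. a k * (t (real (fst p) * fst z) * cos (2 * pi * real k * (\<Delta> p * snd z))))"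
      unfolding smooth_corr_def P_def
      by (simp add: distrib_left sum.distrib sum_distrib_left mult_ac)
    also have "(\<Sum>p\<in>P. \<Sum>k\<in>{1..<K}. a k * (t (real (fst p) * fst z) * cos (2 * pi * real k * (\<Delta> p * snd z))))
        = (\<Sum>k\<in>{1..<K}. a k * U k z)"
      unfolding U_def sum_distrib_left by (rule sum.swap)
    also have "(\<Sum>p\<in>P. a 0 * t (real (fst p) * fst z)) = a 0 * V z + (a 0)\<^sup>2 * real (card P)"
      unfolding V_def by (simp add: sum_subtractf sum_distrib_left[symmetric] algebra_simps power2_eq_square)
    finally show ?thesis by simp
  qed
  define R where "R z = 2 * (a 0)\<^sup>2 * (V z)\<^sup>2 + 2 * harm K * (\<Sum>k\<in>{1..<K}. \<bar>a k\<bar> * (U k z)\<^sup>2)" for z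
  have R: "(R has_integral (2 * (a 0)\<^sup>2 * J1 + 2 * harm K * J2)) (square_box T)"
    unfolding R_def by (intro has_integral_add has_integral_mult_right J1 J2)
  have "integral (square_box T) (\<lambda>z. (smooth_corr N t z - (a 0)\<^sup>2 * real (card P))\<^sup>2) \<le> integral (square_box T) R"
  proof (rule integral_le)
    show "(\<lambda>z. (smooth_corr N t z - (a 0)\<^sup>2 * real (card P))\<^sup>2) integrable_on square_box T"
      unfolding square_box_def smooth_corr_def t_def
      by (intro integrable_continuous continuous_intros)
    show "R integrable_on square_box T" using R by blast
    fix z
    have "(a 0 * V z + (\<Sum>k\<in>{1..<K}. a k * U k z))\<^sup>2 \<le> 2 * (a 0 * V z)\<^sup>2 + 2 * (\<Sum>k\<in>{1..<K}. a k * U k z)\<^sup>2"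
    proof -
      have "(x + y)\<^sup>2 \<le> 2 * x\<^sup>2 + 2 * y\<^sup>2" for x y :: real
        using sum_squares_bound[of x y] by (simp add: power2_sum)
      then show ?thesis .
    qed
    also have "(\<Sum>k\<in>{1..<K}. a k * U k z)\<^sup>2 \<le> (\<Sum>k\<in>{1..<K}. \<bar>a k\<bar>) * (\<Sum>k\<in>{1..<K}. \<bar>a k\<bar> * (U k z)\<^sup>2)"
      by (rule sum_mult_square_le)
    also have "\<dots> \<le> harm K * (\<Sum>k\<in>{1..<K}. \<bar>a k\<bar> * (U k z)\<^sup>2)"
      using assms by (intro mult_right_mono sum_coeff_trunc_inv_le(1)[of K a B \<eta> 0] sum_nonneg) auto
    finally show "(smooth_corr N t z - (a 0)\<^sup>2 * real (card P))\<^sup>2 \<le> R z"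
      unfolding W R_def by (simp add: power_mult_distrib)
  qed
  also have "integral (square_box T) R = 2 * (a 0)\<^sup>2 * J1 + 2 * harm K * J2"
    using R by (rule integral_unique)
  also have "\<dots> \<le> 2 * (a 0)\<^sup>2 * (4 * real T ^ 2 * B * harm K * real N ^ 3 * harm N)
      + 2 * harm K * (4 * real T ^ 2 * (a 0)\<^sup>2 * harm K *
          (real (card {(p, p'). p \<in> index_pairs N \<and> p' \<in> index_pairs N \<and> \<bar>\<Delta> p - \<Delta> p'\<bar> \<le> \<eta>})
            + B / \<eta> * (real N ^ 3 * (1 + 4 * harm N ^ 2 / c)))
        + 2 * real T ^ 2 * B * harm K ^ 2 * (2 * real N ^ 2 * (harm N + 4 * harm N ^ 3 / c)))"
    by (intro add_mono mult_left_mono J1 J2) (auto simp: harm_nonneg)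
  finally show ?thesis unfolding t_def P_def .
qed

end

lemma harm_le_ln: "1 \<le> n \<Longrightarrow> harm n \<le> 1 + ln (real n)"
  using euler_mascheroni_sequence_decreasing[of 1 n] by (simp add: harm_def)

text \<open>With \<open>r\<close> the cube root of \<open>q\<close>,
  \<open>ln q = 3 * ln r \<le> 3 * r\<close>, and \<open>421 = 1 + 140 * 3\<close>. The sixth power
  covers every product of logarithms in the variance.\<close>

lemma harm_power_le:
  assumes "1 \<le> q"
  shows "harm (q ^ 140) ^ 6 \<le> 421 ^ 6 * (real q)\<^sup>2"
proof -
  define r where "r = real q powr (1/3)"
  have r: "1 \<le> r" using assms by (simp add: r_def ge_one_powr_ge_zero)
  have "ln (real q) = 3 * ln r" using assms by (simp add: r_def ln_powr)
  also have "\<dots> \<le> 3 * r" using ln_bound[of r] r by simp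
  finally have ln: "ln (real q) \<le> 3 * r" .
  have "harm (q ^ 140) \<le> 1 + ln (real (q ^ 140))"
    using assms by (intro harm_le_ln) simp
  also have "\<dots> = 1 + 140 * ln (real q)" using assms by (simp add: ln_realpow)
  also have "\<dots> \<le> 421 * r" using ln r by linarith
  finally have "harm (q ^ 140) ^ 6 \<le> (421 * r) ^ 6"
    by (intro power_mono) (auto simp: harm_nonneg)
  also have "r ^ 6 = (real q)\<^sup>2"
  proof -
    have "r ^ 6 = real q powr (1/3 * 6)"
      using assms by (simp add: r_def powr_power)
    also have "\<dots> = (real q)\<^sup>2" using assms by (simp add: powr_numeral)
    finally show ?thesis .
  qed
  then have "(421 * r) ^ 6 = 421 ^ 6 * (real q)\<^sup>2" by (simp only: power_mult_distrib)
  finally show ?thesis .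
qed

context convex_gaps
begin

text \<open>With \<open>M = q ^ 8\<close> and \<open>\<eta> = 1 / q ^ 16\<close> the terms
  \<open>N\<^sup>2\<close> and \<open>M\<^sup>2 * N * (\<eta> * N)\<close> both equal
  \<open>q ^ 80\<close>, and \<open>N / M = q ^ 32\<close>.\<close>

lemma card_close_pow_le:
  assumes "1 \<le> q" "2 / real q ^ 16 < c"
  shows "real (card {(p, p'). p \<in> index_pairs (q ^ 40) \<and> p' \<in> index_pairs (q ^ 40) \<and> \<bar>\<Delta> p - \<Delta> p'\<bar> \<le> 1 / real q ^ 16})
    \<le> (18 + 48 / c) * real q ^ 112"
proof -
  define x where "x = real q"
  have x: "1 \<le> x" using assms by (simp add: x_def)
  have "real (card {(p, p'). p \<in> index_pairs (q ^ 40) \<and> p' \<in> index_pairs (q ^ 40) \<and> \<bar>\<Delta> p - \<Delta> p'\<bar> \<le> 1 / real q ^ 16})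
      \<le> 6 * real (q ^ 40) / real (q ^ 8) * (real (q ^ 40) ^ 2
        + 2 * real (q ^ 8) ^ 2 * real (q ^ 40) * (1 + 4 * (1 / real q ^ 16) * real (q ^ 40) / c))"
    using assms by (intro card_close_le) (auto intro!: power_increasing)
  also have "\<dots> = 6 * (x ^ 40 / x ^ 8) * ((x ^ 40) ^ 2 + 2 * ((x ^ 8) ^ 2 * x ^ 40 * 1 + 4 * ((x ^ 8) ^ 2 * x ^ 40 * (x ^ 40 / x ^ 16)) / c))"
    by (simp add: x_def algebra_simps)
  also have "x ^ 40 / x ^ 8 = x ^ 32" using x by (simp flip: power_diff)
  also have "x ^ 40 / x ^ 16 = x ^ 24" using x by (simp flip: power_diff)
  also have "(x ^ 8) ^ 2 * x ^ 40 * x ^ 24 = x ^ 80" by (simp flip: power_mult power_add)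
  also have "(x ^ 8) ^ 2 * x ^ 40 * 1 = x ^ 56" by (simp flip: power_mult power_add)
  also have "(x ^ 40) ^ 2 = x ^ 80" by (simp flip: power_mult power_add)
  also have "6 * x ^ 32 * (x ^ 80 + 2 * (x ^ 56 + 4 * x ^ 80 / c)) \<le> 6 * x ^ 32 * (x ^ 80 + 2 * (x ^ 80 + 4 * x ^ 80 / c))"
    using x by (intro mult_left_mono add_mono power_increasing) auto
  also have "\<dots> = (18 + 48 / c) * (x ^ 32 * x ^ 80)" by (simp add: algebra_simps)
  also have "x ^ 32 * x ^ 80 = x ^ 112" by (simp flip: power_add)
  finally show ?thesis by (simp add: x_def)
qed

text \<open>The sizes are \<open>N = q ^ 40\<close>, blocks of length \<open>q ^ 8\<close> and increments nearly equal up to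
  \<open>1 / q ^ 16\<close>, so that no roots occur.  The degree of the cosine
  polynomials only enters through logarithms.\<close>

lemma second_moment_rate:
  fixes T :: nat
  assumes s: "0 < s1" "s1 < s2" and "1 \<le> T"
  obtains C q0 where "1 \<le> q0" and "\<And>q. q0 \<le> q \<Longrightarrow> \<exists>t. continuous_on UNIV t \<and>
      (\<forall>x. \<bar>t x - trapezoid (s1 / real q ^ 20) (s2 / real q ^ 20) x\<bar> \<le> 1 / ((s2 - s1) * real q ^ 50)) \<and>
      integral (square_box T) (\<lambda>z. (smooth_corr (q ^ 40) t z
        - ((s1 + s2) / real q ^ 20)\<^sup>2 * real (card (index_pairs (q ^ 40))))\<^sup>2) \<le> C * real q ^ 78"
proof -
  define \<sigma> where "\<sigma> = s1 + s2"
  define t2 where "t2 = real T ^ 2"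
  \<comment> \<open>Its four summands are, in order, the coefficients of the four parts of the
    variance bound below: frequency 0, close increments, far increments, resonances.\<close>
  define C where "C = 16 * t2 * \<sigma> ^ 3 + 48 * t2 * \<sigma>\<^sup>2 * (3 + 8 / c) + 16 * t2 * \<sigma> ^ 3 * (1 + 4 / c)
    + 16 * t2 * \<sigma> * (1 + 4 / c)"
  have \<sigma>: "0 < \<sigma>" using s by (simp add: \<sigma>_def)
  have t2: "0 \<le> t2" by (simp add: t2_def)
  have C: "0 \<le> C" unfolding C_def using \<sigma> t2 c_pos by (intro add_nonneg_nonneg mult_nonneg_nonneg) auto
  \<comment> \<open>The first entry makes twice the threshold smaller than \<open>c\<close>, the
    second puts the support of the trapezoid within half a period, the third makes \<open>q\<close>
    positive.\<close>
  obtain q0 :: nat where q0: "max (2 / c) (max (2 * s2) 1) < real q0"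
    using reals_Archimedean2 by blast
  have main: "\<exists>t. continuous_on UNIV t \<and>
      (\<forall>x. \<bar>t x - trapezoid (s1 / real q ^ 20) (s2 / real q ^ 20) x\<bar> \<le> 1 / ((s2 - s1) * real q ^ 50)) \<and>
      integral (square_box T) (\<lambda>z. (smooth_corr (q ^ 40) t z
        - ((s1 + s2) / real q ^ 20)\<^sup>2 * real (card (index_pairs (q ^ 40))))\<^sup>2) \<le> (C * 421 ^ 6) * real q ^ 78"
    if "q0 \<le> q" for q
  proof -
    define x where "x = real q"
    define y where "y = x ^ 20"
    define K where "K = q ^ 140"
    define H where "H = (harm K :: real)"
    define h where "h = (harm (q ^ 40) :: real)"
    have "real q0 \<le> x" using that by (simp add: x_def)
    then have x: "1 \<le> x" "2 / c < x" "2 * s2 < x" using q0 by linarith+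
    then have q: "1 \<le> q" by (simp add: x_def)
    have y: "0 < y" "x \<le> y" using x by (auto simp: y_def intro: self_le_power)
    have H: "1 \<le> H" "0 \<le> h" "h \<le> H"
    proof -
      have "harm 1 \<le> (harm K :: real)" unfolding K_def using q by (intro harm_mono) simp
      then show "1 \<le> H" by (simp add: H_def harm_def)
      show "h \<le> H" unfolding h_def H_def K_def using q by (intro harm_mono power_increasing) auto
    qed (simp add: h_def harm_nonneg)
    \<comment> \<open>The resonance term contains \<open>H ^ 3 * h ^ 3\<close>, the largest product
      of logarithms that occurs.\<close>
    have pow: "H ^ i * h ^ j \<le> H ^ 6" if "i + j \<le> 6" for i j
    proof -
      have "H ^ i * h ^ j \<le> H ^ i * H ^ j" using H by (intro mult_left_mono power_mono) auto
      also have "\<dots> = H ^ (i + j)" by (simp add: power_add)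
      also have "\<dots> \<le> H ^ 6" using H that by (intro power_increasing) auto
      finally show ?thesis .
    qed
    have ab: "0 < s1 / y" "s1 / y < s2 / y" "s2 / y \<le> 1 / 2"
      using s y x by (auto simp: divide_strict_right_mono field_simps)
    \<comment> \<open>Taking \<open>r = q ^ 70\<close> and slopes of width
      \<open>(s2 - s1) / q ^ 20\<close> leaves an approximation error of order
      \<open>1 / q ^ 50\<close>, small against the at most \<open>q ^ 80\<close> index pairs even
      after division by \<open>q ^ 40\<close>.\<close>
    obtain a where a: "a 0 = s1 / y + s2 / y"
      "\<And>k. k \<in> {1..<K} \<Longrightarrow> \<bar>a k\<bar> \<le> 2 * (s1 / y + s2 / y)" "\<And>k. k \<in> {1..<K} \<Longrightarrow> \<bar>a k\<bar> \<le> 1 / real k"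
      "\<And>x. \<bar>trig_poly K a x - trapezoid (s1 / y) (s2 / y) x\<bar> \<le> 1 / ((s2 / y - s1 / y) * real (q ^ 70))"
      using trapezoid_trig_poly[OF ab, of "q ^ 70" K] q by (auto simp: K_def simp flip: power_mult)
    have a0: "a 0 = \<sigma> / y" by (simp add: a(1) \<sigma>_def add_divide_distrib)
    have a2: "\<bar>a k\<bar> \<le> 2 * (\<sigma> / y)" if "k \<in> {1..<K}" for k
      using a(2)[OF that] by (simp add: \<sigma>_def add_divide_distrib)
    have a2_nonneg: "0 \<le> 2 * (\<sigma> / y)" using \<sigma> y by simp
    define Q where "Q = real (card {(p, p'). p \<in> index_pairs (q ^ 40) \<and> p' \<in> index_pairs (q ^ 40) \<and> \<bar>\<Delta> p - \<Delta> p'\<bar> \<le> 1 / x ^ 16})"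
    have Q: "Q \<le> (18 + 48 / c) * (y\<^sup>2 * x ^ 72)"
    proof -
      have "2 / x ^ 16 \<le> 2 / x" using x by (intro divide_left_mono self_le_power) auto
      also have "\<dots> < c" using x c_pos by (simp add: field_simps)
      finally have "Q \<le> (18 + 48 / c) * x ^ 112"
        unfolding Q_def x_def using q by (intro card_close_pow_le) auto
      also have "x ^ 112 = y\<^sup>2 * x ^ 72" by (simp add: y_def flip: power_mult power_add)
      finally show ?thesis .
    qed
    have x_le: "x ^ 60 \<le> x ^ 76" "x ^ 72 \<le> x ^ 76" using x by (intro power_increasing; simp)+
    have "integral (square_box T) (\<lambda>z. (smooth_corr (q ^ 40) (trig_poly K a) z - (a 0)\<^sup>2 * real (card (index_pairs (q ^ 40))))\<^sup>2)
      \<le> 2 * (a 0)\<^sup>2 * (4 * real T ^ 2 * (2 * (\<sigma> / y)) * harm K * real (q ^ 40) ^ 3 * harm (q ^ 40))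
      + 2 * harm K * (4 * real T ^ 2 * (a 0)\<^sup>2 * harm K *
          (real (card {(p, p'). p \<in> index_pairs (q ^ 40) \<and> p' \<in> index_pairs (q ^ 40) \<and> \<bar>\<Delta> p - \<Delta> p'\<bar> \<le> 1 / x ^ 16})
            + (2 * (\<sigma> / y)) / (1 / x ^ 16) * (real (q ^ 40) ^ 3 * (1 + 4 * harm (q ^ 40) ^ 2 / c)))
        + 2 * real T ^ 2 * (2 * (\<sigma> / y)) * harm K ^ 2 * (2 * real (q ^ 40) ^ 2 * (harm (q ^ 40) + 4 * harm (q ^ 40) ^ 3 / c)))"
      using \<open>1 \<le> T\<close> x by (intro second_moment_smooth_corr a2 a(3) a2_nonneg) auto
    also have "\<dots> = 2 * (\<sigma> / y)\<^sup>2 * (4 * t2 * (2 * (\<sigma> / y)) * H * (x ^ 40) ^ 3 * h)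
      + 2 * H * (4 * t2 * (\<sigma> / y)\<^sup>2 * H * (Q + (2 * (\<sigma> / y)) * (x ^ 16 * (x ^ 40) ^ 3) * (1 + 4 * h ^ 2 / c))
        + 2 * t2 * (2 * (\<sigma> / y)) * H ^ 2 * (2 * (x ^ 40) ^ 2 * (h + 4 * h ^ 3 / c)))"
      by (simp add: a0 t2_def H_def h_def Q_def x_def)
    \<comment> \<open>Powers of \<open>y\<close> are split off so that they cancel the denominators
      \<open>y\<close> coming from the coefficients.\<close>
    also have "(x ^ 40) ^ 3 = y ^ 3 * x ^ 60" by (simp add: y_def flip: power_mult power_add)
    also have "x ^ 16 * (y ^ 3 * x ^ 60) = y ^ 3 * x ^ 76" by (simp add: y_def flip: power_mult power_add)
    also have "(x ^ 40) ^ 2 = y * x ^ 60" by (simp add: y_def flip: power_mult power_add)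
    also have "2 * (\<sigma> / y)\<^sup>2 * (4 * t2 * (2 * (\<sigma> / y)) * H * (y ^ 3 * x ^ 60) * h)
      + 2 * H * (4 * t2 * (\<sigma> / y)\<^sup>2 * H * (Q + (2 * (\<sigma> / y)) * (y ^ 3 * x ^ 76) * (1 + 4 * h ^ 2 / c))
        + 2 * t2 * (2 * (\<sigma> / y)) * H ^ 2 * (2 * (y * x ^ 60) * (h + 4 * h ^ 3 / c)))
      = 16 * t2 * \<sigma> ^ 3 * (x ^ 60 * (H ^ 1 * h ^ 1)) + 8 * t2 * \<sigma>\<^sup>2 * (Q / y\<^sup>2 * (H ^ 2 * h ^ 0))
        + 16 * t2 * \<sigma> ^ 3 * (x ^ 76 * (H ^ 2 * h ^ 0 + 4 / c * (H ^ 2 * h ^ 2)))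
        + 16 * t2 * \<sigma> * (x ^ 60 * (H ^ 3 * h ^ 1 + 4 / c * (H ^ 3 * h ^ 3)))"
      using y by (simp add: field_simps power2_eq_square power3_eq_cube)
    also have "\<dots> \<le> 16 * t2 * \<sigma> ^ 3 * (x ^ 76 * H ^ 6) + 8 * t2 * \<sigma>\<^sup>2 * ((18 + 48 / c) * x ^ 76 * H ^ 6)
        + 16 * t2 * \<sigma> ^ 3 * (x ^ 76 * (H ^ 6 + 4 / c * H ^ 6))
        + 16 * t2 * \<sigma> * (x ^ 76 * (H ^ 6 + 4 / c * H ^ 6))"
    proof -
      have "Q / y\<^sup>2 \<le> (18 + 48 / c) * x ^ 72" using Q y by (simp add: field_simps)
      also have "\<dots> \<le> (18 + 48 / c) * x ^ 76" using c_pos x_le by (intro mult_left_mono) auto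
      finally have "Q / y\<^sup>2 \<le> (18 + 48 / c) * x ^ 76" .
      moreover have "0 \<le> Q" by (simp add: Q_def)
      ultimately show ?thesis using t2 \<sigma> x H c_pos
        by (intro add_mono mult_left_mono mult_mono pow x_le) (auto intro!: add_nonneg_nonneg)
    qed
    also have "\<dots> = C * x ^ 76 * H ^ 6" by (simp add: C_def algebra_simps)
    \<comment> \<open>The far increments give the exponent 76, the logarithms cost
      \<open>x\<^sup>2\<close>; the result \<open>x ^ 78\<close> still lies \<open>x\<^sup>2\<close>
      below \<open>N\<^sup>2 = x ^ 80\<close>, which makes the normalised variances summable over
      \<open>q\<close>.\<close>
    also have "\<dots> \<le> C * x ^ 76 * (421 ^ 6 * x\<^sup>2)"
      unfolding H_def K_def x_def using C harm_power_le[OF q] by (intro mult_left_mono) auto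
    also have "\<dots> = (C * 421 ^ 6) * (x ^ 76 * x\<^sup>2)" by (simp only: mult_ac)
    also have "x ^ 76 * x\<^sup>2 = x ^ 78" by (simp flip: power_add)
    finally have "integral (square_box T) (\<lambda>z. (smooth_corr (q ^ 40) (trig_poly K a) z
        - (\<sigma> / y)\<^sup>2 * real (card (index_pairs (q ^ 40))))\<^sup>2) \<le> C * 421 ^ 6 * x ^ 78"
      unfolding a0 .
    moreover have "\<bar>trig_poly K a z - trapezoid (s1 / y) (s2 / y) z\<bar> \<le> 1 / ((s2 - s1) * x ^ 50)" for z
    proof -
      have "(s2 / y - s1 / y) * real (q ^ 70) = (s2 - s1) * x ^ 50"
      proof -
        have "real (q ^ 70) = y * x ^ 50" by (simp add: x_def y_def flip: power_add)
        then show ?thesis using y by (simp add: field_simps)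
      qed
      with a(4)[of z] show ?thesis by (simp only:)
    qed
    moreover have "continuous_on UNIV (trig_poly K a)" by (intro continuous_intros)
    ultimately show ?thesis unfolding x_def y_def \<sigma>_def by blast
  qed
  moreover have "1 \<le> q0" using q0 by simp
  ultimately show thesis using that by blast
qed

end

section \<open>Pair correlation as a count of index pairs\<close>

lemma torus_infnorm_le_iff: "torus_infnorm (a, b) \<le> r \<longleftrightarrow> int_dist a \<le> r \<and> int_dist b \<le> r"
proof -
  have "torus_infnorm (a, b) = max (int_dist a) (int_dist b)"
  proof (rule antisym)
    have "bdd_below ((\<lambda>k. infnorm ((a, b) + k)) ` (\<int> \<times> \<int>))"
      by (intro bdd_belowI[of _ 0]) (auto simp: infnorm_pos_le)
    then have "torus_infnorm (a, b) \<le> infnorm ((a, b) + (- of_int (round a), - of_int (round b)))"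
      unfolding torus_infnorm_def by (intro cINF_lower) auto
    then show "torus_infnorm (a, b) \<le> max (int_dist a) (int_dist b)"
      by (simp add: infnorm_pair int_dist_def)
    obtain k where k: "k \<in> \<int> \<times> \<int>" "infnorm ((a, b) + k) = torus_infnorm (a, b)"
      using torus_infnorm_attained by blast
    then obtain i j :: int where "k = (of_int i, of_int j)" by (auto elim!: Ints_cases)
    with k have "torus_infnorm (a, b) = infnorm (a + of_int i, b + of_int j)" by simp
    moreover have "int_dist a \<le> \<bar>a + of_int i\<bar>" "int_dist b \<le> \<bar>b + of_int j\<bar>"
      using int_dist_le[of a "- i"] int_dist_le[of b "- j"] by simp_all
    ultimately show "max (int_dist a) (int_dist b) \<le> torus_infnorm (a, b)"
      by (auto simp: infnorm_pair)
  qed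
  then show ?thesis by simp
qed

lemma int_dist_frac_diff: "int_dist (frac a - frac b) = int_dist (a - b)"
proof -
  have "frac a - frac b = (a - b) + of_int (\<lfloor>b\<rfloor> - \<lfloor>a\<rfloor>)" by (simp add: frac_def)
  then show ?thesis by (simp only: int_dist_add_of_int)
qed

context convex_gaps
begin

definition box_count :: "nat \<Rightarrow> real \<Rightarrow> real \<times> real \<Rightarrow> nat" where
  "box_count N r z = card {p\<in>index_pairs N. int_dist (real (fst p) * fst z) \<le> r \<and> int_dist (\<Delta> p * snd z) \<le> r}"

lemma box_count_mono: "N \<le> N' \<Longrightarrow> r \<le> r' \<Longrightarrow> box_count N r z \<le> box_count N' r' z"
  unfolding box_count_def by (intro card_mono) (auto simp: index_pairs_def)

lemma box_count_eq_sum: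
  "real (box_count N r z) = (\<Sum>p\<in>index_pairs N.
    if int_dist (real (fst p) * fst z) \<le> r \<and> int_dist (\<Delta> p * snd z) \<le> r then 1 else 0)"
  unfolding box_count_def by (simp add: sum.inter_filter[symmetric])

lemma box_count_le_smooth_corr:
  assumes "a < b"
  shows "real (box_count N a z) \<le> smooth_corr N (trapezoid a b) z"
  unfolding box_count_eq_sum smooth_corr_def
  by (intro sum_mono) (use assms in \<open>auto simp: trapezoid_eq_1 intro: mult_nonneg_nonneg\<close>)

lemma smooth_corr_le_box_count:
  assumes "a < b"
  shows "smooth_corr N (trapezoid a b) z \<le> real (box_count N b z)"
  unfolding box_count_eq_sum smooth_corr_def
proof (intro sum_mono)
  fix p
  show "trapezoid a b (real (fst p) * fst z) * trapezoid a b (\<Delta> p * snd z)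
      \<le> (if int_dist (real (fst p) * fst z) \<le> b \<and> int_dist (\<Delta> p * snd z) \<le> b then 1 else 0)"
    using assms by (auto simp: trapezoid_eq_0 intro: mult_le_one trapezoid_le_1)
qed

text \<open>Each index pair stands for two ordered pairs, exchanged by \<open>prod.swap\<close>;
  hence the factor 2.\<close>

lemma pair_corr_inf_eq_box_count:
  "pair_corr_inf s (\<lambda>n. (frac (real n * fst z), frac (y n * snd z))) N
    = 2 * real (box_count N (s / real N powr (1/2)) z) / real N"
proof -
  define r where "r = s / real N powr (1/2)"
  define A where "A = {p\<in>index_pairs N. int_dist (real (fst p) * fst z) \<le> r \<and> int_dist (\<Delta> p * snd z) \<le> r}"
  define up where "up p = (snd p + fst p, snd p)" for p :: "nat \<times> nat"
  define S where "S = {(n, m). n \<in> {1..N} \<and> m \<in> {1..N} \<and> n \<noteq> m \<and>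
      torus_infnorm ((frac (real n * fst z), frac (y n * snd z)) - (frac (real m * fst z), frac (y m * snd z))) \<le> r}"
  have mem: "(n, m) \<in> S \<longleftrightarrow> n \<in> {1..N} \<and> m \<in> {1..N} \<and> n \<noteq> m \<and>
      int_dist ((real n - real m) * fst z) \<le> r \<and> int_dist ((y n - y m) * snd z) \<le> r" for n m
    by (simp add: S_def torus_infnorm_le_iff int_dist_frac_diff left_diff_distrib)
  have swap: "(n, m) \<in> S \<longleftrightarrow> (m, n) \<in> S" for n m
  proof -
    have "int_dist ((a - b) * w) = int_dist ((b - a) * w)" for a b w :: real
      using int_dist_minus[of "(a - b) * w"] by (simp add: algebra_simps)
    then show ?thesis unfolding mem by auto
  qed
  have upA: "up ` A = {w\<in>S. snd w < fst w}"
  proof (intro equalityI subsetI)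
    fix w assume "w \<in> up ` A"
    then show "w \<in> {w\<in>S. snd w < fst w}"
      by (auto simp: up_def mem A_def index_pairs_def \<Delta>_def)
  next
    fix w assume w: "w \<in> {w\<in>S. snd w < fst w}"
    obtain n m where [simp]: "w = (n, m)" by force
    from w have "(n - m, m) \<in> A"
      by (auto simp: mem A_def index_pairs_def \<Delta>_def of_nat_diff)
    with w show "w \<in> up ` A" by (intro image_eqI[of _ _ "(n - m, m)"]) (auto simp: up_def)
  qed
  have "S = up ` A \<union> prod.swap ` up ` A"
  proof
    show "S \<subseteq> up ` A \<union> prod.swap ` up ` A"
    proof
      fix w assume w: "w \<in> S"
      obtain n m where [simp]: "w = (n, m)" by force
      have "n \<noteq> m" using w by (simp add: mem)
      moreover have "(m, n) \<in> S" using w swap by simp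
      ultimately show "w \<in> up ` A \<union> prod.swap ` up ` A"
        using w unfolding upA by (cases "m < n") force+
    qed
    show "up ` A \<union> prod.swap ` up ` A \<subseteq> S"
      unfolding upA using swap by force
  qed
  moreover have "up ` A \<inter> prod.swap ` up ` A = {}" unfolding upA by auto
  moreover have "finite (up ` A)" by (simp add: A_def)
  ultimately have "card S = card (up ` A) + card (prod.swap ` up ` A)"
    by (simp add: card_Un_disjoint)
  also have "card (prod.swap ` up ` A) = card (up ` A)" by (intro card_image) simp
  also have "card (up ` A) = card A" by (intro card_image) (auto simp: inj_on_def up_def)
  finally show ?thesis
    unfolding pair_corr_inf_def S_def[symmetric, unfolded r_def]
    by (simp add: S_def A_def r_def box_count_def)
qed

end

section \<open>Almost sure convergence\<close>

text \<open>The integrals are summable, so by monotone convergence the sum of the squares is finite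
  almost everywhere and its terms tend to 0. The shift by \<open>q0\<close> accounts for the bound
  holding only from there on.\<close>

lemma AE_box_tendsto_zero:
  fixes Y :: "nat \<Rightarrow> real \<times> real \<Rightarrow> real"
  assumes cont: "\<And>q. continuous_on UNIV (Y q)"
    and le: "\<And>q. q0 \<le> q \<Longrightarrow> integral (square_box T) (\<lambda>z. (Y q z)\<^sup>2) \<le> C / (real q)\<^sup>2"
  shows "AE z in lborel. z \<in> square_box T \<longrightarrow> (\<lambda>q. Y q z) \<longlonglongrightarrow> 0"
proof -
  define I where "I q = integral (square_box T) (\<lambda>z. (Y q z)\<^sup>2)" for q
  define f where "f q z = ennreal ((Y (q + q0) z)\<^sup>2) * indicator (square_box T) z" for q z
  have box: "square_box T \<in> sets borel" unfolding square_box_def by simp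
  have meas: "f q \<in> borel_measurable lborel" for q
  proof -
    have "Y (q + q0) \<in> borel_measurable borel" using cont by (rule borel_measurable_continuous_onI)
    then show ?thesis unfolding f_def using box by measurable
  qed
  have int: "((\<lambda>z. (Y q z)\<^sup>2) has_integral I q) (square_box T)" for q
    unfolding I_def square_box_def
    by (intro integrable_integral integrable_continuous continuous_intros continuous_on_subset[OF cont]) auto
  have I_nonneg: "0 \<le> I q" for q by (rule has_integral_nonneg[OF int]) simp
  have "summable (\<lambda>q. I (q + q0))"
  proof (rule summable_comparison_test')
    have "summable (\<lambda>q. inverse (real (q + q0) ^ 2))"
      using summable_ignore_initial_segment[OF inverse_power_summable[of 2, where 'a = real], of q0]
      by (simp only: order.refl of_nat_add)
    then have "summable (\<lambda>q. C * inverse (real (q + q0) ^ 2))" by (rule summable_mult)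
    then show "summable (\<lambda>q. C / (real (q + q0))\<^sup>2)" by (simp add: divide_inverse)
    fix q
    show "norm (I (q + q0)) \<le> C / (real (q + q0))\<^sup>2"
      using le[of "q + q0"] I_nonneg[of "q + q0"] by (simp add: I_def)
  qed
  then have "(\<Sum>q. ennreal (I (q + q0))) \<noteq> top" by (intro ennreal_suminf_neq_top I_nonneg)
  moreover have "(\<integral>\<^sup>+z. f q z \<partial>lborel) = ennreal (I (q + q0))" for q
    unfolding f_def by (intro nn_integral_has_integral_lebesgue' int) auto
  ultimately have "(\<integral>\<^sup>+z. (\<Sum>q. f q z) \<partial>lborel) \<noteq> \<infinity>"
    using meas by (subst nn_integral_suminf) auto
  then have "AE z in lborel. (\<Sum>q. f q z) \<noteq> \<infinity>"
    using meas by (intro nn_integral_PInf_AE) auto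
  then show ?thesis
  proof eventually_elim
    fix z assume z: "(\<Sum>q. f q z) \<noteq> \<infinity>"
    show "z \<in> square_box T \<longrightarrow> (\<lambda>q. Y q z) \<longlonglongrightarrow> 0"
    proof
      assume "z \<in> square_box T"
      with z have "summable (\<lambda>q. (Y (q + q0) z)\<^sup>2)"
        by (intro summable_suminf_not_top) (simp_all add: f_def)
      then have "(\<lambda>q. (Y (q + q0) z)\<^sup>2) \<longlonglongrightarrow> 0" by (rule summable_LIMSEQ_zero)
      then have "(\<lambda>q. sqrt ((Y (q + q0) z)\<^sup>2)) \<longlonglongrightarrow> sqrt 0" by (intro tendsto_real_sqrt)
      then have "(\<lambda>q. Y (q + q0) z) \<longlonglongrightarrow> 0" by (simp add: tendsto_rabs_zero_iff)
      then show "(\<lambda>q. Y q z) \<longlonglongrightarrow> 0" by (rule LIMSEQ_offset)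
    qed
  qed
qed

lemma AE_square_boxes:
  assumes "\<And>T. 1 \<le> T \<Longrightarrow> AE z in lborel. z \<in> square_box T \<longrightarrow> P z"
  shows "AE z in lborel. P z"
proof -
  have "AE z in lborel. \<forall>T. z \<in> square_box (Suc T) \<longrightarrow> P z"
    unfolding AE_all_countable using assms by simp
  then show ?thesis
  proof eventually_elim
    fix z :: "real \<times> real" assume *: "\<forall>T. z \<in> square_box (Suc T) \<longrightarrow> P z"
    obtain T :: nat where "max \<bar>fst z\<bar> \<bar>snd z\<bar> < real T" using reals_Archimedean2 by blast
    then have "z \<in> square_box (Suc T)"
      by (cases z) (auto simp: square_box_def cbox_Pair_eq)
    with * show "P z" by blast
  qed
qed

section \<open>Elementary limits and interpolation between consecutive 40th powers\<close>

lemma tendsto_inverse_power_zero: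
  assumes "0 < k"
  shows "(\<lambda>q. a / real q ^ k) \<longlonglongrightarrow> 0"
proof -
  have "(\<lambda>q. a * (1 / real q) ^ k) \<longlonglongrightarrow> a * 0 ^ k"
    by (intro tendsto_intros lim_1_over_n)
  then show ?thesis using assms by (simp add: power_one_over zero_power)
qed

lemma tendsto_Suc_ratio_power: "(\<lambda>q. (real (q + 1) / real q) ^ k) \<longlonglongrightarrow> 1"
proof -
  have "(\<lambda>q. (1 + 1 / real q) ^ k) \<longlonglongrightarrow> (1 + 0) ^ k"
    by (intro tendsto_intros lim_1_over_n)
  then have "(\<lambda>q. (1 + 1 / real q) ^ k) \<longlonglongrightarrow> 1" by simp
  moreover have "\<forall>\<^sub>F q in sequentially. (1 + 1 / real q) ^ k = (real (q + 1) / real q) ^ k"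
    using eventually_gt_at_top[of 0]
  proof eventually_elim
    fix q :: nat assume "0 < q"
    then have "1 + 1 / real q = real (q + 1) / real q" by (simp add: field_simps)
    then show "(1 + 1 / real q) ^ k = (real (q + 1) / real q) ^ k" by (simp only:)
  qed
  ultimately show ?thesis by (rule Lim_transform_eventually)
qed

lemma power_root_interpolation:
  obtains r :: "nat \<Rightarrow> nat" where "filterlim r at_top at_top" "\<And>N. r N ^ 40 \<le> N" "\<And>N. N < (r N + 1) ^ 40"
proof
  define x where "x N = root 40 (real N)" for N
  define r where "r N = nat \<lfloor>x N\<rfloor>" for N
  have x: "0 \<le> x N" "x N ^ 40 = real N" for N by (simp_all add: x_def)
  have r: "real (r N) \<le> x N" "x N < real (r N + 1)" for N
    using x(1)[of N] by (simp_all add: r_def) linarith+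
  show "r N ^ 40 \<le> N" for N
  proof -
    have "real (r N) ^ 40 \<le> x N ^ 40" using r by (intro power_mono) auto
    then show ?thesis by (simp only: x(2) of_nat_power[symmetric] of_nat_le_iff)
  qed
  show less: "N < (r N + 1) ^ 40" for N
  proof -
    have "x N ^ 40 < real (r N + 1) ^ 40" using r x by (intro power_strict_mono) auto
    then show ?thesis by (simp only: x(2) of_nat_power[symmetric] of_nat_less_iff)
  qed
  show "filterlim r at_top at_top"
    unfolding filterlim_at_top
  proof
    fix k
    show "\<forall>\<^sub>F N in sequentially. k \<le> r N"
      using eventually_ge_at_top[of "k ^ 40"]
    proof eventually_elim
      fix N assume "k ^ 40 \<le> N"
      then have "k ^ 40 < (r N + 1) ^ 40" using less by (rule le_less_trans)
      then have "k < r N + 1" by (rule power_less_imp_less_base) simp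
      then show "k \<le> r N" by simp
    qed
  qed
qed

context convex_gaps
begin

lemma smooth_corr_diff_le:
  assumes f: "\<And>x. \<bar>f x\<bar> \<le> 1" and "\<And>x. \<bar>t x - f x\<bar> \<le> \<epsilon>"
  shows "\<bar>smooth_corr N t z - smooth_corr N f z\<bar> \<le> real N ^ 2 * (2 * \<epsilon> + \<epsilon>\<^sup>2)"
proof -
  have \<epsilon>: "0 \<le> \<epsilon>" using assms(2)[of 0] by (rule order.trans[OF abs_ge_zero])
  have "\<bar>t u * t v - f u * f v\<bar> \<le> 2 * \<epsilon> + \<epsilon>\<^sup>2" for u v
  proof -
    have "t u * t v - f u * f v = (t u - f u) * (t v - f v) + (t u - f u) * f v + f u * (t v - f v)"
      by (simp add: algebra_simps)
    also have "\<bar>\<dots>\<bar> \<le> \<bar>t u - f u\<bar> * \<bar>t v - f v\<bar> + \<bar>t u - f u\<bar> * \<bar>f v\<bar> + \<bar>f u\<bar> * \<bar>t v - f v\<bar>"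
      unfolding abs_mult[symmetric] by linarith
    also have "\<dots> \<le> \<epsilon> * \<epsilon> + \<epsilon> * 1 + 1 * \<epsilon>"
      using \<epsilon> by (intro add_mono mult_mono assms) auto
    finally show ?thesis by (simp add: power2_eq_square)
  qed
  then have "\<bar>smooth_corr N t z - smooth_corr N f z\<bar> \<le> (\<Sum>p\<in>index_pairs N. 2 * \<epsilon> + \<epsilon>\<^sup>2)"
    unfolding smooth_corr_def sum_subtractf[symmetric] by (intro order.trans[OF sum_abs] sum_mono)
  also have "\<dots> = real (card (index_pairs N)) * (2 * \<epsilon> + \<epsilon>\<^sup>2)" by simp
  also have "\<dots> \<le> real N ^ 2 * (2 * \<epsilon> + \<epsilon>\<^sup>2)"
    using \<epsilon> by (intro mult_right_mono card_index_pairs_le) auto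
  finally show ?thesis .
qed

text \<open>The mean per point is \<open>(s1 + s2)\<^sup>2 / N\<close> times
  \<open>N * (N - 1) / 2\<close>, divided by \<open>N\<close>; this explains the limit. The variance
  bound is for the polynomials, so the trapezoids are reached through a uniform error that vanishes
  after normalisation.\<close>

lemma AE_smooth_corr_tendsto:
  assumes s: "0 < s1" "s1 < s2"
  shows "AE z in lborel. (\<lambda>q. smooth_corr (q ^ 40) (trapezoid (s1 / real q ^ 20) (s2 / real q ^ 20)) z / real q ^ 40)
    \<longlonglongrightarrow> (s1 + s2)\<^sup>2 / 2"
proof (rule AE_square_boxes)
  fix T :: nat assume "1 \<le> T"
  define m where "m q = ((s1 + s2) / real q ^ 20)\<^sup>2 * real (card (index_pairs (q ^ 40)))" for q
  define f where "f q = trapezoid (s1 / real q ^ 20) (s2 / real q ^ 20)" for q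
  define d where "d = s2 - s1"
  have d: "0 < d" using s by (simp add: d_def)
  obtain C q0 where q0: "1 \<le> q0" and ex: "\<And>q. q0 \<le> q \<Longrightarrow> \<exists>t. continuous_on UNIV t \<and>
      (\<forall>x. \<bar>t x - f q x\<bar> \<le> 1 / (d * real q ^ 50)) \<and>
      integral (square_box T) (\<lambda>z. (smooth_corr (q ^ 40) t z - m q)\<^sup>2) \<le> C * real q ^ 78"
    unfolding m_def f_def d_def by (rule second_moment_rate[OF s \<open>1 \<le> T\<close>]) blast
  define t where "t q = (SOME t. continuous_on UNIV t \<and>
      (\<forall>x. \<bar>t x - f q x\<bar> \<le> 1 / (d * real q ^ 50)) \<and>
      integral (square_box T) (\<lambda>z. (smooth_corr (q ^ 40) t z - m q)\<^sup>2) \<le> C * real q ^ 78)" for q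
  have t: "continuous_on UNIV (t q)" "\<And>x. \<bar>t q x - f q x\<bar> \<le> 1 / (d * real q ^ 50)"
    "integral (square_box T) (\<lambda>z. (smooth_corr (q ^ 40) (t q) z - m q)\<^sup>2) \<le> C * real q ^ 78"
    if "q0 \<le> q" for q
    using someI_ex[OF ex[OF that]] unfolding t_def[symmetric] by blast+
  \<comment> \<open>Below \<open>q0\<close> nothing is known about \<open>t q\<close>; the value 0
    keeps every \<open>Y q\<close> continuous.\<close>
  define Y where "Y q z = (if q0 \<le> q then (smooth_corr (q ^ 40) (t q) z - m q) / real q ^ 40 else 0)" for q z
  have "AE z in lborel. z \<in> square_box T \<longrightarrow> (\<lambda>q. Y q z) \<longlonglongrightarrow> 0"
  proof (rule AE_box_tendsto_zero)
    show "continuous_on UNIV (Y q)" for q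
    proof (cases "q0 \<le> q")
      case True
      have "continuous_on UNIV (\<lambda>z :: real \<times> real. t q (a * fst z))"
        "continuous_on UNIV (\<lambda>z :: real \<times> real. t q (a * snd z))" for a
        by (rule continuous_on_compose2[OF t(1)[OF True]]; auto intro!: continuous_intros)+
      then have "continuous_on UNIV (\<lambda>z. (smooth_corr (q ^ 40) (t q) z - m q) / real q ^ 40)"
        using True q0 unfolding smooth_corr_def
        by (intro continuous_on_divide continuous_on_diff continuous_on_sum continuous_on_mult
          continuous_on_const) auto
      then show ?thesis using True by (simp add: Y_def)
    qed (simp add: Y_def)
    fix q assume q: "q0 \<le> q"
    then have pos: "0 < real q" using q0 by simp
    have "integral (square_box T) (\<lambda>z. (Y q z)\<^sup>2)
        = integral (square_box T) (\<lambda>z. (1 / real q ^ 80) * (smooth_corr (q ^ 40) (t q) z - m q)\<^sup>2)"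
      using q by (simp add: Y_def power_divide flip: power_mult)
    also have "\<dots> = (1 / real q ^ 80) * integral (square_box T) (\<lambda>z. (smooth_corr (q ^ 40) (t q) z - m q)\<^sup>2)"
      by (rule integral_mult_right)
    also have "\<dots> \<le> (1 / real q ^ 80) * (C * real q ^ 78)"
      by (intro mult_left_mono t q) auto
    also have "\<dots> = C / (real q)\<^sup>2"
    proof -
      have "1 / (u * v) * (C * u) = C / v" if "0 < u" for u v :: real using that by simp
      moreover have "real q ^ 80 = real q ^ 78 * (real q)\<^sup>2" by (simp flip: power_add)
      ultimately show ?thesis using pos by (simp only: zero_less_power)
    qed
    finally show "integral (square_box T) (\<lambda>z. (Y q z)\<^sup>2) \<le> C / (real q)\<^sup>2" .
  qed
  then show "AE z in lborel. z \<in> square_box T \<longrightarrow>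
    (\<lambda>q. smooth_corr (q ^ 40) (trapezoid (s1 / real q ^ 20) (s2 / real q ^ 20)) z / real q ^ 40) \<longlonglongrightarrow> (s1 + s2)\<^sup>2 / 2"
  proof eventually_elim
    fix z assume Y: "z \<in> square_box T \<longrightarrow> (\<lambda>q. Y q z) \<longlonglongrightarrow> 0"
    \<comment> \<open>Replacing the polynomial by the trapezoid: \<open>q ^ 80\<close> pairs with
      error of order \<open>1 / q ^ 50\<close>, divided by \<open>q ^ 40\<close>.\<close>
    define E where "E q = (smooth_corr (q ^ 40) (t q) z - smooth_corr (q ^ 40) (f q) z) / real q ^ 40" for q
    have E: "E \<longlonglongrightarrow> 0"
    proof (rule Lim_null_comparison)
      have "(\<lambda>q. (2 / d) / real q ^ 10 + (1 / d\<^sup>2) / real q ^ 60) \<longlonglongrightarrow> 0 + 0"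
        by (intro tendsto_add tendsto_inverse_power_zero) auto
      then show "(\<lambda>q. (2 / d) / real q ^ 10 + (1 / d\<^sup>2) / real q ^ 60) \<longlonglongrightarrow> 0" by simp
      show "\<forall>\<^sub>F q in sequentially. norm (E q) \<le> (2 / d) / real q ^ 10 + (1 / d\<^sup>2) / real q ^ 60"
        using eventually_ge_at_top[of q0]
      proof eventually_elim
        fix q assume q: "q0 \<le> q"
        then have pos: "0 < real q" using q0 by simp
        have "\<bar>smooth_corr (q ^ 40) (t q) z - smooth_corr (q ^ 40) (f q) z\<bar>
            \<le> real (q ^ 40) ^ 2 * (2 * (1 / (d * real q ^ 50)) + (1 / (d * real q ^ 50))\<^sup>2)"
          using trapezoid_le_1 by (intro smooth_corr_diff_le t(2)[OF q]) (simp add: f_def)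
        also have "\<dots> = real q ^ 40 * ((2 / d) / real q ^ 10 + (1 / d\<^sup>2) / real q ^ 60)"
        proof -
          have "A * A * (2 * (1 / (d * (A * B))) + (1 / (d * (A * B)))\<^sup>2)
              = A * ((2 / d) / B + (1 / d\<^sup>2) / (A * (B * B)))" if "0 < A" "0 < B" for A B :: real
            using that d by (simp add: field_simps power2_eq_square)
          moreover have "real (q ^ 40) ^ 2 = real q ^ 40 * real q ^ 40" "real q ^ 50 = real q ^ 40 * real q ^ 10"
            "real q ^ 60 = real q ^ 40 * (real q ^ 10 * real q ^ 10)"
            by (simp_all flip: power_add power_mult)
          ultimately show ?thesis using pos by (simp only: zero_less_power)
        qed
        finally show "norm (E q) \<le> (2 / d) / real q ^ 10 + (1 / d\<^sup>2) / real q ^ 60"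
          using pos by (simp add: E_def field_simps)
      qed
    qed
    have m: "(\<lambda>q. m q / real q ^ 40) \<longlonglongrightarrow> (s1 + s2)\<^sup>2 / 2"
    proof -
      have "(\<lambda>q. (s1 + s2)\<^sup>2 / 2 - ((s1 + s2)\<^sup>2 / 2) / real q ^ 40) \<longlonglongrightarrow> (s1 + s2)\<^sup>2 / 2 - 0"
        by (intro tendsto_diff tendsto_const tendsto_inverse_power_zero) auto
      then have "(\<lambda>q. (s1 + s2)\<^sup>2 / 2 - ((s1 + s2)\<^sup>2 / 2) / real q ^ 40) \<longlonglongrightarrow> (s1 + s2)\<^sup>2 / 2"
        by (simp only: diff_zero)
      moreover have "\<forall>\<^sub>F q in sequentially. (s1 + s2)\<^sup>2 / 2 - ((s1 + s2)\<^sup>2 / 2) / real q ^ 40 = m q / real q ^ 40"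
        using eventually_gt_at_top[of 0]
      proof eventually_elim
        fix q :: nat assume "0 < q"
        moreover have "(real q ^ 20)\<^sup>2 = real q ^ 40" by (simp flip: power_mult)
        ultimately show "(s1 + s2)\<^sup>2 / 2 - ((s1 + s2)\<^sup>2 / 2) / real q ^ 40 = m q / real q ^ 40"
          by (simp add: m_def card_index_pairs power_divide) (simp add: field_simps)
      qed
      ultimately show ?thesis by (rule Lim_transform_eventually)
    qed
    show "z \<in> square_box T \<longrightarrow>
      (\<lambda>q. smooth_corr (q ^ 40) (trapezoid (s1 / real q ^ 20) (s2 / real q ^ 20)) z / real q ^ 40) \<longlonglongrightarrow> (s1 + s2)\<^sup>2 / 2"
    proof
      assume "z \<in> square_box T"
      with Y have "(\<lambda>q. Y q z) \<longlonglongrightarrow> 0" by blast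
      from tendsto_add[OF tendsto_diff[OF this E] m]
      have "(\<lambda>q. Y q z - E q + m q / real q ^ 40) \<longlonglongrightarrow> (s1 + s2)\<^sup>2 / 2" by simp
      moreover have "\<forall>\<^sub>F q in sequentially. Y q z - E q + m q / real q ^ 40 = smooth_corr (q ^ 40) (f q) z / real q ^ 40"
        using eventually_ge_at_top[of q0] by eventually_elim (simp add: Y_def E_def diff_divide_distrib)
      ultimately show "(\<lambda>q. smooth_corr (q ^ 40) (trapezoid (s1 / real q ^ 20) (s2 / real q ^ 20)) z / real q ^ 40) \<longlonglongrightarrow> (s1 + s2)\<^sup>2 / 2"
        unfolding f_def[symmetric] by (rule Lim_transform_eventually)
    qed
  qed
qed

text \<open>This part is deterministic, for one fixed \<open>z\<close>. The hypothesis involves only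
  rational parameters, so it holds outside a countable union of null sets, and a real
  \<open>s\<close> is squeezed between rationals.\<close>

lemma pair_corr_tendsto:
  assumes lim: "\<And>s1 s2 :: rat. 0 < s1 \<Longrightarrow> s1 < s2 \<Longrightarrow>
      (\<lambda>q. smooth_corr (q ^ 40) (trapezoid (of_rat s1 / real q ^ 20) (of_rat s2 / real q ^ 20)) z / real q ^ 40)
        \<longlonglongrightarrow> (of_rat s1 + of_rat s2)\<^sup>2 / 2"
    and "0 < s"
  shows "(\<lambda>N. 2 * real (box_count N (s / real N powr (1/2)) z) / real N) \<longlonglongrightarrow> (2 * s)\<^sup>2"
proof -
  obtain r :: "nat \<Rightarrow> nat" where r: "filterlim r at_top at_top" "\<And>N. r N ^ 40 \<le> N" "\<And>N. N < (r N + 1) ^ 40"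
    using power_root_interpolation by blast
  define F where "F N = 2 * real (box_count N (s / real N powr (1/2)) z) / real N" for N
  define Z where "Z s1 s2 q = smooth_corr (q ^ 40) (trapezoid (of_rat s1 / real q ^ 20) (of_rat s2 / real q ^ 20)) z / real q ^ 40"
    for s1 s2 :: rat and q
  have sqrt: "q ^ 20 \<le> real N powr (1/2)" "real N powr (1/2) \<le> real (q' ^ 20)"
    if "q ^ 40 \<le> N" "N < q' ^ 40" for q q' N :: nat
  proof -
    have e: "sqrt (real (p ^ 40)) = real (p ^ 20)" for p :: nat
    proof -
      have "real (p ^ 40) = (real (p ^ 20))\<^sup>2" by (simp flip: power_mult)
      then show ?thesis by (simp only: real_sqrt_abs abs_of_nat)
    qed
    have "sqrt (real (q ^ 40)) \<le> sqrt (real N)" "sqrt (real N) \<le> sqrt (real (q' ^ 40))"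
      using that by (simp_all del: of_nat_power)
    then show "q ^ 20 \<le> real N powr (1/2)" "real N powr (1/2) \<le> real (q' ^ 20)"
      by (simp_all only: e powr_half_sqrt of_nat_0_le_iff)
  qed
  \<comment> \<open>Passing from \<open>N\<close> up to \<open>(q + 1) ^ 40\<close> adds index
    pairs, and replacing the root of \<open>N\<close> by \<open>q ^ 20\<close> enlarges the radius;
    the condition on \<open>s1\<close> absorbs the enlargement, and the ratio of the two sizes tends
    to 1.\<close>
  have upper: "F N \<le> 2 * Z s1 s2 (q + 1) * (real (q + 1) / real q) ^ 40"
    if q: "q = r N" "0 < q" "s * (real (q + 1) / real q) ^ 20 \<le> of_rat s1" and s12: "s1 < s2" for N q s1 s2
  proof -
    have N: "q ^ 40 \<le> N" "N < (q + 1) ^ 40" using r(2)[of N] r(3)[of N] q by auto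
    have rat: "(of_rat s1 :: real) < of_rat s2" using s12 by (simp add: of_rat_less)
    have pos: "0 < real N" using N q by (auto intro: gr0I)
    have "s / real N powr (1/2) \<le> s / real (q ^ 20)"
      using sqrt[OF N] q \<open>0 < s\<close> pos by (intro divide_left_mono) auto
    also have "\<dots> \<le> of_rat s1 / real (q + 1) ^ 20"
      using q by (simp add: field_simps power_divide)
    finally have "box_count N (s / real N powr (1/2)) z \<le> box_count ((q + 1) ^ 40) (of_rat s1 / real (q + 1) ^ 20) z"
      using N by (intro box_count_mono) auto
    then have "real (box_count N (s / real N powr (1/2)) z) \<le> real (box_count ((q + 1) ^ 40) (of_rat s1 / real (q + 1) ^ 20) z)"
      by simp
    also have "\<dots> \<le> smooth_corr ((q + 1) ^ 40) (trapezoid (of_rat s1 / real (q + 1) ^ 20) (of_rat s2 / real (q + 1) ^ 20)) z"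
      using rat by (intro box_count_le_smooth_corr divide_strict_right_mono) auto
    also have "\<dots> = Z s1 s2 (q + 1) * real (q + 1) ^ 40" by (simp add: Z_def)
    finally have le: "real (box_count N (s / real N powr (1/2)) z) \<le> Z s1 s2 (q + 1) * real (q + 1) ^ 40" .
    then have "0 \<le> Z s1 s2 (q + 1) * real (q + 1) ^ 40" by (rule order.trans[rotated]) simp
    have "F N \<le> 2 * (Z s1 s2 (q + 1) * real (q + 1) ^ 40) / real N"
      unfolding F_def using le by (intro divide_right_mono mult_left_mono) auto
    also have "\<dots> \<le> 2 * (Z s1 s2 (q + 1) * real (q + 1) ^ 40) / real (q ^ 40)"
      using N q pos \<open>0 \<le> Z s1 s2 (q + 1) * real (q + 1) ^ 40\<close>
      by (intro divide_left_mono of_nat_mono) auto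
    finally show ?thesis by (simp add: power_divide mult.assoc)
  qed
  have lower: "2 * Z s1 s2 q / (real (q + 1) / real q) ^ 40 \<le> F N"
    if q: "q = r N" "0 < q" "of_rat s2 * (real (q + 1) / real q) ^ 20 \<le> s" and s12: "s1 < s2" for N q s1 s2
  proof -
    have N: "q ^ 40 \<le> N" "N < (q + 1) ^ 40" using r(2)[of N] r(3)[of N] q by auto
    have rat: "(of_rat s1 :: real) < of_rat s2" using s12 by (simp add: of_rat_less)
    have pos: "0 < real N" using N q by (auto intro: gr0I)
    have "Z s1 s2 q * real q ^ 40 = smooth_corr (q ^ 40) (trapezoid (of_rat s1 / real q ^ 20) (of_rat s2 / real q ^ 20)) z"
      using q by (simp add: Z_def)
    also have "\<dots> \<le> real (box_count (q ^ 40) (of_rat s2 / real q ^ 20) z)"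
      using rat q by (intro smooth_corr_le_box_count divide_strict_right_mono) auto
    also have "\<dots> \<le> real (box_count N (s / real N powr (1/2)) z)"
    proof -
      have "of_rat s2 / real q ^ 20 \<le> s / real ((q + 1) ^ 20)"
        using q by (simp add: field_simps power_divide)
      also have "\<dots> \<le> s / real N powr (1/2)"
        using sqrt[OF N] \<open>0 < s\<close> pos by (intro divide_left_mono) auto
      finally show ?thesis using N by (intro of_nat_mono box_count_mono) auto
    qed
    finally have le: "Z s1 s2 q * real q ^ 40 \<le> real (box_count N (s / real N powr (1/2)) z)" .
    have "0 \<le> Z s1 s2 q" unfolding Z_def smooth_corr_def
      by (intro divide_nonneg_nonneg sum_nonneg mult_nonneg_nonneg) auto
    then have "2 * (Z s1 s2 q * real q ^ 40) / real ((q + 1) ^ 40) \<le> 2 * (Z s1 s2 q * real q ^ 40) / real N"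
      using N pos by (intro divide_left_mono of_nat_mono) auto
    also have "\<dots> \<le> F N" unfolding F_def using le by (intro divide_right_mono mult_left_mono) auto
    finally show ?thesis using q by (simp add: power_divide field_simps)
  qed
  show ?thesis unfolding F_def[symmetric]
  proof (rule order_tendstoI)
    fix u assume u: "(2 * s)\<^sup>2 < u"
    have "2 * s < sqrt u" using u by (rule real_less_rsqrt)
    then have "s < sqrt u / 2" by simp
    \<comment> \<open>Both rationals lie below half the root of \<open>u\<close>, so the square of
      their sum stays below \<open>u\<close>.\<close>
    then obtain s2 where s2: "s < of_rat s2" "of_rat s2 < sqrt u / 2" using of_rat_dense by blast
    then obtain s1 where s1: "s < of_rat s1" "(of_rat s1 :: real) < of_rat s2" using of_rat_dense by blast
    have "(0 :: real) < of_rat s1" using s1 \<open>0 < s\<close> by linarith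
    then have s12: "0 < s1" "s1 < s2" using s1 by (auto simp: of_rat_less)
    have "(of_rat s1 + of_rat s2)\<^sup>2 < (sqrt u)\<^sup>2"
      using s1 s2 \<open>0 < s\<close> by (intro power_strict_mono) auto
    then have less: "(of_rat s1 + of_rat s2)\<^sup>2 < u"
      using u zero_le_power2[of "2 * s"] by simp
    have "(\<lambda>q. 2 * Z s1 s2 (q + 1) * (real (q + 1) / real q) ^ 40) \<longlonglongrightarrow> 2 * ((of_rat s1 + of_rat s2)\<^sup>2 / 2) * 1"
      unfolding Z_def using LIMSEQ_ignore_initial_segment[OF lim[OF s12], of 1]
      by (intro tendsto_mult tendsto_const tendsto_Suc_ratio_power)
    then have "\<forall>\<^sub>F q in sequentially. 2 * Z s1 s2 (q + 1) * (real (q + 1) / real q) ^ 40 < u"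
      using less by (intro order_tendstoD(2)) auto
    moreover have "(\<lambda>q. s * (real (q + 1) / real q) ^ 20) \<longlonglongrightarrow> s * 1"
      by (intro tendsto_mult tendsto_const tendsto_Suc_ratio_power)
    then have "\<forall>\<^sub>F q in sequentially. s * (real (q + 1) / real q) ^ 20 < of_rat s1"
      using s1 by (intro order_tendstoD(2)) auto
    \<comment> \<open>Quantifying over all \<open>N\<close> with \<open>r N = q\<close> lets the
      divergence of \<open>r\<close> carry an eventual statement about \<open>q\<close> over to
      \<open>N\<close>.\<close>
    ultimately have "\<forall>\<^sub>F q in sequentially. \<forall>N. q = r N \<longrightarrow> F N < u"
      using eventually_gt_at_top[of 0]
    proof eventually_elim
      case (elim q)
      show ?case
      proof (intro allI impI)
        fix N assume "q = r N"
        with elim s12(2) have "F N \<le> 2 * Z s1 s2 (q + 1) * (real (q + 1) / real q) ^ 40"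
          by (intro upper) auto
        with elim show "F N < u" by linarith
      qed
    qed
    from eventually_compose_filterlim[OF this r(1)] show "\<forall>\<^sub>F N in sequentially. F N < u"
      by (rule eventually_mono) auto
  next
    fix u assume u: "u < (2 * s)\<^sup>2"
    \<comment> \<open>The maximum with 0 covers negative \<open>u\<close>.\<close>
    have "sqrt (max u 0) < 2 * s" using u \<open>0 < s\<close> by (intro real_less_lsqrt) auto
    then have "sqrt (max u 0) / 2 < s" by simp
    then obtain s1 where s1: "sqrt (max u 0) / 2 < of_rat s1" "of_rat s1 < s" using of_rat_dense by blast
    then obtain s2 where s2: "(of_rat s1 :: real) < of_rat s2" "of_rat s2 < s" using of_rat_dense by blast
    have nn: "0 \<le> sqrt (max u 0)" by simp
    with s1 have "(0 :: real) < of_rat s1" by linarith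
    then have s12: "0 < s1" "s1 < s2" using s2 by (auto simp: of_rat_less)
    have "(sqrt (max u 0))\<^sup>2 < (of_rat s1 + of_rat s2)\<^sup>2"
      using s1 s2 by (intro power_strict_mono) auto
    then have less: "u < (of_rat s1 + of_rat s2)\<^sup>2" by simp
    have "(\<lambda>q. 2 * Z s1 s2 q / (real (q + 1) / real q) ^ 40) \<longlonglongrightarrow> 2 * ((of_rat s1 + of_rat s2)\<^sup>2 / 2) / 1"
      unfolding Z_def
      by (intro tendsto_divide[OF tendsto_mult[OF tendsto_const lim[OF s12]] tendsto_Suc_ratio_power]) simp
    then have "\<forall>\<^sub>F q in sequentially. u < 2 * Z s1 s2 q / (real (q + 1) / real q) ^ 40"
      using less by (intro order_tendstoD(1)) auto
    moreover have "(\<lambda>q. of_rat s2 * (real (q + 1) / real q) ^ 20) \<longlonglongrightarrow> of_rat s2 * 1"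
      by (intro tendsto_mult tendsto_const tendsto_Suc_ratio_power)
    then have "\<forall>\<^sub>F q in sequentially. of_rat s2 * (real (q + 1) / real q) ^ 20 < s"
      using s2 by (intro order_tendstoD(2)) auto
    ultimately have "\<forall>\<^sub>F q in sequentially. \<forall>N. q = r N \<longrightarrow> u < F N"
      using eventually_gt_at_top[of 0]
    proof eventually_elim
      case (elim q)
      show ?case
      proof (intro allI impI)
        fix N assume "q = r N"
        with elim s12(2) have "2 * Z s1 s2 q / (real (q + 1) / real q) ^ 40 \<le> F N"
          by (intro lower) auto
        with elim show "u < F N" by linarith
      qed
    qed
    from eventually_compose_filterlim[OF this r(1)] show "\<forall>\<^sub>F N in sequentially. u < F N"
      by (rule eventually_mono) auto
  qed
qed

lemma has_inf_MPPC_convex_gaps: "has_inf_MPPC (\<lambda>n. (real n, y n))"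
proof -
  have "AE z in lborel. \<forall>s1 s2 :: rat. 0 < s1 \<longrightarrow> s1 < s2 \<longrightarrow>
      (\<lambda>q. smooth_corr (q ^ 40) (trapezoid (of_rat s1 / real q ^ 20) (of_rat s2 / real q ^ 20)) z / real q ^ 40)
        \<longlonglongrightarrow> (of_rat s1 + of_rat s2)\<^sup>2 / 2"
    unfolding AE_all_countable
    by (auto intro!: AE_smooth_corr_tendsto simp: of_rat_less)
  then show ?thesis
    unfolding has_inf_MPPC_def
  proof eventually_elim
    case (elim z)
    show ?case
      unfolding has_inf_PPC_def fst_conv snd_conv pair_corr_inf_eq_box_count
      using elim by (intro allI impI pair_corr_tendsto) auto
  qed
qed

end

section \<open>The sequence \<open>n log\<^sup>A n\<close>\<close>

definition n_log_pow :: "real \<Rightarrow> real \<Rightarrow> real" where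
  "n_log_pow A x = x * ln x powr A"

lemma n_log_pow_deriv:
  assumes "1 < x"
  shows "(n_log_pow A has_real_derivative ln x powr A + A * ln x powr (A - 1)) (at x)"
  unfolding n_log_pow_def using assms ln_gt_zero[OF assms]
  by (auto intro!: derivative_eq_intros simp: powr_diff field_simps)

lemma n_log_pow_second_deriv:
  assumes "1 < x"
  shows "((\<lambda>x. ln x powr A + A * ln x powr (A - 1)) has_real_derivative
    (A * ln x powr (A - 1) + A * (A - 1) * ln x powr (A - 2)) / x) (at x)"
proof -
  have "((\<lambda>x. ln x powr p) has_real_derivative p * ln x powr (p - of_nat 1) * (1 / x)) (at x)" for p
    using assms by (intro DERIV_fun_powr DERIV_ln_divide) auto
  from DERIV_add[OF this[of A] DERIV_cmult[OF this[of "A - 1"], of A]] show ?thesis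
    by (simp add: add_divide_distrib mult.assoc)
qed

text \<open>Two applications of the mean value theorem turn the second difference into the second
  derivative at some \<zeta> between \<open>x\<close> and \<open>x + 2\<close>. For
  \<open>A \<ge> 1\<close> both of its terms are nonnegative, and \<open>2 \<le> x\<close> keeps the
  logarithm at least \<open>ln 2\<close>.\<close>

lemma n_log_pow_second_difference:
  assumes "1 \<le> A" "2 \<le> x"
  shows "ln 2 powr (A - 1) / (x + 2) \<le> n_log_pow A (x + 2) - 2 * n_log_pow A (x + 1) + n_log_pow A x"
proof -
  define f' where "f' x = ln x powr A + A * ln x powr (A - 1)" for x
  have "\<exists>\<xi>>x. \<xi> < x + 1 \<and> (n_log_pow A ((x + 1) + 1) - n_log_pow A (x + 1)) - (n_log_pow A (x + 1) - n_log_pow A x)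
      = ((x + 1) - x) * (f' (\<xi> + 1) - f' \<xi>)"
    unfolding f'_def using assms
    by (intro MVT2) (auto intro!: DERIV_diff n_log_pow_deriv DERIV_shift[THEN iffD1])
  then obtain \<xi> where \<xi>: "x < \<xi>" "\<xi> < x + 1"
    "(n_log_pow A (x + 2) - n_log_pow A (x + 1)) - (n_log_pow A (x + 1) - n_log_pow A x) = f' (\<xi> + 1) - f' \<xi>"
    by (auto simp: add.assoc)
  have "\<exists>\<zeta>>\<xi>. \<zeta> < \<xi> + 1 \<and> f' (\<xi> + 1) - f' \<xi>
      = ((\<xi> + 1) - \<xi>) * ((A * ln \<zeta> powr (A - 1) + A * (A - 1) * ln \<zeta> powr (A - 2)) / \<zeta>)"
    unfolding f'_def using \<xi> assms by (intro MVT2 n_log_pow_second_deriv) auto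
  then obtain \<zeta> where \<zeta>: "\<xi> < \<zeta>" "\<zeta> < \<xi> + 1"
    "f' (\<xi> + 1) - f' \<xi> = (A * ln \<zeta> powr (A - 1) + A * (A - 1) * ln \<zeta> powr (A - 2)) / \<zeta>"
    by auto
  have "ln 2 powr (A - 1) \<le> 1 * ln \<zeta> powr (A - 1) + 0"
    using assms \<xi> \<zeta> by (auto intro!: powr_mono2)
  also have "\<dots> \<le> A * ln \<zeta> powr (A - 1) + A * (A - 1) * ln \<zeta> powr (A - 2)"
    using assms by (intro add_mono mult_right_mono) auto
  finally have "ln 2 powr (A - 1) / (x + 2) \<le> (A * ln \<zeta> powr (A - 1) + A * (A - 1) * ln \<zeta> powr (A - 2)) / \<zeta>"
    using assms \<xi> \<zeta> by (intro frac_le) auto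
  also have "\<dots> = n_log_pow A (x + 2) - 2 * n_log_pow A (x + 1) + n_log_pow A x"
    using \<xi>(3) \<zeta>(3) by simp
  finally show ?thesis .
qed

text \<open>Near 1 the logarithm has no positive lower bound, so this case is computed directly. As
  \<open>ln 3 / ln 2 \<ge> 1\<close>, the exponent 1 is the worst one, and there the claim is
  \<open>16 < 27\<close>.\<close>

lemma n_log_pow_second_difference_at_1:
  assumes "1 \<le> A"
  shows "0 < n_log_pow A 3 - 2 * n_log_pow A 2 + n_log_pow A 1"
proof -
  have ln2: "0 < ln (2 :: real)" by simp
  have "4 * ln 2 < 3 * ln (3 :: real)"
  proof -
    have "ln (16 :: real) = 4 * ln 2" "ln (27 :: real) = 3 * ln 3"
      using ln_realpow[of "2 :: real" 4] ln_realpow[of "3 :: real" 3] by simp_all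
    moreover have "ln (16 :: real) < ln 27" by simp
    ultimately show ?thesis by linarith
  qed
  then have "4 / 3 < ln 3 / ln (2 :: real)" using ln2 by (simp add: field_simps)
  also have "ln 3 / ln (2 :: real) \<le> (ln 3 / ln 2) powr A"
    using assms powr_mono[of 1 A "ln 3 / ln (2 :: real)"] by simp
  also have "\<dots> = ln 3 powr A / ln 2 powr A" by (simp add: powr_divide)
  finally show ?thesis using ln2 by (simp add: n_log_pow_def field_simps)
qed

lemma convex_gaps_n_log_pow:
  assumes "1 \<le> A"
  shows "\<exists>c. convex_gaps (\<lambda>n. n_log_pow A (real n)) c"
proof -
  define D where "D = n_log_pow A 3 - 2 * n_log_pow A 2 + n_log_pow A 1"
  \<comment> \<open>The three entries serve the first gap, the second difference at
    \<open>n = 1\<close>, where the denominator is 2, and those at \<open>n \<ge> 2\<close>, where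
    \<open>n + 2 \<le> 2 * (n + 1)\<close> costs a factor 2.\<close>
  define c where "c = min (n_log_pow A 2) (min (2 * D) (ln 2 powr (A - 1) / 2))"
  have D: "0 < D" unfolding D_def using assms by (rule n_log_pow_second_difference_at_1)
  have [simp]: "n_log_pow A 1 = 0" by (simp add: n_log_pow_def)
  have "convex_gaps (\<lambda>n. n_log_pow A (real n)) c"
  proof
    show "0 < c" using D by (simp add: c_def n_log_pow_def)
    show "c \<le> n_log_pow A (real 2) - n_log_pow A (real 1)" by (simp add: c_def)
    fix n :: nat assume "1 \<le> n"
    show "c / real (n + 1) \<le> n_log_pow A (real (n + 2)) - 2 * n_log_pow A (real (n + 1)) + n_log_pow A (real n)"
    proof (cases "n = 1")
      case True
      then show ?thesis by (simp add: c_def D_def)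
    next
      case False
      then have n: "2 \<le> n" using \<open>1 \<le> n\<close> by simp
      have "c / real (n + 1) \<le> (ln 2 powr (A - 1) / 2) / real (n + 1)"
        by (intro divide_right_mono) (auto simp: c_def)
      also have "\<dots> \<le> ln 2 powr (A - 1) / (real n + 2)"
        using n by (simp add: field_simps)
      also have "\<dots> \<le> n_log_pow A (real n + 2) - 2 * n_log_pow A (real n + 1) + n_log_pow A (real n)"
        using n assms by (intro n_log_pow_second_difference) auto
      finally show ?thesis by (simp add: add.commute)
    qed
  qed
  then show ?thesis by blast
qed

theorem corollary1p4:
  fixes A :: real
  assumes "A \<ge> 1"
  shows "has_inf_MPPC (\<lambda>n. (real n, real n * ln (real n) powr A))"
proof -
  obtain c where "convex_gaps (\<lambda>n. n_log_pow A (real n)) c"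
    using convex_gaps_n_log_pow[OF assms] by blast
  then interpret convex_gaps "\<lambda>n. n_log_pow A (real n)" c .
  show ?thesis using has_inf_MPPC_convex_gaps by (simp add: n_log_pow_def)
qed

end
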